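(* Let $F:M^3\to\mathbb{R}^4$ be a positive definite affine hypersurface admitting a pointwise $S_3$-symmetry, i.e. such that for every $p\in M^3$ there is an $h$-orthonormal basis $\{e_1,e_2,e_3\}$ of $T_pM$ for which the stabilizer $G_p$ is the group of order 6 generated by the rotation by $\pi$ about $e_1$ and the rotation by $2\pi/3$ about $e_3$. Then $M^3$ is an affine hypersphere, i.e. its affine shape operator $S$ is a multiple of the identity.
   Context: A nondegenerate affine hypersurface $F:M^3\to\mathbb{R}^4$ is an immersion which carries the (equi)affine (Blaschke) normal field $\xi$, inducing $\nabla$, $h$, $S$ by $D_XY=\nabla_XY+h(X,Y)\xi$, $D_X\xi=-SX$ ($D$ the flat connection of $\mathbb{R}^4$), where $h$ (affine metric) is nondegenerate and $|\det(X_1,X_2,X_3,\xi)|=1$ for $h$-orthonormal $X_1,X_2,X_3$; $S$ is the affine shape operator. The difference tensor is $K(X,Y)=\nabla_XY-\widehat\nabla_XY$, with $\widehat\nabla$ the Levi-Civita connection of $h$; $h(K(X,Y),Z)$ is totally symmetric and $\operatorname{trace}K_X=0$. The hypersurface is positive definite if $h$ is positive definite. For $p\in M$, $G_p$ is the group of orientation-preserving linear isometries $g$ of $(T_pM,h)$ satisfying $K(gX,gY)=gK(X,Y)$ and $S(gX)=gS(X)$ for all $X,Y\in T_pM$. *)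

theory Defs
  imports
    "HOL-Analysis.Analysis"
    "HOL-Algebra.Bij"
    "HOL-Algebra.Generated_Groups"
begin

section \<open>Smooth manifolds of dimension three\<close>

text \<open>All sets \<open>S\<close> below are open, so that derivatives at points of \<open>S\<close> are unrestricted ones.\<close>

primrec Ck_on :: "nat \<Rightarrow> 'a::real_normed_vector set \<Rightarrow> ('a \<Rightarrow> 'b::real_normed_vector) \<Rightarrow> bool" where
  "Ck_on 0 S f \<longleftrightarrow> continuous_on S f"
| "Ck_on (Suc k) S f \<longleftrightarrow>
     (\<forall>x\<in>S. f differentiable (at x)) \<and> (\<forall>v. Ck_on k S (\<lambda>x. frechet_derivative f (at x) v))"

definition smooth_on :: "'a::real_normed_vector set \<Rightarrow> ('a \<Rightarrow> 'b::real_normed_vector) \<Rightarrow> bool" where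
  "smooth_on S f \<longleftrightarrow> (\<forall>k. Ck_on k S f)"

text \<open>A chart is a pair of its domain and its coordinate map.\<close>

type_synonym 'm chart = "'m set \<times> ('m \<Rightarrow> real^3)"

definition smooth_manifold3 :: "'m topology \<Rightarrow> 'm chart set \<Rightarrow> bool" where
  "smooth_manifold3 M A \<longleftrightarrow>
     Hausdorff_space M \<and>
     (\<exists>\<B>. countable \<B> \<and> (\<forall>B\<in>\<B>. openin M B) \<and>
        (\<forall>W p. openin M W \<and> p \<in> W \<longrightarrow> (\<exists>B\<in>\<B>. p \<in> B \<and> B \<subseteq> W))) \<and>
     (\<forall>(U, \<phi>)\<in>A. openin M U \<and> open (\<phi> ` U) \<and>
        homeomorphic_map (subtopology M U) (top_of_set (\<phi> ` U)) \<phi>) \<and>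
     (\<Union>(U, \<phi>)\<in>A. U) = topspace M \<and>
     (\<forall>(U, \<phi>)\<in>A. \<forall>(V, \<psi>)\<in>A. smooth_on (\<phi> ` (U \<inter> V)) (\<psi> \<circ> inv_into U \<phi>))"

definition smooth_fun_on :: "'m chart set \<Rightarrow> 'm set \<Rightarrow> ('m \<Rightarrow> 'b::real_normed_vector) \<Rightarrow> bool" where
  "smooth_fun_on A W f \<longleftrightarrow> (\<forall>(U, \<phi>)\<in>A. smooth_on (\<phi> ` (U \<inter> W)) (f \<circ> inv_into U \<phi>))"

definition chart_deriv ::
  "'m chart \<Rightarrow> ('m \<Rightarrow> 'b::real_normed_vector) \<Rightarrow> 'm \<Rightarrow> real^3 \<Rightarrow> 'b" where
  "chart_deriv c f p v = frechet_derivative (f \<circ> inv_into (fst c) (snd c)) (at (snd c p)) v"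

definition immersion ::
  "'m topology \<Rightarrow> 'm chart set \<Rightarrow> ('m \<Rightarrow> real^4) \<Rightarrow> bool" where
  "immersion M A F \<longleftrightarrow> smooth_fun_on A (topspace M) F \<and>
     (\<forall>c\<in>A. \<forall>p\<in>fst c. inj (chart_deriv c F p))"

section \<open>Tangent vectors and vector fields\<close>

text \<open>
  As \<open>F\<close> is an immersion, its differential identifies the tangent space of \<open>M\<close> at \<open>p\<close> with a
  three-dimensional subspace of \<open>real^4\<close>. Tangent vectors are represented by their images under
  this identification, and vector fields by the corresponding maps into \<open>real^4\<close>.
\<close>

definition tangent_space :: "'m chart set \<Rightarrow> ('m \<Rightarrow> real^4) \<Rightarrow> 'm \<Rightarrow> (real^4) set" where
  "tangent_space A F p = (\<Union>c\<in>{c \<in> A. p \<in> fst c}. range (chart_deriv c F p))"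

text \<open>Derivative of \<open>f\<close> at \<open>p\<close> in the direction of the tangent vector \<open>v\<close>.
  For \<open>f\<close> with values in \<open>real^4\<close> this is the flat connection \<open>D\<close>.\<close>

definition dir_deriv ::
  "'m chart set \<Rightarrow> ('m \<Rightarrow> real^4) \<Rightarrow> 'm \<Rightarrow> real^4 \<Rightarrow> ('m \<Rightarrow> 'b::real_normed_vector) \<Rightarrow> 'b" where
  "dir_deriv A F p v f = (THE d. \<exists>c\<in>A. p \<in> fst c \<and>
     (\<exists>u. chart_deriv c F p u = v \<and> chart_deriv c f p u = d))"

definition vector_field ::
  "'m topology \<Rightarrow> 'm chart set \<Rightarrow> ('m \<Rightarrow> real^4) \<Rightarrow> 'm set \<Rightarrow> ('m \<Rightarrow> real^4) \<Rightarrow> bool" where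
  "vector_field M A F W Y \<longleftrightarrow> openin M W \<and> smooth_fun_on A W Y \<and>
     (\<forall>q\<in>W. Y q \<in> tangent_space A F q)"

text \<open>The differential of \<open>F\<close> sends \<open>[X, Y]\<close> to \<open>X(Y F) - Y(X F)\<close>, and \<open>Y F\<close> is the
  representation of \<open>Y\<close> itself.\<close>

definition lie_bracket ::
  "'m chart set \<Rightarrow> ('m \<Rightarrow> real^4) \<Rightarrow> ('m \<Rightarrow> real^4) \<Rightarrow> ('m \<Rightarrow> real^4) \<Rightarrow> 'm \<Rightarrow> real^4" where
  "lie_bracket A F X Y p = dir_deriv A F p (X p) Y - dir_deriv A F p (Y p) X"

section \<open>The structure induced by a transversal field\<close>

definition tangential_part ::
  "'m chart set \<Rightarrow> ('m \<Rightarrow> real^4) \<Rightarrow> ('m \<Rightarrow> real^4) \<Rightarrow> 'm \<Rightarrow> real^4 \<Rightarrow> real^4" where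
  "tangential_part A F \<xi> p z = (THE t. t \<in> tangent_space A F p \<and> (\<exists>a. z = t + a *\<^sub>R \<xi> p))"

definition transversal_part ::
  "'m chart set \<Rightarrow> ('m \<Rightarrow> real^4) \<Rightarrow> ('m \<Rightarrow> real^4) \<Rightarrow> 'm \<Rightarrow> real^4 \<Rightarrow> real" where
  "transversal_part A F \<xi> p z = (THE a. \<exists>t\<in>tangent_space A F p. z = t + a *\<^sub>R \<xi> p)"

text \<open>\<open>\<nabla>\<^sub>v Y\<close> at \<open>p\<close>, for \<open>v\<close> tangent at \<open>p\<close> and \<open>Y\<close> a vector field near \<open>p\<close>.\<close>

definition induced_connection ::
  "'m chart set \<Rightarrow> ('m \<Rightarrow> real^4) \<Rightarrow> ('m \<Rightarrow> real^4) \<Rightarrow> 'm \<Rightarrow> real^4 \<Rightarrow> ('m \<Rightarrow> real^4) \<Rightarrow> real^4" where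
  "induced_connection A F \<xi> p v Y = tangential_part A F \<xi> p (dir_deriv A F p v Y)"

text \<open>The affine metric at \<open>p\<close>; its value does not depend on the local extension \<open>Y\<close> of \<open>w\<close>.\<close>

definition affine_metric ::
  "'m topology \<Rightarrow> 'm chart set \<Rightarrow> ('m \<Rightarrow> real^4) \<Rightarrow> ('m \<Rightarrow> real^4) \<Rightarrow> 'm \<Rightarrow> real^4 \<Rightarrow> real^4 \<Rightarrow> real" where
  "affine_metric M A F \<xi> p v w = (THE r. \<exists>W Y. p \<in> W \<and> vector_field M A F W Y \<and> Y p = w \<and>
     r = transversal_part A F \<xi> p (dir_deriv A F p v Y))"

definition shape_operator ::
  "'m chart set \<Rightarrow> ('m \<Rightarrow> real^4) \<Rightarrow> ('m \<Rightarrow> real^4) \<Rightarrow> 'm \<Rightarrow> real^4 \<Rightarrow> real^4" where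
  "shape_operator A F \<xi> p v = - dir_deriv A F p v \<xi>"

definition induced_volume :: "('m \<Rightarrow> real^4) \<Rightarrow> 'm \<Rightarrow> real^4 \<Rightarrow> real^4 \<Rightarrow> real^4 \<Rightarrow> real" where
  "induced_volume \<xi> p u v w = det (vector [u, v, w, \<xi> p] :: real^4^4)"

text \<open>Orthonormality for a possibly indefinite \<open>h\<close>.\<close>

definition orthonormal_frame ::
  "(real^4) set \<Rightarrow> (real^4 \<Rightarrow> real^4 \<Rightarrow> real) \<Rightarrow> real^4 \<Rightarrow> real^4 \<Rightarrow> real^4 \<Rightarrow> bool" where
  "orthonormal_frame T h e1 e2 e3 \<longleftrightarrow> e1 \<in> T \<and> e2 \<in> T \<and> e3 \<in> T \<and>
     \<bar>h e1 e1\<bar> = 1 \<and> \<bar>h e2 e2\<bar> = 1 \<and> \<bar>h e3 e3\<bar> = 1 \<and>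
     h e1 e2 = 0 \<and> h e2 e1 = 0 \<and> h e1 e3 = 0 \<and> h e3 e1 = 0 \<and> h e2 e3 = 0 \<and> h e3 e2 = 0"

text \<open>Nondegenerate hypersurface \<open>F\<close> with its Blaschke normal field \<open>\<xi>\<close>.\<close>

definition affine_hypersurface ::
  "'m topology \<Rightarrow> 'm chart set \<Rightarrow> ('m \<Rightarrow> real^4) \<Rightarrow> ('m \<Rightarrow> real^4) \<Rightarrow> bool" where
  "affine_hypersurface M A F \<xi> \<longleftrightarrow>
     smooth_manifold3 M A \<and> immersion M A F \<and> smooth_fun_on A (topspace M) \<xi> \<and>
     (\<forall>p\<in>topspace M.
        \<xi> p \<notin> tangent_space A F p \<and>
        (\<forall>v\<in>tangent_space A F p. dir_deriv A F p v \<xi> \<in> tangent_space A F p) \<and>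
        (\<forall>v\<in>tangent_space A F p.
           (\<forall>w\<in>tangent_space A F p. affine_metric M A F \<xi> p v w = 0) \<longrightarrow> v = 0) \<and>
        (\<forall>e1 e2 e3. orthonormal_frame (tangent_space A F p) (affine_metric M A F \<xi> p) e1 e2 e3 \<longrightarrow>
           \<bar>induced_volume \<xi> p e1 e2 e3\<bar> = 1))"

definition positive_definite ::
  "'m topology \<Rightarrow> 'm chart set \<Rightarrow> ('m \<Rightarrow> real^4) \<Rightarrow> ('m \<Rightarrow> real^4) \<Rightarrow> bool" where
  "positive_definite M A F \<xi> \<longleftrightarrow>
     (\<forall>p\<in>topspace M. \<forall>v\<in>tangent_space A F p. v \<noteq> 0 \<longrightarrow> 0 < affine_metric M A F \<xi> p v v)"

section \<open>Levi-Civita connection and difference tensor\<close>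

definition affine_connection ::
  "'m topology \<Rightarrow> 'm chart set \<Rightarrow> ('m \<Rightarrow> real^4) \<Rightarrow>
   ('m \<Rightarrow> real^4 \<Rightarrow> ('m \<Rightarrow> real^4) \<Rightarrow> real^4) \<Rightarrow> bool" where
  "affine_connection M A F N \<longleftrightarrow>
     (\<forall>W Y. vector_field M A F W Y \<longrightarrow>
        (\<forall>X. vector_field M A F W X \<longrightarrow> vector_field M A F W (\<lambda>q. N q (X q) Y)) \<and>
        (\<forall>p\<in>W. \<forall>v\<in>tangent_space A F p.
           N p v Y \<in> tangent_space A F p \<and>
           (\<forall>w\<in>tangent_space A F p. \<forall>a b. N p (a *\<^sub>R v + b *\<^sub>R w) Y = a *\<^sub>R N p v Y + b *\<^sub>R N p w Y) \<and>
           (\<forall>Z. vector_field M A F W Z \<longrightarrow> N p v (\<lambda>q. Y q + Z q) = N p v Y + N p v Z) \<and>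
           (\<forall>f :: 'm \<Rightarrow> real. smooth_fun_on A W f \<longrightarrow>
              N p v (\<lambda>q. f q *\<^sub>R Y q) = dir_deriv A F p v f *\<^sub>R Y p + f p *\<^sub>R N p v Y)))"

definition levi_civita_connection ::
  "'m topology \<Rightarrow> 'm chart set \<Rightarrow> ('m \<Rightarrow> real^4) \<Rightarrow> ('m \<Rightarrow> real^4 \<Rightarrow> real^4 \<Rightarrow> real) \<Rightarrow>
   ('m \<Rightarrow> real^4 \<Rightarrow> ('m \<Rightarrow> real^4) \<Rightarrow> real^4) \<Rightarrow> bool" where
  "levi_civita_connection M A F h N \<longleftrightarrow> affine_connection M A F N \<and>
     (\<forall>W X Y. vector_field M A F W X \<and> vector_field M A F W Y \<longrightarrow>
        (\<forall>p\<in>W. N p (X p) Y - N p (Y p) X = lie_bracket A F X Y p)) \<and>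
     (\<forall>W Y Z. vector_field M A F W Y \<and> vector_field M A F W Z \<longrightarrow>
        (\<forall>p\<in>W. \<forall>v\<in>tangent_space A F p.
           dir_deriv A F p v (\<lambda>q. h q (Y q) (Z q)) = h p (N p v Y) (Z p) + h p (Y p) (N p v Z)))"

text \<open>Tensorial in \<open>w\<close>, so that again any local extension \<open>Y\<close> of \<open>w\<close> may be used.\<close>

definition difference_tensor ::
  "'m topology \<Rightarrow> 'm chart set \<Rightarrow> ('m \<Rightarrow> real^4) \<Rightarrow> ('m \<Rightarrow> real^4) \<Rightarrow>
   ('m \<Rightarrow> real^4 \<Rightarrow> ('m \<Rightarrow> real^4) \<Rightarrow> real^4) \<Rightarrow> 'm \<Rightarrow> real^4 \<Rightarrow> real^4 \<Rightarrow> real^4" where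
  "difference_tensor M A F \<xi> N p v w =
     (THE k. \<exists>W Y. p \<in> W \<and> vector_field M A F W Y \<and> Y p = w \<and>
        k = induced_connection A F \<xi> p v Y - N p v Y)"

section \<open>Pointwise symmetry\<close>

text \<open>
  Maps of the tangent space are taken extensional, as in \<^const>\<open>BijGroup\<close>. Preservation of
  orientation is expressed by the sign of the induced volume form, which does not vanish.
\<close>

definition symmetry_group ::
  "'m topology \<Rightarrow> 'm chart set \<Rightarrow> ('m \<Rightarrow> real^4) \<Rightarrow> ('m \<Rightarrow> real^4) \<Rightarrow>
   ('m \<Rightarrow> real^4 \<Rightarrow> ('m \<Rightarrow> real^4) \<Rightarrow> real^4) \<Rightarrow> 'm \<Rightarrow> (real^4 \<Rightarrow> real^4) set" where
  "symmetry_group M A F \<xi> N p =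
     (let T = tangent_space A F p; h = affine_metric M A F \<xi> p; \<theta> = induced_volume \<xi> p;
          K = difference_tensor M A F \<xi> N p; S = shape_operator A F \<xi> p
      in {g \<in> Bij T.
           (\<forall>u\<in>T. \<forall>v\<in>T. \<forall>a b. g (a *\<^sub>R u + b *\<^sub>R v) = a *\<^sub>R g u + b *\<^sub>R g v) \<and>
           (\<forall>u\<in>T. \<forall>v\<in>T. h (g u) (g v) = h u v) \<and>
           (\<forall>u\<in>T. \<forall>v\<in>T. \<forall>w\<in>T. 0 < \<theta> u v w \<longrightarrow> 0 < \<theta> (g u) (g v) (g w)) \<and>
           (\<forall>u\<in>T. \<forall>v\<in>T. K (g u) (g v) = g (K u v)) \<and>
           (\<forall>u\<in>T. S (g u) = g (S u))})"

text \<open>Rotation by \<open>t\<close> about \<open>c\<close>, turning \<open>a\<close> towards \<open>b\<close>, for an orthonormal basis \<open>a, b, c\<close> of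
  \<open>T\<close> with respect to the positive definite \<open>h\<close>.\<close>

definition rotation_about ::
  "(real^4) set \<Rightarrow> (real^4 \<Rightarrow> real^4 \<Rightarrow> real) \<Rightarrow> real^4 \<Rightarrow> real^4 \<Rightarrow> real^4 \<Rightarrow> real \<Rightarrow> real^4 \<Rightarrow> real^4" where
  "rotation_about T h c a b t = (\<lambda>v\<in>T. h v c *\<^sub>R c +
     h v a *\<^sub>R (cos t *\<^sub>R a + sin t *\<^sub>R b) + h v b *\<^sub>R (- sin t *\<^sub>R a + cos t *\<^sub>R b))"

definition pointwise_S3_symmetry ::
  "'m topology \<Rightarrow> 'm chart set \<Rightarrow> ('m \<Rightarrow> real^4) \<Rightarrow> ('m \<Rightarrow> real^4) \<Rightarrow>
   ('m \<Rightarrow> real^4 \<Rightarrow> ('m \<Rightarrow> real^4) \<Rightarrow> real^4) \<Rightarrow> bool" where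
  "pointwise_S3_symmetry M A F \<xi> N \<longleftrightarrow>
     (\<forall>p\<in>topspace M.
        let T = tangent_space A F p; h = affine_metric M A F \<xi> p
        in \<exists>e1 e2 e3. orthonormal_frame T h e1 e2 e3 \<and>
             symmetry_group M A F \<xi> N p = generate (BijGroup T)
               {rotation_about T h e1 e2 e3 pi, rotation_about T h e3 e1 e2 (2 * pi / 3)})"

text \<open>On connected \<open>M\<close> the second condition says that the factor \<open>lam\<close> is a constant.\<close>

definition affine_hypersphere ::
  "'m topology \<Rightarrow> 'm chart set \<Rightarrow> ('m \<Rightarrow> real^4) \<Rightarrow> ('m \<Rightarrow> real^4) \<Rightarrow> bool" where
  "affine_hypersphere M A F \<xi> \<longleftrightarrow> (\<exists>lam :: 'm \<Rightarrow> real.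
     (\<forall>p\<in>topspace M. \<forall>v\<in>tangent_space A F p. shape_operator A F \<xi> p v = lam p *\<^sub>R v) \<and>
     (\<forall>p q. connected_component_of M p q \<longrightarrow> lam p = lam q))"

end

theory Submission
  imports Defs
begin

text \<open>
  At every point the symmetry forces \<open>S = diag(s, s, t)\<close> and, for the covariant derivative
  \<open>C = \<nabla>h\<close>, \<open>C = l Re (x + iy)\<^sup>3\<close>; here \<open>l \<noteq> 0\<close>, as otherwise the half turn about \<open>e3\<close> would
  be a further symmetry. By the Ricci identity for \<open>h\<close> and the Gauss equation, the sum of
  \<open>(\<nabla>\<^bsub>e\<^esub>C)(e3,e,e3) - (\<nabla>\<^bsub>e3\<^esub>C)(e,e,e3)\<close> over \<open>e = e1, e2\<close> is \<open>2(t - s)\<close>. The left-hand side vanishes,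
  and this needs no smooth choice of adapted frames: the identities \<open>det C(u,-,-) = 0\<close> and
  \<open>det (h + C(u,-,-)) = det (h - C(u,-,-))\<close> hold at every point, and at one point their
  derivatives give \<open>(\<nabla>\<^bsub>u\<^esub>C)(v,e3,e3) = 0\<close> and \<open>(\<nabla>\<^bsub>u\<^esub>C)(e3,e1,e1) + (\<nabla>\<^bsub>u\<^esub>C)(e3,e2,e2) = 0\<close>. So \<open>s = t\<close>.

  In a chart everything is expressed by \<open>F\<close>, \<open>\<xi>\<close> and the conormal \<open>\<nu>\<close> with \<open>\<nu> \<bullet> dF = 0\<close> and \<open>\<nu> \<bullet> \<xi> = 1\<close>: \<open>h(u,v) = \<nu> \<bullet> F\<^bsub>uv\<^esub>\<close> and
  \<open>C(u,v,w) = \<nu> \<bullet> F\<^bsub>uvw\<^esub> + \<nu>\<^bsub>u\<^esub> \<bullet> F\<^bsub>vw\<^esub> + \<nu>\<^bsub>v\<^esub> \<bullet> F\<^bsub>uw\<^esub> + \<nu>\<^bsub>w\<^esub> \<bullet> F\<^bsub>uv\<^esub>\<close>.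
\<close>

section \<open>Smooth maps on open sets\<close>

text \<open>The symmetry gives a frame at each point separately, with no continuity between
  neighbouring ones, so \<open>e1\<close>, \<open>e2\<close>, \<open>e3\<close> cannot be
  differentiated as fields. Only relations that mention no frame can be. Written as determinants in
  constant chart vectors, they also avoid the inverse of \<open>h\<close>. Given det C(u,-,-) = 0,
  the odd part of det (h + C(u,-,-)) is det h times the \<open>h\<close>-trace of C(u,-,-), so the
  second identity says that C(u,-,-) is trace free. The first one yields information because for u =
  e1 or e2 the block of C(u,-,-) on the plane of e1, e2 has determinant -l^2; this is what l
  \<noteq> 0 is for. The derivatives in the code are chart derivatives with constant arguments, not
  covariant ones. Correction terms containing C(e3,-,-) vanish; the one that survives is C(g,e,e)
  with g the tangential part of the second derivative of the immersion along e3, and its sum over e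
  = e1, e2 is zero because Re (x + iy)^3 is harmonic. An affine hypersphere must moreover have a
  constant factor on each connected component; this comes from the symmetry of the second
  derivatives of the normal field.\<close>

definition D :: "'a::real_normed_vector \<Rightarrow> ('a \<Rightarrow> 'b::real_normed_vector) \<Rightarrow> 'a \<Rightarrow> 'b" where
  "D v f = (\<lambda>x. frechet_derivative f (at x) v)"

lemma D_eq: "(f has_derivative f') (at x) \<Longrightarrow> D v f x = f' v"
  unfolding D_def by (metis frechet_derivative_at)

lemma D_has_derivative: "f differentiable (at x) \<Longrightarrow> (f has_derivative (\<lambda>v. D v f x)) (at x)"
  unfolding D_def using frechet_derivative_works by blast

lemma linear_D: "f differentiable (at x) \<Longrightarrow> linear (\<lambda>v. D v f x)"
  using D_has_derivative has_derivative_linear by blast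

lemma D_add: "f differentiable (at x) \<Longrightarrow> D (u + v) f x = D u f x + D v f x"
  using linear_add[OF linear_D] by blast

lemma D_scale: "f differentiable (at x) \<Longrightarrow> D (a *\<^sub>R u) f x = a *\<^sub>R D u f x"
  using linear_D linear_cmul by metis

lemma differentiable_cong_open:
  assumes "open S" "x \<in> S" "\<And>y. y \<in> S \<Longrightarrow> f y = g y" "f differentiable (at x)"
  shows "g differentiable (at x)"
  using assms has_derivative_transform_within_open unfolding differentiable_def by blast

text \<open>Holds for arbitrary maps: \<open>frechet_derivative\<close> is a choice among the
  derivatives at \<open>x\<close>, and both maps have the same ones.\<close>

lemma D_cong:
  assumes "open S" "x \<in> S" "\<And>y. y \<in> S \<Longrightarrow> f y = g y"
  shows "D v f x = D v g x"
proof -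
  have "(f has_derivative f') (at x) \<longleftrightarrow> (g has_derivative f') (at x)" for f'
    using assms has_derivative_transform_within_open[of f f' x UNIV S g]
      has_derivative_transform_within_open[of g f' x UNIV S f] by auto
  then show ?thesis unfolding D_def frechet_derivative_def by simp
qed

lemma Ck_on_Suc_D: "Ck_on (Suc k) S f \<longleftrightarrow> (\<forall>x\<in>S. f differentiable (at x)) \<and> (\<forall>v. Ck_on k S (D v f))"
  by (simp add: D_def)

lemma Ck_on_SucD: "Ck_on (Suc k) S f \<Longrightarrow> Ck_on k S f"
proof (induction k arbitrary: f)
  case 0
  then show ?case
    by (auto intro!: continuous_at_imp_continuous_on differentiable_imp_continuous_within)
next
  case (Suc k)
  then show ?case unfolding Ck_on_Suc_D[of "Suc k"] Ck_on_Suc_D[of k] by blast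
qed

lemma Ck_on_subset: "Ck_on k S f \<Longrightarrow> T \<subseteq> S \<Longrightarrow> Ck_on k T f"
  by (induction k arbitrary: f) (auto intro: continuous_on_subset)

lemma Ck_on_cong:
  "open S \<Longrightarrow> (\<And>x. x \<in> S \<Longrightarrow> f x = g x) \<Longrightarrow> Ck_on k S f \<Longrightarrow> Ck_on k S g"
proof (induction k arbitrary: f g)
  case 0
  then show ?case by (auto cong: continuous_on_cong)
next
  case (Suc k)
  have "Ck_on k S (D v g)" for v
    using Suc.IH[of "D v f" "D v g"] Suc.prems D_cong[OF Suc.prems(1), of _ f g]
    unfolding Ck_on_Suc_D by blast
  then show ?case
    using Suc.prems differentiable_cong_open unfolding Ck_on_Suc_D by blast
qed

lemma Ck_on_const: "Ck_on k S (\<lambda>x. c)"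
proof (induction k arbitrary: c)
  case (Suc k)
  have "D v (\<lambda>x. c) = (\<lambda>x. 0)" for v :: 'a
    by (auto simp: D_def)
  then show ?case using Suc unfolding Ck_on_Suc_D by simp
qed simp

lemma Ck_on_add:
  "open S \<Longrightarrow> Ck_on k S f \<Longrightarrow> Ck_on k S g \<Longrightarrow> Ck_on k S (\<lambda>x. f x + g x)"
proof (induction k arbitrary: f g)
  case 0
  then show ?case by (auto intro: continuous_intros)
next
  case (Suc k)
  have "D v f x + D v g x = D v (\<lambda>x. f x + g x) x" if "x \<in> S" for v x
    using Suc.prems that
    by (intro D_eq[symmetric] has_derivative_add D_has_derivative) (auto simp: Ck_on_Suc_D simp del: Ck_on.simps)
  note d = this
  have c: "Ck_on k S (\<lambda>x. D v f x + D v g x)" for v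
    using Suc unfolding Ck_on_Suc_D by blast
  have "Ck_on k S (D v (\<lambda>x. f x + g x))" for v
    by (rule Ck_on_cong[OF Suc.prems(1) d c])
  then show ?case using Suc.prems unfolding Ck_on_Suc_D by auto
qed

lemma Ck_on_linear:
  "bounded_linear L \<Longrightarrow> open S \<Longrightarrow> Ck_on k S f \<Longrightarrow> Ck_on k S (\<lambda>x. L (f x))"
proof (induction k arbitrary: f)
  case 0
  then show ?case by (auto intro: bounded_linear.continuous_on)
next
  case (Suc k)
  have d: "((\<lambda>x. L (f x)) has_derivative (\<lambda>v. L (D v f x))) (at x)" if "x \<in> S" for x
    using Suc.prems that
    by (intro bounded_linear.has_derivative[where f=L] D_has_derivative) (auto simp: Ck_on_Suc_D simp del: Ck_on.simps)
  have c: "Ck_on k S (\<lambda>x. L (D v f x))" for v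
    using Suc unfolding Ck_on_Suc_D by blast
  have "Ck_on k S (D v (\<lambda>x. L (f x)))" for v
    by (rule Ck_on_cong[OF Suc.prems(2) D_eq[OF d, symmetric] c])
  then show ?case using d unfolding Ck_on_Suc_D differentiable_def by auto
qed

text \<open>Induction through the product rule, where \<open>Ck_on_SucD\<close> lowers the order of
  the undifferentiated factor. Products, scalings and inner products are all instances.\<close>

lemma Ck_on_bilinear:
  "bounded_bilinear B \<Longrightarrow> open S \<Longrightarrow> Ck_on k S f \<Longrightarrow> Ck_on k S g \<Longrightarrow> Ck_on k S (\<lambda>x. B (f x) (g x))"
proof (induction k arbitrary: f g)
  case 0
  then show ?case by (auto intro: bounded_bilinear.continuous_on)
next
  case (Suc k)
  have d: "((\<lambda>x. B (f x) (g x)) has_derivative (\<lambda>v. B (f x) (D v g x) + B (D v f x) (g x))) (at x)"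
    if "x \<in> S" for x
    using Suc.prems that
    by (intro bounded_bilinear.FDERIV[where prod=B] D_has_derivative) (auto simp: Ck_on_Suc_D simp del: Ck_on.simps)
  have c: "Ck_on k S (\<lambda>x. B (f x) (D v g x) + B (D v f x) (g x))" for v
    using Suc.prems Ck_on_SucD[of k S f] Ck_on_SucD[of k S g]
    by (intro Ck_on_add Suc.IH) (auto simp: Ck_on_Suc_D simp del: Ck_on.simps)
  have "Ck_on k S (D v (\<lambda>x. B (f x) (g x)))" for v
    by (rule Ck_on_cong[OF Suc.prems(2) D_eq[OF d, symmetric] c])
  then show ?case using d unfolding Ck_on_Suc_D differentiable_def by auto
qed

text \<open>The derivative of 1/f is a product of 1/f, 1/f and \<open>D v f\<close> up to sign, so
  order \<open>k\<close> of 1/f itself, known by induction, gives order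
  \<open>k + 1\<close>.\<close>

lemma Ck_on_inverse:
  fixes f :: "'a::real_normed_vector \<Rightarrow> real"
  shows "open S \<Longrightarrow> Ck_on k S f \<Longrightarrow> (\<And>x. x \<in> S \<Longrightarrow> f x \<noteq> 0) \<Longrightarrow> Ck_on k S (\<lambda>x. inverse (f x))"
proof (induction k)
  case 0
  then show ?case by (auto intro: continuous_intros)
next
  case (Suc k)
  have d: "((\<lambda>x. inverse (f x)) has_derivative (\<lambda>v. - 1 * (inverse (f x) * inverse (f x) * D v f x))) (at x)"
    if "x \<in> S" for x
    using Suc.prems that D_has_derivative[of f x]
    by (auto intro!: derivative_eq_intros simp: Ck_on_Suc_D)
  have i: "Ck_on k S (\<lambda>x. inverse (f x))"
    using Suc Ck_on_SucD by blast
  have c: "Ck_on k S (\<lambda>x. - 1 * (inverse (f x) * inverse (f x) * D v f x))" for v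
    using Suc.prems i
    by (intro Ck_on_bilinear[OF bounded_bilinear_mult] Ck_on_const) (auto simp: Ck_on_Suc_D simp del: Ck_on.simps)
  have "Ck_on k S (D v (\<lambda>x. inverse (f x)))" for v
    by (rule Ck_on_cong[OF Suc.prems(1) D_eq[OF d, symmetric] c])
  then show ?case using d unfolding Ck_on_Suc_D differentiable_def by auto
qed

lemma smooth_on_differentiable: "smooth_on S f \<Longrightarrow> x \<in> S \<Longrightarrow> f differentiable (at x)"
  unfolding smooth_on_def using Ck_on_Suc_D by blast

lemma smooth_on_D: "smooth_on S f \<Longrightarrow> smooth_on S (D v f)"
  unfolding smooth_on_def using Ck_on_Suc_D by blast

lemma smooth_on_subset: "smooth_on S f \<Longrightarrow> T \<subseteq> S \<Longrightarrow> smooth_on T f"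
  unfolding smooth_on_def using Ck_on_subset by blast

lemma smooth_on_cong:
  "open S \<Longrightarrow> (\<And>x. x \<in> S \<Longrightarrow> f x = g x) \<Longrightarrow> smooth_on S f \<Longrightarrow> smooth_on S g"
  unfolding smooth_on_def using Ck_on_cong by blast

lemma smooth_on_const: "smooth_on S (\<lambda>x. c)"
  unfolding smooth_on_def by (simp add: Ck_on_const)

lemma smooth_on_add:
  "open S \<Longrightarrow> smooth_on S f \<Longrightarrow> smooth_on S g \<Longrightarrow> smooth_on S (\<lambda>x. f x + g x)"
  unfolding smooth_on_def by (simp add: Ck_on_add)

lemma smooth_on_linear:
  "bounded_linear L \<Longrightarrow> open S \<Longrightarrow> smooth_on S f \<Longrightarrow> smooth_on S (\<lambda>x. L (f x))"
  unfolding smooth_on_def by (simp add: Ck_on_linear)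

lemma smooth_on_bilinear:
  "bounded_bilinear B \<Longrightarrow> open S \<Longrightarrow> smooth_on S f \<Longrightarrow> smooth_on S g \<Longrightarrow> smooth_on S (\<lambda>x. B (f x) (g x))"
  unfolding smooth_on_def by (simp add: Ck_on_bilinear)

lemmas smooth_on_mult = smooth_on_bilinear[OF bounded_bilinear_mult]
lemmas smooth_on_scaleR = smooth_on_bilinear[OF bounded_bilinear_scaleR]
lemmas smooth_on_inner = smooth_on_bilinear[OF bounded_bilinear_inner]

lemma smooth_on_diff:
  "open S \<Longrightarrow> smooth_on S f \<Longrightarrow> smooth_on S g \<Longrightarrow> smooth_on S (\<lambda>x. f x - g x)"
  using smooth_on_add[of S f "\<lambda>x. - g x"] smooth_on_linear[OF bounded_linear_minus[OF bounded_linear_ident], of S g]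
  by simp

lemma smooth_on_inverse:
  fixes f :: "'a::real_normed_vector \<Rightarrow> real"
  shows "open S \<Longrightarrow> smooth_on S f \<Longrightarrow> (\<And>x. x \<in> S \<Longrightarrow> f x \<noteq> 0) \<Longrightarrow> smooth_on S (\<lambda>x. inverse (f x))"
  unfolding smooth_on_def by (simp add: Ck_on_inverse)

lemma smooth_on_sum:
  "open S \<Longrightarrow> (\<And>i. i \<in> I \<Longrightarrow> smooth_on S (f i)) \<Longrightarrow> smooth_on S (\<lambda>x. \<Sum>i\<in>I. f i x)"
  by (induction I rule: infinite_finite_induct) (auto intro: smooth_on_add smooth_on_const)

lemma smooth_on_prod:
  fixes f :: "'i \<Rightarrow> 'a::real_normed_vector \<Rightarrow> real"
  shows "open S \<Longrightarrow> (\<And>i. i \<in> I \<Longrightarrow> smooth_on S (f i)) \<Longrightarrow> smooth_on S (\<lambda>x. \<Prod>i\<in>I. f i x)"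
  by (induction I rule: infinite_finite_induct) (auto intro: smooth_on_mult smooth_on_const)

lemma smooth_on_det:
  fixes m :: "'a::real_normed_vector \<Rightarrow> real^'n^'n"
  assumes "open S" "\<And>i j. smooth_on S (\<lambda>x. m x $ i $ j)"
  shows "smooth_on S (\<lambda>x. det (m x))"
  unfolding det_def by (intro smooth_on_sum smooth_on_mult smooth_on_prod smooth_on_const assms)

lemma smooth_on_component:
  "open S \<Longrightarrow> smooth_on S f \<Longrightarrow> smooth_on S (\<lambda>x. f x $ i)"
  by (rule smooth_on_linear[OF bounded_linear_vec_nth])

lemma smooth_on_vec:
  fixes g :: "'i::finite \<Rightarrow> 'a::real_normed_vector \<Rightarrow> real"
  assumes "open S" "\<And>i. smooth_on S (g i)"
  shows "smooth_on S (\<lambda>x. \<chi> i. g i x)"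
proof -
  have "(\<chi> i. g i x) = (\<Sum>i\<in>UNIV. g i x *\<^sub>R axis i 1)" for x
    by (simp add: vec_eq_iff axis_def if_distrib[of "(*) _"] cong: if_cong)
  then show ?thesis
    by (auto intro!: smooth_on_sum smooth_on_scaleR smooth_on_const assms)
qed

text \<open>Two applications of the mean value theorem to the second difference
  \<open>f (x + su + sv) - f (x + su) - f (x + sv) + f x\<close> give \<open>s\<^sup>2\<close> times a value of
  \<open>D v (D u f)\<close> near \<open>x\<close>; the second difference is symmetric in \<open>u\<close> and \<open>v\<close>.\<close>

lemma second_difference_mean_value:
  fixes f :: "'a::real_normed_vector \<Rightarrow> real"
  assumes S: "\<And>a b. 0 \<le> a \<Longrightarrow> a \<le> s \<Longrightarrow> 0 \<le> b \<Longrightarrow> b \<le> s \<Longrightarrow> x + a *\<^sub>R u + b *\<^sub>R v \<in> S"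
    and f: "\<And>y. y \<in> S \<Longrightarrow> f differentiable (at y)"
    and f': "\<And>y. y \<in> S \<Longrightarrow> D u f differentiable (at y)" and s: "0 < s"
  shows "\<exists>a b. 0 \<le> a \<and> a \<le> s \<and> 0 \<le> b \<and> b \<le> s \<and>
    f (x + s *\<^sub>R u + s *\<^sub>R v) - f (x + s *\<^sub>R u) - f (x + s *\<^sub>R v) + f x
      = s * s * D v (D u f) (x + a *\<^sub>R u + b *\<^sub>R v)"
proof -
  define p where "p = (\<lambda>a b. x + a *\<^sub>R u + b *\<^sub>R v)"
  define g where "g = (\<lambda>a. f (p a s) - f (p a 0))"
  have d1: "((\<lambda>a. f (p a b)) has_real_derivative D u f (p a b)) (at a)"
    if "0 \<le> a" "a \<le> s" "0 \<le> b" "b \<le> s" for a b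
  proof -
    have "((\<lambda>a. f (p a b)) has_derivative (\<lambda>t. D (t *\<^sub>R u) f (p a b))) (at a)"
      using that S f unfolding p_def
      by (intro has_derivative_compose[OF _ D_has_derivative])
        (auto intro!: derivative_eq_intros)
    then show ?thesis
      unfolding has_field_derivative_def using D_scale[of f "p a b" _ u] f S that
      by (simp add: p_def mult.commute[of _ "D u f _"] cong: )
  qed
  have d2: "((\<lambda>b. D u f (p a b)) has_real_derivative D v (D u f) (p a b)) (at b)"
    if "0 \<le> a" "a \<le> s" "0 \<le> b" "b \<le> s" for a b
  proof -
    have "((\<lambda>b. D u f (p a b)) has_derivative (\<lambda>t. D (t *\<^sub>R v) (D u f) (p a b))) (at b)"
      using that S f' unfolding p_def
      by (intro has_derivative_compose[OF _ D_has_derivative])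
        (auto intro!: derivative_eq_intros)
    then show ?thesis
      unfolding has_field_derivative_def using D_scale[of "D u f" "p a b" _ v] f' S that
      by (simp add: p_def mult.commute[of _ "D v _ _"])
  qed
  have "(g has_real_derivative D u f (p a s) - D u f (p a 0)) (at a)" if "0 \<le> a" "a \<le> s" for a
    unfolding g_def using that s by (intro DERIV_diff d1) auto
  then obtain a where a: "0 < a" "a < s" "g s - g 0 = (s - 0) * (D u f (p a s) - D u f (p a 0))"
    using MVT2[of 0 s g "\<lambda>a. D u f (p a s) - D u f (p a 0)"] s by auto
  obtain b where b: "0 < b" "b < s" "D u f (p a s) - D u f (p a 0) = (s - 0) * D v (D u f) (p a b)"
    using MVT2[of 0 s "\<lambda>b. D u f (p a b)" "\<lambda>b. D v (D u f) (p a b)"] s d2 a by auto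
  show ?thesis
    using a b by (intro exI[of _ a] exI[of _ b]) (simp add: g_def p_def)
qed

lemma D_commute_real:
  fixes f :: "'a::real_normed_vector \<Rightarrow> real"
  assumes O: "open S" "x \<in> S" and f: "smooth_on S f"
  shows "D v (D u f) x = D u (D v f) x"
proof (rule ccontr)
  assume ne: "D v (D u f) x \<noteq> D u (D v f) x"
  \<comment> \<open>Half the gap, so that the open \<open>e\<close>-intervals around the two values
    are disjoint.\<close>
  define e where "e = \<bar>D v (D u f) x - D u (D v f) x\<bar> / 2"
  have e: "e > 0" using ne by (simp add: e_def)
  have c: "isCont (D w (D z f)) x" for w z
    using smooth_on_differentiable[OF smooth_on_D[OF smooth_on_D[OF f]] O(2)]
      differentiable_imp_continuous_within by blast
  obtain r where r: "r > 0" "ball x r \<subseteq> S"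
    "\<And>y. y \<in> ball x r \<Longrightarrow> \<bar>D v (D u f) y - D v (D u f) x\<bar> < e"
    "\<And>y. y \<in> ball x r \<Longrightarrow> \<bar>D u (D v f) y - D u (D v f) x\<bar> < e"
  proof -
    obtain r0 where "r0 > 0" "ball x r0 \<subseteq> S" using O openE by blast
    moreover obtain r1 where "r1 > 0" "\<And>y. dist y x < r1 \<Longrightarrow> \<bar>D v (D u f) y - D v (D u f) x\<bar> < e"
      using c[of v u] e unfolding continuous_at_eps_delta dist_real_def by metis
    moreover obtain r2 where "r2 > 0" "\<And>y. dist y x < r2 \<Longrightarrow> \<bar>D u (D v f) y - D u (D v f) x\<bar> < e"
      using c[of u v] e unfolding continuous_at_eps_delta dist_real_def by metis
    ultimately show ?thesis
      by (intro that[of "min r0 (min r1 r2)"]) (auto simp: dist_commute subset_iff)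
  qed
  \<comment> \<open>The parallelogram with sides \<open>s *\<^sub>R u\<close> and
    \<open>s *\<^sub>R v\<close> then stays in the ball of radius \<open>r\<close>; the summand 1
    keeps the denominator positive even if both vectors vanish.\<close>
  define s where "s = r / 2 / (norm u + norm v + 1)"
  have pos: "0 < norm u + norm v + 1" by (simp add: add_nonneg_pos)
  have s: "0 < s" using r pos by (simp add: s_def)
  have B: "x + a *\<^sub>R u + b *\<^sub>R v \<in> ball x r" if "0 \<le> a" "a \<le> s" "0 \<le> b" "b \<le> s" for a b
  proof -
    have "norm (a *\<^sub>R u + b *\<^sub>R v) \<le> a * norm u + b * norm v"
      using that by (intro norm_triangle_le) auto
    also have "\<dots> \<le> s * norm u + s * norm v"
      using that by (intro add_mono mult_right_mono) auto
    also have "\<dots> \<le> s * (norm u + norm v + 1)" using s by (simp add: algebra_simps)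
    also have "\<dots> = r / 2" using pos unfolding s_def by (metis less_irrefl nonzero_eq_divide_eq)
    also have "\<dots> < r" using r(1) by simp
    finally show ?thesis by (metis add.assoc add_diff_cancel_left' dist_commute dist_norm mem_ball)
  qed
  note sd = smooth_on_differentiable[OF f] smooth_on_differentiable[OF smooth_on_D[OF f]]
  obtain a b where ab: "0 \<le> a" "a \<le> s" "0 \<le> b" "b \<le> s"
    "f (x + s *\<^sub>R u + s *\<^sub>R v) - f (x + s *\<^sub>R u) - f (x + s *\<^sub>R v) + f x
      = s * s * D v (D u f) (x + a *\<^sub>R u + b *\<^sub>R v)"
    using second_difference_mean_value[of s x u v S f] B r sd s by blast
  have B': "x + a *\<^sub>R v + b *\<^sub>R u \<in> ball x r" if "0 \<le> a" "a \<le> s" "0 \<le> b" "b \<le> s" for a b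
    using B[of b a] that by (simp add: ac_simps)
  obtain a' b' where ab': "0 \<le> a'" "a' \<le> s" "0 \<le> b'" "b' \<le> s"
    "f (x + s *\<^sub>R v + s *\<^sub>R u) - f (x + s *\<^sub>R v) - f (x + s *\<^sub>R u) + f x
      = s * s * D u (D v f) (x + a' *\<^sub>R v + b' *\<^sub>R u)"
    using second_difference_mean_value[of s x v u S f] B' r sd s by blast
  have "s * s * D v (D u f) (x + a *\<^sub>R u + b *\<^sub>R v) = s * s * D u (D v f) (x + a' *\<^sub>R v + b' *\<^sub>R u)"
    unfolding ab(5)[symmetric] ab'(5)[symmetric] by (simp add: ac_simps)
  then have "D v (D u f) (x + a *\<^sub>R u + b *\<^sub>R v) = D u (D v f) (x + a' *\<^sub>R v + b' *\<^sub>R u)"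
    using s by simp
  moreover have "\<bar>D v (D u f) (x + a *\<^sub>R u + b *\<^sub>R v) - D v (D u f) x\<bar> < e"
    using r(3) B ab by blast
  moreover have "\<bar>D u (D v f) (x + a' *\<^sub>R v + b' *\<^sub>R u) - D u (D v f) x\<bar> < e"
    using r(4) B' ab' by blast
  ultimately show False unfolding e_def by (auto simp: abs_if field_simps split: if_splits)
qed

lemma D_inner_const:
  "f differentiable (at x) \<Longrightarrow> D v (\<lambda>y. f y \<bullet> c) x = D v f x \<bullet> c"
  by (intro D_eq[of _ "\<lambda>v. D v f x \<bullet> c"] bounded_linear.has_derivative[OF bounded_linear_inner_left] D_has_derivative)

lemma D_commute:
  fixes f :: "'a::real_normed_vector \<Rightarrow> 'b::euclidean_space"
  assumes O: "open S" "x \<in> S" and f: "smooth_on S f"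
  shows "D v (D u f) x = D u (D v f) x"
proof (rule euclidean_eqI)
  fix c :: 'b
  have 1: "D w (D z f) x \<bullet> c = D w (D z (\<lambda>y. f y \<bullet> c)) x" for w z
  proof -
    have "D w (D z f) x \<bullet> c = D w (\<lambda>y. D z f y \<bullet> c) x"
      using D_inner_const smooth_on_differentiable smooth_on_D f O by metis
    also have "\<dots> = D w (D z (\<lambda>y. f y \<bullet> c)) x"
      by (rule D_cong[OF O]) (rule D_inner_const[OF smooth_on_differentiable[OF f], symmetric])
    finally show ?thesis .
  qed
  have "smooth_on S (\<lambda>y. f y \<bullet> c)"
    by (intro smooth_on_inner smooth_on_const O f)
  then show "D v (D u f) x \<bullet> c = D u (D v f) x \<bullet> c"
    using 1 D_commute_real O by metis
qed

section \<open>Symmetric determinants of order three\<close>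

text \<open>The arguments are the upper triangle of the matrix read by rows: \<open>a b c\<close>,
  then \<open>d e\<close>, then \<open>g\<close>.\<close>

definition sym_det3 :: "real \<Rightarrow> real \<Rightarrow> real \<Rightarrow> real \<Rightarrow> real \<Rightarrow> real \<Rightarrow> real" where
  "sym_det3 a b c d e g = a * d * g + 2 * b * c * e - a * e\<^sup>2 - d * c\<^sup>2 - g * b\<^sup>2"

text \<open>\<open>B\<close> is the congruence Y N Y^T of the block matrix N with blocks (m11, m12;
  m12, m22) and m33, so its determinant is det N (det Y)^2. Determinants of two forms in the same
  three vectors can thus be compared through their blocks alone.\<close>

lemma sym_det3_congruence:
  fixes m11 m12 m22 m33 :: real and y :: "nat \<Rightarrow> nat \<Rightarrow> real"
  defines "B \<equiv> \<lambda>i j. m11 * y i 1 * y j 1 + m12 * (y i 1 * y j 2 + y i 2 * y j 1)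
      + m22 * y i 2 * y j 2 + m33 * y i 3 * y j 3"
  shows "sym_det3 (B 1 1) (B 1 2) (B 1 3) (B 2 2) (B 2 3) (B 3 3) = (m11 * m22 - m12\<^sup>2) * m33 *
    (y 1 1 * y 2 2 * y 3 3 + y 1 2 * y 2 3 * y 3 1 + y 1 3 * y 2 1 * y 3 2
      - y 1 1 * y 2 3 * y 3 2 - y 1 2 * y 2 1 * y 3 3 - y 1 3 * y 2 2 * y 3 1)\<^sup>2"
  unfolding sym_det3_def B_def by algebra

text \<open>At a symmetric matrix whose last row and column vanish, the only cofactor that can be
  nonzero is that of the last diagonal entry, and the derivative of the determinant is this cofactor
  times the derivative of that entry.\<close>

lemma D_sym_det3_last:
  assumes S: "open S" "x \<in> S"
    and d: "a differentiable (at x)" "b differentiable (at x)" "c differentiable (at x)"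
      "d differentiable (at x)" "e differentiable (at x)" "g differentiable (at x)"
    and z: "c x = 0" "e x = 0" "g x = 0"
    and 0: "\<And>y. y \<in> S \<Longrightarrow> sym_det3 (a y) (b y) (c y) (d y) (e y) (g y) = 0"
  shows "(a x * d x - (b x)\<^sup>2) * D v g x = 0"
proof -
  have "((\<lambda>y. sym_det3 (a y) (b y) (c y) (d y) (e y) (g y)) has_derivative
      (\<lambda>v. (a x * d x - (b x)\<^sup>2) * D v g x)) (at x)"
    unfolding sym_det3_def
    by (rule derivative_eq_intros d[THEN D_has_derivative] refl)+
      (simp add: z fun_eq_iff algebra_simps power2_eq_square)
  then have "D v (\<lambda>y. sym_det3 (a y) (b y) (c y) (d y) (e y) (g y)) x = (a x * d x - (b x)\<^sup>2) * D v g x"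
    by (rule D_eq)
  moreover have "D v (\<lambda>y. sym_det3 (a y) (b y) (c y) (d y) (e y) (g y)) x = D v (\<lambda>y. 0) x"
    using 0 by (rule D_cong[OF S])
  moreover have "D v (\<lambda>y. 0::real) x = 0"
    by (simp add: D_def)
  ultimately show ?thesis by simp
qed

text \<open>To first order, the part of \<open>det (m + q)\<close> that is odd in \<open>q\<close> is the trace of \<open>q\<close> with respect
  to \<open>m\<close>.\<close>

lemma D_sym_det3_trace:
  fixes m q :: "nat \<Rightarrow> nat \<Rightarrow> 'a::real_normed_vector \<Rightarrow> real"
  assumes S: "open S" "x \<in> S"
    and d: "\<And>i j. m i j differentiable (at x)" "\<And>i j. q i j differentiable (at x)"
    and z: "\<And>i j. q i j x = 0" and o: "m 1 1 x = 1" "m 2 2 x = 1" "m 3 3 x = 1"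
      "m 1 2 x = 0" "m 1 3 x = 0" "m 2 3 x = 0"
    and eq: "\<And>y. y \<in> S \<Longrightarrow>
        sym_det3 (m 1 1 y + q 1 1 y) (m 1 2 y + q 1 2 y) (m 1 3 y + q 1 3 y)
          (m 2 2 y + q 2 2 y) (m 2 3 y + q 2 3 y) (m 3 3 y + q 3 3 y)
      = sym_det3 (m 1 1 y - q 1 1 y) (m 1 2 y - q 1 2 y) (m 1 3 y - q 1 3 y)
          (m 2 2 y - q 2 2 y) (m 2 3 y - q 2 3 y) (m 3 3 y - q 3 3 y)"
  shows "D v (q 1 1) x + D v (q 2 2) x + D v (q 3 3) x = 0"
proof -
  let ?G = "\<lambda>y. sym_det3 (m 1 1 y + q 1 1 y) (m 1 2 y + q 1 2 y) (m 1 3 y + q 1 3 y)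
          (m 2 2 y + q 2 2 y) (m 2 3 y + q 2 3 y) (m 3 3 y + q 3 3 y)
      - sym_det3 (m 1 1 y - q 1 1 y) (m 1 2 y - q 1 2 y) (m 1 3 y - q 1 3 y)
          (m 2 2 y - q 2 2 y) (m 2 3 y - q 2 3 y) (m 3 3 y - q 3 3 y)"
  have "(?G has_derivative (\<lambda>v. 2 * (D v (q 1 1) x + D v (q 2 2) x + D v (q 3 3) x))) (at x)"
    unfolding sym_det3_def
    by (rule derivative_eq_intros d[THEN D_has_derivative] refl)+
      (simp add: z o fun_eq_iff del: One_nat_def)
  then have "D v ?G x = 2 * (D v (q 1 1) x + D v (q 2 2) x + D v (q 3 3) x)"
    by (rule D_eq)
  moreover have "D v ?G x = D v (\<lambda>y. 0) x"
    using eq by (intro D_cong[OF S]) simp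
  moreover have "D v (\<lambda>y. 0::real) x = 0"
    by (simp add: D_def)
  ultimately show ?thesis by simp
qed

section \<open>A hypersurface in one chart\<close>

lemma D_inner:
  assumes "a differentiable (at x)" "b differentiable (at x)"
  shows "D v (\<lambda>y. a y \<bullet> b y) x = a x \<bullet> D v b x + D v a x \<bullet> b x"
  by (rule D_eq[of _ "\<lambda>v. a x \<bullet> D v b x + D v a x \<bullet> b x"])
    (intro has_derivative_inner D_has_derivative assms)

lemma D_constant_on:
  assumes "open S" "x \<in> S" "\<And>y. y \<in> S \<Longrightarrow> f y = c"
  shows "D v f x = 0"
  using D_cong[OF assms(1,2), of f "\<lambda>_. c"] assms(3) by (simp add: D_def)

text \<open>The last two assumptions say that dF identifies \<open>real^3\<close> with the kernel of
  the conormal; \<open>equiaffine\<close> says that the derivative of \<xi> is tangential.\<close>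

locale equiaffine_chart =
  fixes S :: "(real^3) set" and f \<xi> \<nu> :: "real^3 \<Rightarrow> real^4"
  assumes open_S: "open S"
    and smooth: "smooth_on S f" "smooth_on S \<xi>" "smooth_on S \<nu>"
    and conormal_tangent: "x \<in> S \<Longrightarrow> \<nu> x \<bullet> D u f x = 0"
    and conormal_normal: "x \<in> S \<Longrightarrow> \<nu> x \<bullet> \<xi> x = 1"
    and equiaffine: "x \<in> S \<Longrightarrow> \<nu> x \<bullet> D u \<xi> x = 0"
    and tangent_if: "x \<in> S \<Longrightarrow> \<nu> x \<bullet> z = 0 \<Longrightarrow> \<exists>u. z = D u f x"
    and inj_D: "x \<in> S \<Longrightarrow> inj (\<lambda>u. D u f x)"
begin

definition metric :: "real^3 \<Rightarrow> real^3 \<Rightarrow> real^3 \<Rightarrow> real" where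
  "metric x u v = \<nu> x \<bullet> D u (D v f) x"

text \<open>The covariant derivative of the metric, written so that its symmetry is visible.\<close>

definition cubic :: "real^3 \<Rightarrow> real^3 \<Rightarrow> real^3 \<Rightarrow> real^3 \<Rightarrow> real" where
  "cubic x u v w = \<nu> x \<bullet> D u (D v (D w f)) x + D u \<nu> x \<bullet> D v (D w f) x
     + D v \<nu> x \<bullet> D u (D w f) x + D w \<nu> x \<bullet> D u (D v f) x"

lemmas smooth_D = smooth[THEN smooth_on_D]
lemmas smooth_D2 = smooth_D[THEN smooth_on_D]

lemma D_inner_smooth:
  assumes "x \<in> S" "smooth_on S a" "smooth_on S b"
  shows "D v (\<lambda>y. a y \<bullet> b y) x = a x \<bullet> D v b x + D v a x \<bullet> b x"
  using D_inner assms smooth_on_differentiable by blast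

lemma D_inner_constant:
  assumes "x \<in> S" "smooth_on S a" "smooth_on S b" "\<And>y. y \<in> S \<Longrightarrow> a y \<bullet> b y = c"
  shows "a x \<bullet> D v b x + D v a x \<bullet> b x = 0"
  using D_inner_smooth[OF assms(1-3), of v] D_constant_on[of S x "\<lambda>y. a y \<bullet> b y" c v] open_S assms by simp

lemmas D_swap = D_commute[OF open_S]

lemma D_swap3: "x \<in> S \<Longrightarrow> smooth_on S g \<Longrightarrow> D u (D v (D w g)) x = D u (D w (D v g)) x"
  for g :: "real^3 \<Rightarrow> real^4"
  by (intro D_cong[OF open_S] D_swap)

lemma D_conormal_tangent: "x \<in> S \<Longrightarrow> D u \<nu> x \<bullet> D v f x = - metric x u v"
  using D_inner_constant[OF _ smooth(3) smooth_D(1) conormal_tangent, of x u v]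
  by (simp add: metric_def)

lemma D_conormal_normal: "x \<in> S \<Longrightarrow> D u \<nu> x \<bullet> \<xi> x = 0"
  using D_inner_constant[OF _ smooth(3) smooth(2) conormal_normal, of x u] equiaffine by simp

lemma D2_conormal_normal: "x \<in> S \<Longrightarrow> D v (D u \<nu>) x \<bullet> \<xi> x = - (D u \<nu> x \<bullet> D v \<xi> x)"
  using D_inner_constant[OF _ smooth_D(3) smooth(2) D_conormal_normal, of x u v] by simp

text \<open>Differentiate \<nu> . f_v = 0 twice. Besides the term on the left, three terms arise;
  they are those of \<open>cubic x w u v\<close> except for
  \<open>D v \<nu> x \<bullet> D w (D u f) x\<close>.\<close>

lemma D2_conormal_tangent:
  assumes x: "x \<in> S"
  shows "D w (D u \<nu>) x \<bullet> D v f x = D v \<nu> x \<bullet> D w (D u f) x - cubic x w u v"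
proof -
  have "D w (\<lambda>y. \<nu> y \<bullet> D u (D v f) y + D u \<nu> y \<bullet> D v f y) x = 0"
    using D_conormal_tangent by (intro D_constant_on[OF open_S x, of _ 0]) (simp add: metric_def)
  moreover have "D w (\<lambda>y. \<nu> y \<bullet> D u (D v f) y + D u \<nu> y \<bullet> D v f y) x
      = D w (\<lambda>y. \<nu> y \<bullet> D u (D v f) y) x + D w (\<lambda>y. D u \<nu> y \<bullet> D v f y) x"
    by (rule D_eq[of _ "\<lambda>w. D w _ x + D w _ x"], intro has_derivative_add D_has_derivative
        smooth_on_differentiable[OF _ x] smooth_on_inner smooth smooth_on_D open_S)
  ultimately show ?thesis
    unfolding cubic_def
    using D_inner_smooth[OF x smooth(3) smooth_D2(1), of w u v]
      D_inner_smooth[OF x smooth_D(3,1), of w u v] by simp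
qed

lemma metric_commute: "x \<in> S \<Longrightarrow> metric x u v = metric x v u"
  unfolding metric_def using D_swap[OF _ smooth(1), of x u v] by simp

lemma linear_metric: "x \<in> S \<Longrightarrow> linear (\<lambda>u. metric x u v)"
  unfolding metric_def
  using smooth_on_differentiable[OF smooth_D(1)]
  by (auto intro!: linearI simp: D_add D_scale inner_add_right)

lemma cubic_commute12: "x \<in> S \<Longrightarrow> cubic x u v w = cubic x v u w"
  unfolding cubic_def using D_swap[OF _ smooth_D(1), of x u v w] D_swap[OF _ smooth(1), of x u v] by simp

lemma cubic_commute23: "x \<in> S \<Longrightarrow> cubic x u v w = cubic x u w v"
  unfolding cubic_def using D_swap3[OF _ smooth(1), of x u v w] D_swap[OF _ smooth(1), of x v w] by simp

lemma linear_cubic: "x \<in> S \<Longrightarrow> linear (\<lambda>u. cubic x u v w)"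
  unfolding cubic_def
  using smooth_on_differentiable[OF smooth_D(1)] smooth_on_differentiable[OF smooth_D2(1)]
    smooth_on_differentiable[OF smooth(3)]
  by (auto intro!: linearI simp: D_add D_scale inner_add_right inner_add_left algebra_simps)

lemma smooth_metric: "smooth_on S (\<lambda>x. metric x u v)"
  unfolding metric_def by (intro smooth_on_inner smooth smooth_on_D open_S)

lemma smooth_cubic: "smooth_on S (\<lambda>x. cubic x u v w)"
  unfolding cubic_def by (intro smooth_on_add smooth_on_inner smooth smooth_on_D open_S)

lemmas differentiable_metric = smooth_on_differentiable[OF smooth_metric]
lemmas differentiable_cubic = smooth_on_differentiable[OF smooth_cubic]

lemma D_cubic:
  assumes x: "x \<in> S"
  shows "D z (\<lambda>x. cubic x u v w) x =
    \<nu> x \<bullet> D z (D u (D v (D w f))) x + D z \<nu> x \<bullet> D u (D v (D w f)) x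
    + D u \<nu> x \<bullet> D z (D v (D w f)) x + D z (D u \<nu>) x \<bullet> D v (D w f) x
    + D v \<nu> x \<bullet> D z (D u (D w f)) x + D z (D v \<nu>) x \<bullet> D u (D w f) x
    + D w \<nu> x \<bullet> D z (D u (D v f)) x + D z (D w \<nu>) x \<bullet> D u (D v f) x"
proof -
  note i = D_has_derivative[OF smooth_on_differentiable[OF _ x]]
  have "((\<lambda>x. cubic x u v w) has_derivative (\<lambda>z.
    (\<nu> x \<bullet> D z (D u (D v (D w f))) x + D z \<nu> x \<bullet> D u (D v (D w f)) x)
    + (D u \<nu> x \<bullet> D z (D v (D w f)) x + D z (D u \<nu>) x \<bullet> D v (D w f) x)
    + (D v \<nu> x \<bullet> D z (D u (D w f)) x + D z (D v \<nu>) x \<bullet> D u (D w f) x)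
    + (D w \<nu> x \<bullet> D z (D u (D v f)) x + D z (D w \<nu>) x \<bullet> D u (D v f) x))) (at x)"
    unfolding cubic_def by (intro has_derivative_add has_derivative_inner i smooth smooth_on_D)
  then show ?thesis by (simp add: D_eq)
qed

text \<open>Once derivatives are commuted, the fourth-order terms, the terms with third derivatives
  of \<open>f\<close>, and those with the mixed derivative of \<nu> cancel in pairs. This is the
  Ricci identity before Christoffel corrections.\<close>

lemma cubic_codazzi:
  assumes x: "x \<in> S"
  shows "D a (\<lambda>x. cubic x b a b) x - D b (\<lambda>x. cubic x a a b) x
    = D a (D a \<nu>) x \<bullet> D b (D b f) x - D b (D b \<nu>) x \<bullet> D a (D a f) x"
proof -
  note s = smooth smooth_on_D[OF smooth(1)] smooth_on_D[OF smooth_on_D[OF smooth(1)]]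
  have "D b (D a (D b f)) x = D a (D b (D b f)) x" "D a (D b (D a f)) x = D a (D a (D b f)) x"
    "D b (D a (D a f)) x = D a (D a (D b f)) x" "D b (D b (D a f)) x = D a (D b (D b f)) x"
    "D a (D b (D a (D b f))) x = D b (D a (D a (D b f))) x"
    "D b (D a f) x = D a (D b f) x" "D b (D a \<nu>) x = D a (D b \<nu>) x"
    using D_swap[OF x s(1), of a b] D_swap[OF x s(3), of a b] D_swap3[OF x s(1)]
      D_swap[OF x s(4)] D_swap[OF x s(5)] by metis+
  then show ?thesis unfolding D_cubic[OF x] by (simp add: algebra_simps)
qed

section \<open>Adapted frames and the derivative of the cubic form at one point\<close>

definition S3_frame :: "real^3 \<Rightarrow> real^3 \<Rightarrow> real^3 \<Rightarrow> real^3 \<Rightarrow> real \<Rightarrow> bool" where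
  "S3_frame x e1 e2 e3 l \<longleftrightarrow>
     (\<forall>u. u = metric x u e1 *\<^sub>R e1 + metric x u e2 *\<^sub>R e2 + metric x u e3 *\<^sub>R e3) \<and>
     metric x e1 e1 = 1 \<and> metric x e2 e2 = 1 \<and> metric x e3 e3 = 1 \<and>
     metric x e1 e2 = 0 \<and> metric x e1 e3 = 0 \<and> metric x e2 e3 = 0 \<and>
     (\<forall>u v. cubic x e3 u v = 0) \<and>
     cubic x e1 e1 e1 = l \<and> cubic x e1 e2 e2 = - l \<and> cubic x e1 e1 e2 = 0 \<and> cubic x e2 e2 e2 = 0"

text \<open>The second formula is \<open>l\<close> times the real part of the product of three
  complex numbers x + iy, the polarisation of l Re (x + iy)^3. The factor \<open>l\<close> may be
  zero here, which is used to show that it is not.\<close>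

lemma S3_frame_expand:
  assumes x: "x \<in> S" and fr: "S3_frame x e1 e2 e3 l"
  shows "metric x u v = metric x u e1 * metric x v e1 + metric x u e2 * metric x v e2
      + metric x u e3 * metric x v e3"
    and "cubic x u v w = l * (metric x u e1 * (metric x v e1 * metric x w e1 - metric x v e2 * metric x w e2)
      - metric x u e2 * (metric x v e1 * metric x w e2 + metric x v e2 * metric x w e1))"
proof -
  note F = fr[unfolded S3_frame_def]
  have e: "metric x u e1 *\<^sub>R e1 + metric x u e2 *\<^sub>R e2 + metric x u e3 *\<^sub>R e3 = u" for u
    using F by metis
  have m: "metric x u w = metric x u e1 * metric x e1 w + metric x u e2 * metric x e2 w
      + metric x u e3 * metric x e3 w" for u w
    using arg_cong[OF e[of u], of "\<lambda>u. metric x u w"]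
    by (simp add: linear_add[OF linear_metric[OF x]] linear_cmul[OF linear_metric[OF x]])
  then show "metric x u v = metric x u e1 * metric x v e1 + metric x u e2 * metric x v e2
      + metric x u e3 * metric x v e3"
    using metric_commute[OF x] by metis
  have c: "cubic x u v w = metric x u e1 * cubic x e1 v w + metric x u e2 * cubic x e2 v w" for u v w
  proof -
    have "cubic x u v w = metric x u e1 * cubic x e1 v w + metric x u e2 * cubic x e2 v w
        + metric x u e3 * cubic x e3 v w"
      using arg_cong[OF e[of u], of "\<lambda>u. cubic x u v w"]
      by (simp add: linear_add[OF linear_cubic[OF x]] linear_cmul[OF linear_cubic[OF x]])
    then show ?thesis using F by simp
  qed
  have r: "cubic x u v w = cubic x w u v" for u v w
    using cubic_commute12[OF x] cubic_commute23[OF x] by metis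
  have k: "cubic x e1 e1 e1 = l" "cubic x e1 e2 e2 = - l" "cubic x e1 e1 e2 = 0" "cubic x e2 e2 e2 = 0"
    "cubic x e2 e1 e1 = 0" "cubic x e2 e1 e2 = - l" "cubic x e2 e2 e1 = - l" "cubic x e1 e2 e1 = 0"
    using F r by metis+
  have w: "cubic x e1 e1 w = l * metric x w e1" "cubic x e1 e2 w = - l * metric x w e2"
    "cubic x e2 e1 w = - l * metric x w e2" "cubic x e2 e2 w = - l * metric x w e1" for w
    using c[of w e1 e1] c[of w e1 e2] c[of w e2 e1] c[of w e2 e2] r[of _ _ w] by (simp_all add: k)
  have c1: "cubic x e1 v w = l * (metric x v e1 * metric x w e1 - metric x v e2 * metric x w e2)" for v w
    using c[of v e1 w] cubic_commute12[OF x, of e1 v w]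
    by (simp add: w algebra_simps)
  have c2: "cubic x e2 v w = - l * (metric x v e1 * metric x w e2 + metric x v e2 * metric x w e1)" for v w
    using c[of v e2 w] cubic_commute12[OF x, of e2 v w]
    by (simp add: w algebra_simps)
  show "cubic x u v w = l * (metric x u e1 * (metric x v e1 * metric x w e1 - metric x v e2 * metric x w e2)
      - metric x u e2 * (metric x v e1 * metric x w e2 + metric x v e2 * metric x w e1))"
    unfolding c[of u] c1 c2 by (simp add: algebra_simps)
qed

text \<open>In the frame, C(u,-,-) has the block (r, -s; -s, -r) and a zero last row and column,
  while h + C and h - C have blocks of the same determinant 1 - r^2 - s^2. The vectors
  \<open>a i\<close> are arbitrary, so the same constant ones serve at all points of the
  chart.\<close>

lemma S3_frame_determinants:
  fixes a :: "nat \<Rightarrow> real^3" and u :: "real^3"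
  assumes x: "x \<in> S" and fr: "S3_frame x e1 e2 e3 l"
  defines "m \<equiv> \<lambda>i j. metric x (a i) (a j)" and "q \<equiv> \<lambda>i j. cubic x u (a i) (a j)"
  shows "sym_det3 (q 1 1) (q 1 2) (q 1 3) (q 2 2) (q 2 3) (q 3 3) = 0"
    and "sym_det3 (m 1 1 + q 1 1) (m 1 2 + q 1 2) (m 1 3 + q 1 3)
        (m 2 2 + q 2 2) (m 2 3 + q 2 3) (m 3 3 + q 3 3)
      = sym_det3 (m 1 1 - q 1 1) (m 1 2 - q 1 2) (m 1 3 - q 1 3)
        (m 2 2 - q 2 2) (m 2 3 - q 2 3) (m 3 3 - q 3 3)"
proof -
  define r s where "r = l * metric x u e1" and "s = l * metric x u e2"
  \<comment> \<open>Row \<open>i\<close> holds the frame coordinates of \<open>a i\<close>;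
    \<open>y\<close> is the congruence matrix of \<open>sym_det3_congruence\<close>.\<close>
  define y where "y = (\<lambda>i k::nat. metric x (a i) (if k = 1 then e1 else if k = 2 then e2 else e3))"
  define B where "B = (\<lambda>m11 m12 m22 m33 i j. m11 * y i 1 * y j 1 + m12 * (y i 1 * y j 2 + y i 2 * y j 1)
      + m22 * y i 2 * y j 2 + m33 * y i 3 * y j 3)"
  have y: "metric x (a i) e1 = y i 1" "metric x (a i) e2 = y i 2" "metric x (a i) e3 = y i 3" for i
    by (simp_all add: y_def)
  have q: "q i j = r * (y i 1 * y j 1 - y i 2 * y j 2) - s * (y i 1 * y j 2 + y i 2 * y j 1)" for i j
    unfolding q_def S3_frame_expand(2)[OF x fr] y r_def s_def by (simp only: algebra_simps)
  have m: "m i j = y i 1 * y j 1 + y i 2 * y j 2 + y i 3 * y j 3" for i j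
    unfolding m_def S3_frame_expand(1)[OF x fr, of "a i"] y by simp
  have eqs: "q i j = B r (- s) (- r) 0 i j" "m i j + q i j = B (1 + r) (- s) (1 - r) 1 i j"
    "m i j - q i j = B (1 - r) s (1 + r) 1 i j" for i j
    unfolding q m B_def by (simp_all only: algebra_simps mult_minus_left)
      (simp_all add: algebra_simps)
  show "sym_det3 (q 1 1) (q 1 2) (q 1 3) (q 2 2) (q 2 3) (q 3 3) = 0"
    unfolding eqs(1) unfolding B_def sym_det3_congruence by simp
  show "sym_det3 (m 1 1 + q 1 1) (m 1 2 + q 1 2) (m 1 3 + q 1 3)
        (m 2 2 + q 2 2) (m 2 3 + q 2 3) (m 3 3 + q 3 3)
      = sym_det3 (m 1 1 - q 1 1) (m 1 2 - q 1 2) (m 1 3 - q 1 3)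
        (m 2 2 - q 2 2) (m 2 3 - q 2 3) (m 3 3 - q 3 3)"
    unfolding eqs(2,3) unfolding B_def sym_det3_congruence by simp
qed

text \<open>The frame at \<open>x\<close> is kept as three constant chart vectors. In these,
  C(u,-,-) has vanishing last row and column at \<open>x\<close>, so \<open>D_sym_det3_last\<close>
  applies, with cofactor -l^2 for both e1 and e2.\<close>

lemma D_cubic_degenerate:
  assumes x: "x \<in> S" and fr: "S3_frame x e1 e2 e3 l" and l: "l \<noteq> 0"
    and all: "\<And>y. y \<in> S \<Longrightarrow> \<exists>e1 e2 e3 l. S3_frame y e1 e2 e3 l"
  shows "D v (\<lambda>x. cubic x e1 e3 e3) x = 0" "D v (\<lambda>x. cubic x e2 e3 e3) x = 0"
    "D v (\<lambda>x. cubic x e3 e3 e3) x = 0"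
proof -
  note F = fr[unfolded S3_frame_def]
  define a where "a = (\<lambda>i::nat. if i = 1 then e1 else if i = 2 then e2 else e3)"
  have a: "a 1 = e1" "a 2 = e2" "a 3 = e3" by (simp_all add: a_def)
  have c3: "cubic x u e3 w = 0" "cubic x u w e3 = 0" for u w
    using F cubic_commute12[OF x] cubic_commute23[OF x] by metis+
  have d0: "(cubic x u e1 e1 * cubic x u e2 e2 - (cubic x u e1 e2)\<^sup>2) * D v (\<lambda>x. cubic x u e3 e3) x = 0" for u
  proof (rule D_sym_det3_last[OF open_S x])
    show "sym_det3 (cubic y u e1 e1) (cubic y u e1 e2) (cubic y u e1 e3) (cubic y u e2 e2)
       (cubic y u e2 e3) (cubic y u e3 e3) = 0" if y: "y \<in> S" for y
      using all[OF y] S3_frame_determinants(1)[OF y, of _ _ _ _ u a] unfolding a by blast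
  qed (use c3 differentiable_cubic[OF x] in auto)
  show 1: "D v (\<lambda>x. cubic x e1 e3 e3) x = 0"
    using d0[of e1] F l by simp
  show "D v (\<lambda>x. cubic x e2 e3 e3) x = 0"
    using d0[of e2] F l cubic_commute12[OF x, of e2 e1] by simp
  \<comment> \<open>For \<open>u = e3\<close> the cofactor is zero. The vector
    \<open>e1 + e3\<close> has the same cofactor as \<open>e1\<close>, and the contribution of
    \<open>e1\<close> is already known to vanish.\<close>
  have lin: "cubic y (e1 + e3) u w = cubic y e1 u w + cubic y e3 u w" if "y \<in> S" for y u w
    using linear_add[OF linear_cubic[OF that]] .
  have "D v (\<lambda>x. cubic x (e1 + e3) e3 e3) x = 0"
    using d0[of "e1 + e3"] F l lin[OF x] by simp
  moreover have "D v (\<lambda>x. cubic x (e1 + e3) e3 e3) x = D v (\<lambda>x. cubic x e1 e3 e3 + cubic x e3 e3 e3) x"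
    using lin by (intro D_cong[OF open_S x])
  moreover have "\<dots> = D v (\<lambda>x. cubic x e1 e3 e3) x + D v (\<lambda>x. cubic x e3 e3 e3) x"
    by (rule D_eq[of _ "\<lambda>v. D v _ x + D v _ x"])
      (intro has_derivative_add D_has_derivative differentiable_cubic x)
  ultimately show "D v (\<lambda>x. cubic x e3 e3 e3) x = 0" using 1 by simp
qed

text \<open>At \<open>x\<close> the form C(e3,-,-) is zero and the metric is the identity matrix, so
  the first-order part of the second determinant identity is the trace.\<close>

lemma D_cubic_trace:
  assumes x: "x \<in> S" and fr: "S3_frame x e1 e2 e3 l"
    and all: "\<And>y. y \<in> S \<Longrightarrow> \<exists>e1 e2 e3 l. S3_frame y e1 e2 e3 l"
  shows "D v (\<lambda>x. cubic x e3 e1 e1) x + D v (\<lambda>x. cubic x e3 e2 e2) x + D v (\<lambda>x. cubic x e3 e3 e3) x = 0"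
proof -
  note F = fr[unfolded S3_frame_def]
  define a where "a = (\<lambda>i::nat. if i = 1 then e1 else if i = 2 then e2 else e3)"
  have a: "a 1 = e1" "a 2 = e2" "a 3 = e3" by (simp_all add: a_def)
  let ?m = "\<lambda>i j x. metric x (a i) (a j)" and ?q = "\<lambda>i j x. cubic x e3 (a i) (a j)"
  have "D v (?q 1 1) x + D v (?q 2 2) x + D v (?q 3 3) x = 0"
  proof (rule D_sym_det3_trace[OF open_S x, where m = ?m and q = ?q])
    show "sym_det3 (?m 1 1 y + ?q 1 1 y) (?m 1 2 y + ?q 1 2 y) (?m 1 3 y + ?q 1 3 y)
          (?m 2 2 y + ?q 2 2 y) (?m 2 3 y + ?q 2 3 y) (?m 3 3 y + ?q 3 3 y)
      = sym_det3 (?m 1 1 y - ?q 1 1 y) (?m 1 2 y - ?q 1 2 y) (?m 1 3 y - ?q 1 3 y)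
          (?m 2 2 y - ?q 2 2 y) (?m 2 3 y - ?q 2 3 y) (?m 3 3 y - ?q 3 3 y)" if y: "y \<in> S" for y
      using all[OF y] S3_frame_determinants(2)[OF y, of _ _ _ _ a e3] by blast
  qed (use F differentiable_cubic[OF x] differentiable_metric[OF x] in \<open>simp_all only: a\<close>)
  then show ?thesis unfolding a .
qed

text \<open>\<open>g\<close> and \<open>k\<close> are the chart coordinates of the tangential parts
  of the second derivatives along \<open>b\<close> and \<open>a\<close>. Both products contain
  -h(g,k), which cancels; the \<xi>-components contribute -s and -t through
  \<open>D2_conormal_normal\<close>. The term C(g,a,a) is the remaining Christoffel
  correction.\<close>

lemma codazzi_in_S3_frame:
  assumes x: "x \<in> S" and m: "metric x a a = 1" "metric x b b = 1"
    and c: "\<And>u v. cubic x b u v = 0"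
    and sh: "D a \<xi> x = - s *\<^sub>R D a f x" "D b \<xi> x = - t *\<^sub>R D b f x"
    and g: "D b (D b f) x = D g f x + \<xi> x"
  shows "D a (D a \<nu>) x \<bullet> D b (D b f) x - D b (D b \<nu>) x \<bullet> D a (D a f) x = t - s - cubic x g a a"
proof -
  have "\<nu> x \<bullet> (D a (D a f) x - \<xi> x) = 0"
    using m conormal_normal[OF x] unfolding metric_def by (simp add: inner_diff_right)
  then obtain k where "D a (D a f) x - \<xi> x = D k f x"
    using tangent_if[OF x] by blast
  then have k: "D a (D a f) x = D k f x + \<xi> x" by (simp add: algebra_simps)
  have "D a (D a \<nu>) x \<bullet> D b (D b f) x = - metric x g k - cubic x g a a - s"
    unfolding g using D2_conormal_tangent[OF x, of a a g] D2_conormal_normal[OF x, of a a] m sh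
      D_conormal_tangent[OF x] D_conormal_normal[OF x] k cubic_commute12[OF x] cubic_commute23[OF x]
    by (simp add: inner_add_right)
  moreover have "D b (D b \<nu>) x \<bullet> D a (D a f) x = - metric x g k - t"
    unfolding k using D2_conormal_tangent[OF x, of b b k] D2_conormal_normal[OF x, of b b] m sh
      D_conormal_tangent[OF x] D_conormal_normal[OF x] g c metric_commute[OF x]
    by (simp add: inner_add_right)
  ultimately show ?thesis by simp
qed

lemma shape_eigenvalues_eq:
  assumes x: "x \<in> S" and fr: "S3_frame x e1 e2 e3 l" and l: "l \<noteq> 0"
    and all: "\<And>y. y \<in> S \<Longrightarrow> \<exists>e1 e2 e3 l. S3_frame y e1 e2 e3 l"
    and sh: "D e1 \<xi> x = - s *\<^sub>R D e1 f x" "D e2 \<xi> x = - s *\<^sub>R D e2 f x" "D e3 \<xi> x = - t *\<^sub>R D e3 f x"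
  shows "s = t"
proof -
  note F = fr[unfolded S3_frame_def]
  have "\<nu> x \<bullet> (D e3 (D e3 f) x - \<xi> x) = 0"
    using F conormal_normal[OF x] unfolding metric_def by (simp add: inner_diff_right)
  then obtain g where "D e3 (D e3 f) x - \<xi> x = D g f x"
    using tangent_if[OF x] by blast
  then have g: "D e3 (D e3 f) x = D g f x + \<xi> x" by (simp add: algebra_simps)
  have sw: "D v (\<lambda>x. cubic x e3 a e3) x = D v (\<lambda>x. cubic x a e3 e3) x"
    "D v (\<lambda>x. cubic x a a e3) x = D v (\<lambda>x. cubic x e3 a a) x" for v a
    using cubic_commute12 cubic_commute23 by (intro D_cong[OF open_S x]; metis)+
  have 1: "D e1 (\<lambda>x. cubic x e1 e3 e3) x - D e3 (\<lambda>x. cubic x e3 e1 e1) x = t - s - cubic x g e1 e1"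
    using cubic_codazzi[OF x, of e1 e3] codazzi_in_S3_frame[OF x, of e1 e3 s t g] F sh g sw by metis
  have 2: "D e2 (\<lambda>x. cubic x e2 e3 e3) x - D e3 (\<lambda>x. cubic x e3 e2 e2) x = t - s - cubic x g e2 e2"
    using cubic_codazzi[OF x, of e2 e3] codazzi_in_S3_frame[OF x, of e2 e3 s t g] F sh g sw by metis
  \<comment> \<open>Harmonicity of Re (x + iy)^3 removes the Christoffel corrections from the sum of
    the two relations.\<close>
  have "cubic x g e1 e1 + cubic x g e2 e2 = 0"
    using S3_frame_expand(2)[OF x fr, of g e1 e1] S3_frame_expand(2)[OF x fr, of g e2 e2]
      F metric_commute[OF x, of e2 e1] by simp
  then show ?thesis
    using 1 2 D_cubic_degenerate[OF x fr l all] D_cubic_trace[OF x fr all, of e3] by simp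
qed

text \<open>Differentiate D_u \<xi> = -k D_u f along v and swap u and v: by injectivity of dF, (D_v
  k) u = (D_u k) v for all u. If D_v k were nonzero, every u would be a multiple of v, which
  dimension three forbids.\<close>

lemma umbilic_factor_derivative:
  fixes k :: "real^3 \<Rightarrow> real"
  assumes x: "x \<in> S" and u: "\<And>x u. x \<in> S \<Longrightarrow> D u \<xi> x = - k x *\<^sub>R D u f x"
    and d: "k differentiable (at x)"
  shows "D v k x = 0"
proof -
  have DD: "D v (D u \<xi>) x = - (k x *\<^sub>R D v (D u f) x + D v k x *\<^sub>R D u f x)" for u v
  proof -
    have "D v (D u \<xi>) x = D v (\<lambda>x. - (k x *\<^sub>R D u f x)) x"
      using u by (intro D_cong[OF open_S x]) simp
    also have "\<dots> = - (k x *\<^sub>R D v (D u f) x + D v k x *\<^sub>R D u f x)"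
      by (rule D_eq[of _ "\<lambda>v. - (k x *\<^sub>R D v (D u f) x + D v k x *\<^sub>R D u f x)"])
        (intro has_derivative_minus has_derivative_scaleR D_has_derivative d
          smooth_on_differentiable[OF _ x] smooth smooth_on_D)
    finally show ?thesis .
  qed
  have "D (D v k x *\<^sub>R u) f x = D (D u k x *\<^sub>R v) f x" for u
  proof -
    have "D v k x *\<^sub>R D u f x = D u k x *\<^sub>R D v f x"
      using DD[of v u] DD[of u v] D_swap[OF x smooth(2), of u v] D_swap[OF x smooth(1), of u v] by simp
    then show ?thesis
      using D_scale[OF smooth_on_differentiable[OF smooth(1) x]] by simp
  qed
  then have e: "D v k x *\<^sub>R u = D u k x *\<^sub>R v" for u
    using injD[OF inj_D[OF x]] by blast
  show ?thesis
  proof (rule ccontr)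
    assume "D v k x \<noteq> 0"
    then have "u = inverse (D v k x) *\<^sub>R (D v k x *\<^sub>R u)" for u :: "real^3"
      by simp
    then have "u \<in> span {v}" for u
      unfolding e by (metis span_base span_scale singletonI)
    then have "dim (UNIV :: (real^3) set) \<le> card {v}"
      by (intro dim_le_card) auto
    then show False by simp
  qed
qed

end

section \<open>Charts of a Blaschke hypersurface\<close>

lemma vector_4:
  "(vector [a, b, c, d] :: 'a::zero^4) $ 1 = a" "(vector [a, b, c, d] :: 'a^4) $ 2 = b"
  "(vector [a, b, c, d] :: 'a^4) $ 3 = c" "(vector [a, b, c, d] :: 'a^4) $ 4 = d"
  unfolding vector_def by simp_all

definition in_chart :: "'m chart \<Rightarrow> ('m \<Rightarrow> 'b) \<Rightarrow> real^3 \<Rightarrow> 'b" where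
  "in_chart c g = g \<circ> inv_into (fst c) (snd c)"

lemma chart_deriv_eq_D: "chart_deriv c g p u = D u (in_chart c g) (snd c p)"
  by (simp add: chart_deriv_def D_def in_chart_def)

locale blaschke_hypersurface =
  fixes M :: "'m topology" and A :: "'m chart set" and F \<xi> :: "'m \<Rightarrow> real^4"
  assumes hypersurface: "affine_hypersurface M A F \<xi>"
begin

lemma manifold: "smooth_manifold3 M A" and immersed: "immersion M A F"
  and smooth_normal: "smooth_fun_on A (topspace M) \<xi>"
  and transversal: "p \<in> topspace M \<Longrightarrow> \<xi> p \<notin> tangent_space A F p"
  and D_normal_tangent: "p \<in> topspace M \<Longrightarrow> v \<in> tangent_space A F p \<Longrightarrow>
    dir_deriv A F p v \<xi> \<in> tangent_space A F p"
  using hypersurface unfolding affine_hypersurface_def by blast+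

lemma smooth_immersion: "smooth_fun_on A (topspace M) F"
  using immersed unfolding immersion_def by blast

section \<open>Charts, change of charts and the tangent space\<close>

lemma chart:
  assumes c: "c \<in> A"
  shows openin_chart: "openin M (fst c)" and open_chart: "open (snd c ` fst c)"
    and inj_on_chart: "inj_on (snd c) (fst c)" and chart_subset: "fst c \<subseteq> topspace M"
    and open_chart_image: "openin M W \<Longrightarrow> open (snd c ` (fst c \<inter> W))"
proof -
  have *: "openin M (fst c) \<and> open (snd c ` fst c) \<and>
      homeomorphic_map (subtopology M (fst c)) (top_of_set (snd c ` fst c)) (snd c)"
    using manifold c unfolding smooth_manifold3_def split_def by blast
  then show "openin M (fst c)" and op: "open (snd c ` fst c)" by auto
  then show sub: "fst c \<subseteq> topspace M" using openin_subset by blast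
  then have top: "topspace (subtopology M (fst c)) = fst c" by auto
  then show "inj_on (snd c) (fst c)"
    using * homeomorphic_imp_injective_map by metis
  show "open (snd c ` (fst c \<inter> W))" if "openin M W"
  proof -
    have "openin (subtopology M (fst c)) (fst c \<inter> W)"
      using that by (simp add: openin_subtopology_Int2)
    then have "openin (top_of_set (snd c ` fst c)) (snd c ` (fst c \<inter> W))"
      using * homeomorphic_map_openness[of "subtopology M (fst c)" _ "snd c" "fst c \<inter> W"] top by auto
    then show ?thesis using op openin_open_eq by blast
  qed
qed

lemma ex_chart: "p \<in> topspace M \<Longrightarrow> \<exists>c\<in>A. p \<in> fst c"
proof -
  assume p: "p \<in> topspace M"
  have "(\<Union>(U, \<phi>)\<in>A. U) = topspace M"
    using manifold unfolding smooth_manifold3_def by blast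
  with p have "p \<in> (\<Union>(U, \<phi>)\<in>A. U)" by simp
  then show ?thesis by force
qed

lemma inv_chart: "c \<in> A \<Longrightarrow> p \<in> fst c \<Longrightarrow> inv_into (fst c) (snd c) (snd c p) = p"
  using inj_on_chart by simp

lemma in_chart_apply: "c \<in> A \<Longrightarrow> p \<in> fst c \<Longrightarrow> in_chart c g (snd c p) = g p"
  by (simp add: in_chart_def inv_chart)

lemma smooth_in_chart:
  "smooth_fun_on A W g \<Longrightarrow> c \<in> A \<Longrightarrow> smooth_on (snd c ` (fst c \<inter> W)) (in_chart c g)"
  unfolding smooth_fun_on_def split_def in_chart_def by blast

lemma smooth_fun_onI:
  "(\<And>c. c \<in> A \<Longrightarrow> smooth_on (snd c ` (fst c \<inter> W)) (in_chart c g)) \<Longrightarrow> smooth_fun_on A W g"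
  unfolding smooth_fun_on_def split_def in_chart_def by blast

lemma smooth_in_chart_topspace:
  assumes "smooth_fun_on A (topspace M) g" "c \<in> A"
  shows "smooth_on (snd c ` fst c) (in_chart c g)"
  using smooth_in_chart[OF assms] chart_subset[OF assms(2)] by (simp add: Int_absorb2)

lemma differentiable_in_chart:
  "smooth_fun_on A W g \<Longrightarrow> c \<in> A \<Longrightarrow> p \<in> fst c \<Longrightarrow> p \<in> W \<Longrightarrow> in_chart c g differentiable (at (snd c p))"
  using smooth_in_chart smooth_on_differentiable by (metis Int_iff imageI)

lemma smooth_fun_on_subset: "smooth_fun_on A W g \<Longrightarrow> V \<subseteq> W \<Longrightarrow> smooth_fun_on A V g"
  by (rule smooth_fun_onI, rule smooth_on_subset[OF smooth_in_chart]) auto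

lemma smooth_fun_on_cong:
  assumes "openin M W" "\<And>q. q \<in> W \<Longrightarrow> f q = g q" "smooth_fun_on A W f"
  shows "smooth_fun_on A W g"
proof (rule smooth_fun_onI)
  fix c assume c: "c \<in> A"
  show "smooth_on (snd c ` (fst c \<inter> W)) (in_chart c g)"
    by (rule smooth_on_cong[OF open_chart_image[OF c assms(1)] _ smooth_in_chart[OF assms(3) c]])
      (auto simp: assms(2) in_chart_apply[OF c])
qed

text \<open>Chain rule through the transition map, which is
  \<open>in_chart c' (snd c)\<close>.\<close>

lemma D_in_chart_change:
  assumes c: "c \<in> A" "p \<in> fst c" and c': "c' \<in> A" "p \<in> fst c'"
    and g: "in_chart c g differentiable (at (snd c p))"
  shows "D u (in_chart c' g) (snd c' p) = D (D u (in_chart c' (snd c)) (snd c' p)) (in_chart c g) (snd c p)"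
proof -
  let ?S = "snd c' ` (fst c' \<inter> fst c)"
  have S: "open ?S" "snd c' p \<in> ?S"
    using open_chart_image[OF c'(1) openin_chart[OF c(1)]] c c' by auto
  have "smooth_on ?S (in_chart c' (snd c))"
    using manifold c c' unfolding smooth_manifold3_def split_def in_chart_def by blast
  then have "in_chart c' (snd c) differentiable (at (snd c' p))"
    using S smooth_on_differentiable by blast
  then have "((\<lambda>y. in_chart c g (in_chart c' (snd c) y)) has_derivative
      (\<lambda>u. D (D u (in_chart c' (snd c)) (snd c' p)) (in_chart c g) (snd c p))) (at (snd c' p))"
    using g in_chart_apply[OF c', of "snd c"]
    by (intro has_derivative_compose[OF D_has_derivative]) (auto intro: D_has_derivative)
  then have "D u (\<lambda>y. in_chart c g (in_chart c' (snd c) y)) (snd c' p)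
      = D (D u (in_chart c' (snd c)) (snd c' p)) (in_chart c g) (snd c p)"
    by (rule D_eq)
  moreover have "D u (in_chart c' g) (snd c' p) = D u (\<lambda>y. in_chart c g (in_chart c' (snd c) y)) (snd c' p)"
    by (rule D_cong[OF S]) (auto simp: in_chart_apply[OF c(1)] in_chart_apply[OF c'(1)])
  ultimately show ?thesis by simp
qed

lemma differentiable_immersion: "c \<in> A \<Longrightarrow> p \<in> fst c \<Longrightarrow> in_chart c F differentiable (at (snd c p))"
  using differentiable_in_chart[OF smooth_immersion] chart_subset by blast

lemma inj_D_immersion: "c \<in> A \<Longrightarrow> p \<in> fst c \<Longrightarrow> inj (\<lambda>u. D u (in_chart c F) (snd c p))"
  using immersed unfolding immersion_def chart_deriv_eq_D[abs_def] by blast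

lemma range_D_immersion_subset:
  assumes "c \<in> A" "p \<in> fst c" "c' \<in> A" "p \<in> fst c'"
  shows "range (\<lambda>u. D u (in_chart c' F) (snd c' p)) \<subseteq> range (\<lambda>u. D u (in_chart c F) (snd c p))"
  using D_in_chart_change[OF assms differentiable_immersion[OF assms(1,2)]] by auto

lemma tangent_space_eq:
  assumes "c \<in> A" "p \<in> fst c"
  shows "tangent_space A F p = range (\<lambda>u. D u (in_chart c F) (snd c p))"
  unfolding tangent_space_def chart_deriv_eq_D[abs_def]
  using range_D_immersion_subset[OF assms] assms by blast

text \<open>The description in \<open>dir_deriv\<close> has one solution: if another chart
  represents the same tangent vector, injectivity of dF forces its coordinates to correspond under
  the transition map, and the chain rule then gives the same derivative.\<close>

lemma dir_deriv_eq:
  assumes c: "c \<in> A" "p \<in> fst c" and g: "in_chart c g differentiable (at (snd c p))"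
  shows "dir_deriv A F p (D u (in_chart c F) (snd c p)) g = D u (in_chart c g) (snd c p)"
  unfolding dir_deriv_def chart_deriv_eq_D
proof (rule the_equality)
  fix d assume "\<exists>c'\<in>A. p \<in> fst c' \<and> (\<exists>u'. D u' (in_chart c' F) (snd c' p) = D u (in_chart c F) (snd c p)
      \<and> D u' (in_chart c' g) (snd c' p) = d)"
  then obtain c' u' where c': "c' \<in> A" "p \<in> fst c'"
    and u': "D u' (in_chart c' F) (snd c' p) = D u (in_chart c F) (snd c p)"
    and d: "D u' (in_chart c' g) (snd c' p) = d" by blast
  have "D u' (in_chart c' (snd c)) (snd c' p) = u"
    using u' injD[OF inj_D_immersion[OF c]] D_in_chart_change[OF c c' differentiable_immersion[OF c]]
    by simp
  then show "d = D u (in_chart c g) (snd c p)"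
    using D_in_chart_change[OF c c' g] d by simp
qed (use c in blast)

lemma subspace_tangent_space:
  assumes "p \<in> topspace M" shows "subspace (tangent_space A F p)"
proof -
  obtain c where "c \<in> A" "p \<in> fst c" using ex_chart assms by blast
  then show ?thesis
    using tangent_space_eq linear_D[OF differentiable_immersion]
    by (metis linear_subspace_image subspace_UNIV)
qed

lemma dim_tangent_space:
  assumes "p \<in> topspace M" shows "dim (tangent_space A F p) = 3"
proof -
  obtain c where c: "c \<in> A" "p \<in> fst c" using ex_chart assms by blast
  then show ?thesis
    using tangent_space_eq[OF c] dim_image_eq[OF linear_D[OF differentiable_immersion[OF c]], of UNIV]
      inj_D_immersion[OF c] by simp
qed

text \<open>The coordinate frame completed by \<open>\<xi>\<close>, as the rows of a matrix, and its dual basis,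
  which is smooth by Cramer's rule. The last dual vector is the conormal.\<close>

definition frame :: "'m chart \<Rightarrow> real^3 \<Rightarrow> real^4^4" where
  "frame c x = vector [D (axis 1 1) (in_chart c F) x, D (axis 2 1) (in_chart c F) x,
     D (axis 3 1) (in_chart c F) x, in_chart c \<xi> x]"

definition dual :: "'m chart \<Rightarrow> 4 \<Rightarrow> real^3 \<Rightarrow> real^4" where
  "dual c m x = (\<chi> k. det (\<chi> i j. if j = k then axis m 1 $ i else frame c x $ i $ j)
     * inverse (det (frame c x)))"

abbreviation conormal :: "'m chart \<Rightarrow> real^3 \<Rightarrow> real^4" where
  "conormal c \<equiv> dual c 4"

lemma D_frame:
  assumes "in_chart c F differentiable (at x)"
  shows "D u (in_chart c F) x = u $ 1 *\<^sub>R frame c x $ 1 + u $ 2 *\<^sub>R frame c x $ 2 + u $ 3 *\<^sub>R frame c x $ 3"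
proof -
  have "u = u $ 1 *\<^sub>R axis 1 1 + u $ 2 *\<^sub>R axis 2 1 + u $ 3 *\<^sub>R axis 3 1"
    by (simp add: vec_eq_iff forall_3 axis_def)
  then have "D u (in_chart c F) x
      = D (u $ 1 *\<^sub>R axis 1 1 + u $ 2 *\<^sub>R axis 2 1 + u $ 3 *\<^sub>R axis 3 1) (in_chart c F) x"
    by simp
  then show ?thesis
    using assms by (simp add: D_add D_scale frame_def vector_4)
qed

text \<open>The transposed frame matrix sends w to dF(w1,w2,w3) + w4 \<xi>. It is injective because
  \<xi> is transversal and F is an immersion, hence also surjective.\<close>

lemma
  assumes c: "c \<in> A" and x: "x \<in> snd c ` fst c"
  shows det_frame: "det (frame c x) \<noteq> 0"
    and frame_spans: "\<exists>w :: real^4. z = w $ 1 *\<^sub>R frame c x $ 1 + w $ 2 *\<^sub>R frame c x $ 2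
      + w $ 3 *\<^sub>R frame c x $ 3 + w $ 4 *\<^sub>R frame c x $ 4"
proof -
  let ?L = "\<lambda>w. transpose (frame c x) *v w"
  obtain p where p: "p \<in> fst c" "x = snd c p" using x by blast
  have top: "p \<in> topspace M" using p chart_subset[OF c] by blast
  have L: "?L w = D (vector [w $ 1, w $ 2, w $ 3]) (in_chart c F) x + w $ 4 *\<^sub>R \<xi> p" for w
    using D_frame[OF differentiable_immersion[OF c p(1)], of "vector [w $ 1, w $ 2, w $ 3]"]
      in_chart_apply[OF c p(1), of \<xi>]
    unfolding p(2) by (simp add: vec_eq_iff matrix_vector_mult_def transpose_def sum_4 vector_4 frame_def mult.commute)
  have "inj ?L"
    unfolding linear_injective_0[OF matrix_vector_mul_linear]
  proof (intro allI impI)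
    fix w assume "?L w = 0"
    then have 0: "D (vector [w $ 1, w $ 2, w $ 3]) (in_chart c F) x + w $ 4 *\<^sub>R \<xi> p = 0"
      using L by simp
    let ?t = "D (vector [w $ 1, w $ 2, w $ 3]) (in_chart c F) x"
    have t: "?t \<in> tangent_space A F p"
      using tangent_space_eq[OF c p(1)] p by blast
    have w4: "w $ 4 = 0"
    proof (rule ccontr)
      assume "w $ 4 \<noteq> 0"
      then have "\<xi> p = inverse (w $ 4) *\<^sub>R (w $ 4 *\<^sub>R \<xi> p)"
        by simp
      also have "w $ 4 *\<^sub>R \<xi> p = - ?t"
        using 0 by (simp add: add_eq_0_iff)
      finally have "\<xi> p = (- inverse (w $ 4)) *\<^sub>R ?t"
        by simp
      then show False
        using transversal[OF top] t subspace_scale[OF subspace_tangent_space[OF top]] by metis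
    qed
    then have "?t = 0" using 0 by simp
    moreover have "D 0 (in_chart c F) x = 0"
      using linear_0[OF linear_D[OF differentiable_immersion[OF c p(1)]]] p by simp
    ultimately have "vector [w $ 1, w $ 2, w $ 3] = (0 :: real^3)"
      using injD[OF inj_D_immersion[OF c p(1)]] p by metis
    then have "w $ 1 = 0 \<and> w $ 2 = 0 \<and> w $ 3 = 0"
      by (metis vector_3 zero_index)
    then show "w = 0" using w4 by (simp add: vec_eq_iff forall_4)
  qed
  then have "det (matrix ?L) \<noteq> 0" "surj ?L"
    using det_nz_iff_inj[OF matrix_vector_mul_linear] linear_injective_imp_surjective by blast+
  then show "det (frame c x) \<noteq> 0"
    by (metis det_transpose matrix_of_matrix_vector_mul)
  obtain w where "z = ?L w" using \<open>surj ?L\<close> by blast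
  then show "\<exists>w :: real^4. z = w $ 1 *\<^sub>R frame c x $ 1 + w $ 2 *\<^sub>R frame c x $ 2
      + w $ 3 *\<^sub>R frame c x $ 3 + w $ 4 *\<^sub>R frame c x $ 4"
    by (intro exI[of _ w]) (simp add: vec_eq_iff matrix_vector_mult_def transpose_def sum_4 mult.commute)
qed

lemma smooth_frame:
  assumes c: "c \<in> A" shows "smooth_on (snd c ` fst c) (\<lambda>x. frame c x $ i $ j)"
proof -
  note o = open_chart[OF c]
  have s: "smooth_on (snd c ` fst c) (\<lambda>x. D u (in_chart c F) x $ j)"
    "smooth_on (snd c ` fst c) (\<lambda>x. in_chart c \<xi> x $ j)" for u
    using smooth_in_chart_topspace[OF _ c] smooth_immersion smooth_normal
    by (auto intro!: smooth_on_component o smooth_on_D)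
  have "\<forall>i. smooth_on (snd c ` fst c) (\<lambda>x. frame c x $ i $ j)"
    unfolding forall_4 frame_def vector_4 using s by blast
  then show ?thesis by blast
qed

lemma smooth_dual:
  assumes c: "c \<in> A" shows "smooth_on (snd c ` fst c) (dual c m)"
proof -
  note o = open_chart[OF c]
  have "smooth_on (snd c ` fst c)
    (\<lambda>x. (\<chi> i j. if j = k then axis m 1 $ i else frame c x $ i $ j :: real^4^4) $ i $ j)" for i j k
    using smooth_frame[OF c] by (cases "j = k") (auto simp: smooth_on_const)
  then show ?thesis
    unfolding dual_def[abs_def]
    by (intro smooth_on_vec smooth_on_mult smooth_on_det smooth_on_inverse o smooth_frame c det_frame)
qed

lemma frame_inner_dual:
  assumes "c \<in> A" "x \<in> snd c ` fst c"
  shows "frame c x $ i \<bullet> dual c m x = (if i = m then 1 else 0)"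
proof -
  have "frame c x *v dual c m x = axis m 1"
    using cramer[OF det_frame[OF assms], of "dual c m x" "axis m 1"] by (simp add: dual_def divide_inverse)
  then have "(frame c x *v dual c m x) $ i = axis m 1 $ i" by simp
  then show ?thesis by (simp add: matrix_vector_mul_component axis_def)
qed

lemma frame_expansion:
  assumes "c \<in> A" "x \<in> snd c ` fst c"
  shows "z = (dual c 1 x \<bullet> z) *\<^sub>R frame c x $ 1 + (dual c 2 x \<bullet> z) *\<^sub>R frame c x $ 2
      + (dual c 3 x \<bullet> z) *\<^sub>R frame c x $ 3 + (conormal c x \<bullet> z) *\<^sub>R frame c x $ 4"
proof -
  obtain w :: "real^4" where w: "z = w $ 1 *\<^sub>R frame c x $ 1 + w $ 2 *\<^sub>R frame c x $ 2
      + w $ 3 *\<^sub>R frame c x $ 3 + w $ 4 *\<^sub>R frame c x $ 4"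
    using frame_spans[OF assms] by blast
  have "dual c i x \<bullet> frame c x $ j = (if j = i then 1 else 0)" for i j
    using frame_inner_dual[OF assms] by (simp add: inner_commute)
  then have "dual c 1 x \<bullet> z = w $ 1" "dual c 2 x \<bullet> z = w $ 2" "dual c 3 x \<bullet> z = w $ 3"
    "dual c 4 x \<bullet> z = w $ 4"
    unfolding w by (simp_all add: inner_add_right)
  then show ?thesis using w by simp
qed

text \<open>On tangent vectors this inverts the differential of \<open>F\<close>, and it annihilates
  \<xi>; being built from the dual frame, it depends smoothly on the point.\<close>

definition coordinates :: "'m chart \<Rightarrow> real^3 \<Rightarrow> real^4 \<Rightarrow> real^3" where
  "coordinates c x z = (\<chi> i. (if i = 1 then dual c 1 x else if i = 2 then dual c 2 x else dual c 3 x) \<bullet> z)"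

lemma coordinate_expansion:
  assumes "c \<in> A" "p \<in> fst c"
  shows "z = D (coordinates c (snd c p) z) (in_chart c F) (snd c p) + (conormal c (snd c p) \<bullet> z) *\<^sub>R \<xi> p"
proof -
  have "D (coordinates c (snd c p) z) (in_chart c F) (snd c p) = (dual c 1 (snd c p) \<bullet> z) *\<^sub>R frame c (snd c p) $ 1
      + (dual c 2 (snd c p) \<bullet> z) *\<^sub>R frame c (snd c p) $ 2 + (dual c 3 (snd c p) \<bullet> z) *\<^sub>R frame c (snd c p) $ 3"
    by (simp add: D_frame[OF differentiable_immersion[OF assms]] coordinates_def)
  moreover have "frame c (snd c p) $ 4 = \<xi> p"
    using in_chart_apply[OF assms, of \<xi>] by (simp add: frame_def vector_4)
  ultimately show ?thesis
    using frame_expansion[OF assms(1), of "snd c p" z] assms(2) by (metis imageI)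
qed

lemma conormal_immersion: "c \<in> A \<Longrightarrow> p \<in> fst c \<Longrightarrow> conormal c (snd c p) \<bullet> D u (in_chart c F) (snd c p) = 0"
  using frame_inner_dual[of c "snd c p" _ 4]
  by (simp add: D_frame[OF differentiable_immersion] inner_add_right inner_commute[of "dual _ _ _"])

lemma conormal_\<xi>: "c \<in> A \<Longrightarrow> p \<in> fst c \<Longrightarrow> conormal c (snd c p) \<bullet> \<xi> p = 1"
  using frame_inner_dual[of c "snd c p" 4 4] in_chart_apply[of c p \<xi>]
  by (simp add: frame_def vector_4 inner_commute)

lemma tangent_space_conormal:
  assumes c: "c \<in> A" "p \<in> fst c"
  shows "z \<in> tangent_space A F p \<longleftrightarrow> conormal c (snd c p) \<bullet> z = 0"
proof
  show "z \<in> tangent_space A F p" if "conormal c (snd c p) \<bullet> z = 0"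
    using that coordinate_expansion[OF c, of z] tangent_space_eq[OF c] by auto
qed (use tangent_space_eq[OF c] conormal_immersion[OF c] in auto)

lemma transversal_part_eq:
  assumes c: "c \<in> A" "p \<in> fst c"
  shows "transversal_part A F \<xi> p z = conormal c (snd c p) \<bullet> z"
  unfolding transversal_part_def
proof (rule the_equality)
  show "\<exists>t\<in>tangent_space A F p. z = t + (conormal c (snd c p) \<bullet> z) *\<^sub>R \<xi> p"
    using coordinate_expansion[OF c, of z] tangent_space_eq[OF c] by auto
qed (use tangent_space_conormal[OF c] conormal_\<xi>[OF c] in \<open>auto simp: inner_add_right\<close>)

lemma tangential_part_eq:
  assumes c: "c \<in> A" "p \<in> fst c"
  shows "tangential_part A F \<xi> p z = z - (conormal c (snd c p) \<bullet> z) *\<^sub>R \<xi> p"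
  unfolding tangential_part_def
proof (rule the_equality)
  show "z - (conormal c (snd c p) \<bullet> z) *\<^sub>R \<xi> p \<in> tangent_space A F p \<and>
      (\<exists>a. z = z - (conormal c (snd c p) \<bullet> z) *\<^sub>R \<xi> p + a *\<^sub>R \<xi> p)"
    using tangent_space_conormal[OF c] conormal_\<xi>[OF c] by (auto simp: inner_diff_right)
qed (use tangent_space_conormal[OF c] conormal_\<xi>[OF c] in \<open>auto simp: inner_add_right\<close>)

lemma equiaffine_chart_in_chart:
  assumes c: "c \<in> A"
  shows "equiaffine_chart (snd c ` fst c) (in_chart c F) (in_chart c \<xi>) (conormal c)"
proof
  show "open (snd c ` fst c)" using open_chart[OF c] .
  show "smooth_on (snd c ` fst c) (in_chart c F)" "smooth_on (snd c ` fst c) (in_chart c \<xi>)"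
    "smooth_on (snd c ` fst c) (conormal c)"
    using smooth_in_chart_topspace[OF _ c] smooth_immersion smooth_normal smooth_dual[OF c] by auto
  fix x u assume "x \<in> snd c ` fst c"
  then obtain p where p: "p \<in> fst c" "x = snd c p" by blast
  note cp = c p(1)
  have top: "p \<in> topspace M" using chart_subset[OF c] p by blast
  show "conormal c x \<bullet> D u (in_chart c F) x = 0"
    using conormal_immersion[OF cp] p by simp
  show "conormal c x \<bullet> in_chart c \<xi> x = 1"
    using conormal_\<xi>[OF cp] in_chart_apply[OF cp, of \<xi>] p by simp
  show "conormal c x \<bullet> D u (in_chart c \<xi>) x = 0"
    using D_normal_tangent[OF top, of "D u (in_chart c F) x"] tangent_space_conormal[OF cp] p
      conormal_immersion[OF cp] dir_deriv_eq[OF cp differentiable_in_chart[OF smooth_normal cp top]] by simp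
  show "inj (\<lambda>u. D u (in_chart c F) x)"
    using inj_D_immersion[OF cp] p by simp
  show "\<exists>u. z = D u (in_chart c F) x" if "conormal c x \<bullet> z = 0" for z
    using that coordinate_expansion[OF cp, of z] p by auto
qed

section \<open>Vector fields and the affine metric\<close>

text \<open>The tangential parts of the constant fields are globally defined and span every tangent
  space, so they can replace coordinate fields.\<close>

definition constant_field :: "real^4 \<Rightarrow> 'm \<Rightarrow> real^4" where
  "constant_field z = (\<lambda>q. tangential_part A F \<xi> q z)"

lemma constant_field_tangent: "q \<in> topspace M \<Longrightarrow> constant_field z q \<in> tangent_space A F q"
  using ex_chart[of q] tangent_space_conormal conormal_\<xi>
  by (auto simp: constant_field_def tangential_part_eq inner_diff_right)

lemma constant_field_apply: "q \<in> topspace M \<Longrightarrow> z \<in> tangent_space A F q \<Longrightarrow> constant_field z q = z"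
  using ex_chart[of q] tangent_space_conormal
  by (auto simp: constant_field_def tangential_part_eq)

lemma vector_field_constant_field: "vector_field M A F (topspace M) (constant_field z)"
  unfolding vector_field_def
proof (intro conjI ballI smooth_fun_onI)
  fix c assume c: "c \<in> A"
  let ?S = "snd c ` (fst c \<inter> topspace M)"
  have S: "?S = snd c ` fst c" using chart_subset[OF c] by (simp add: Int_absorb2)
  have "smooth_on ?S (\<lambda>x. z - (conormal c x \<bullet> z) *\<^sub>R in_chart c \<xi> x)"
    unfolding S by (intro smooth_on_diff smooth_on_const smooth_on_scaleR smooth_on_inner
        smooth_dual c open_chart smooth_in_chart_topspace smooth_normal)
  then show "smooth_on ?S (in_chart c (constant_field z))"
    unfolding S
    by (rule smooth_on_cong[OF open_chart[OF c], rotated])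
      (auto simp: constant_field_def in_chart_apply[OF c] tangential_part_eq[OF c])
qed (use constant_field_tangent in auto)

lemma vector_field_subset:
  "vector_field M A F W Y \<Longrightarrow> openin M V \<Longrightarrow> V \<subseteq> W \<Longrightarrow> vector_field M A F V Y"
  unfolding vector_field_def using smooth_fun_on_subset by blast

text \<open>Differentiate \<nu> . Y = 0. The right-hand side involves \<open>Y\<close> only through
  \<open>Y p\<close>, which is why the affine metric does not depend on the extension.\<close>

lemma conormal_D_vector_field:
  assumes Y: "vector_field M A F W Y" "p \<in> W" and c: "c \<in> A" "p \<in> fst c"
  shows "conormal c (snd c p) \<bullet> D u (in_chart c Y) (snd c p) = - (D u (conormal c) (snd c p) \<bullet> Y p)"
proof -
  let ?S = "snd c ` (fst c \<inter> W)"
  have W: "openin M W" "smooth_fun_on A W Y" "\<And>q. q \<in> W \<Longrightarrow> Y q \<in> tangent_space A F q"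
    using Y unfolding vector_field_def by auto
  have S: "open ?S" "snd c p \<in> ?S"
    using open_chart_image[OF c(1) W(1)] c Y by auto
  have t: "conormal c (snd c q) \<bullet> Y q = 0" if "q \<in> fst c" "q \<in> W" for q
    using tangent_space_conormal[OF c(1) that(1)] W(3)[OF that(2)] by blast
  have "D u (\<lambda>x. conormal c x \<bullet> in_chart c Y x) (snd c p) = 0"
    by (rule D_constant_on[OF S, of _ 0])
      (auto simp: t in_chart_apply[OF c(1)])
  moreover have "D u (\<lambda>x. conormal c x \<bullet> in_chart c Y x) (snd c p) =
      conormal c (snd c p) \<bullet> D u (in_chart c Y) (snd c p) + D u (conormal c) (snd c p) \<bullet> in_chart c Y (snd c p)"
    using D_inner[OF smooth_on_differentiable[OF smooth_dual[OF c(1)]] differentiable_in_chart[OF W(2) c Y(2)]]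
      c by blast
  ultimately show ?thesis using in_chart_apply[OF c, of Y] by simp
qed

lemma affine_metric_eq:
  assumes c: "c \<in> A" "p \<in> fst c" and w: "w \<in> tangent_space A F p"
  shows "affine_metric M A F \<xi> p (D u (in_chart c F) (snd c p)) w = - (D u (conormal c) (snd c p) \<bullet> w)"
proof -
  let ?v = "D u (in_chart c F) (snd c p)"
  have top: "p \<in> topspace M" using chart_subset[OF c(1)] c by blast
  have *: "transversal_part A F \<xi> p (dir_deriv A F p ?v Y) = - (D u (conormal c) (snd c p) \<bullet> w)"
    if "vector_field M A F W Y" "p \<in> W" "Y p = w" for W Y
    using that conormal_D_vector_field[OF that(1,2) c] transversal_part_eq[OF c]
      dir_deriv_eq[OF c differentiable_in_chart[of W Y, OF _ c that(2)]] unfolding vector_field_def by simp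
  show ?thesis
    unfolding affine_metric_def
  proof (rule the_equality)
    show "\<exists>W Y. p \<in> W \<and> vector_field M A F W Y \<and> Y p = w \<and>
        - (D u (conormal c) (snd c p) \<bullet> w) = transversal_part A F \<xi> p (dir_deriv A F p ?v Y)"
      using *[OF vector_field_constant_field top constant_field_apply[OF top w]]
        vector_field_constant_field constant_field_apply[OF top w] top by metis
  qed (use * in blast)
qed

lemma affine_metric_in_chart:
  assumes c: "c \<in> A" "p \<in> fst c"
  shows "affine_metric M A F \<xi> p (D u (in_chart c F) (snd c p)) (D v (in_chart c F) (snd c p))
    = equiaffine_chart.metric (in_chart c F) (conormal c) (snd c p) u v"
proof -
  interpret equiaffine_chart "snd c ` fst c" "in_chart c F" "in_chart c \<xi>" "conormal c"
    by (rule equiaffine_chart_in_chart[OF c(1)])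
  show ?thesis
    using affine_metric_eq[OF c, of "D v (in_chart c F) (snd c p)" u] D_conormal_tangent[of "snd c p" u v]
      tangent_space_eq[OF c] c by auto
qed

end

section \<open>Derivatives along a variable vector, and rules for vector fields and the
  metric\<close>

lemma D_sum_Basis:
  fixes g :: "'a::euclidean_space \<Rightarrow> 'b::real_normed_vector"
  assumes "g differentiable (at x)"
  shows "D v g x = (\<Sum>b\<in>Basis. (v \<bullet> b) *\<^sub>R D b g x)"
proof -
  have "D v g x = D (\<Sum>b\<in>Basis. (v \<bullet> b) *\<^sub>R b) g x"
    by (simp add: euclidean_representation)
  also have "\<dots> = (\<Sum>b\<in>Basis. (v \<bullet> b) *\<^sub>R D b g x)"
    unfolding linear_sum[OF linear_D[OF assms]] D_scale[OF assms] ..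
  finally show ?thesis .
qed

text \<open>Expanding the direction in \<open>Basis\<close> leaves constant directions with variable
  coefficients, to which the product rule applies.\<close>

lemma
  fixes g :: "'a::euclidean_space \<Rightarrow> 'b::real_normed_vector"
  assumes S: "open S" "x \<in> S" and g: "smooth_on S g" and y: "y differentiable (at x)"
  shows differentiable_D_along: "(\<lambda>x. D (y x) g x) differentiable (at x)"
    and D_D_along: "D w (\<lambda>x. D (y x) g x) x = D (D w y x) g x + D w (D (y x) g) x"
proof -
  note d = smooth_on_differentiable[OF g] smooth_on_differentiable[OF smooth_on_D[OF g] S(2)]
  have gen: "((\<lambda>x. D (y x) g x) has_derivative
      (\<lambda>w. \<Sum>b\<in>Basis. (y x \<bullet> b) *\<^sub>R D w (D b g) x + (D w y x \<bullet> b) *\<^sub>R D b g x)) (at x)"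
    if "y differentiable (at x)" for y
  proof (rule has_derivative_transform_within_open[OF _ S])
    show "((\<lambda>x. \<Sum>b\<in>Basis. (y x \<bullet> b) *\<^sub>R D b g x) has_derivative
      (\<lambda>w. \<Sum>b\<in>Basis. (y x \<bullet> b) *\<^sub>R D w (D b g) x + (D w y x \<bullet> b) *\<^sub>R D b g x)) (at x)"
      by (intro has_derivative_sum has_derivative_scaleR has_derivative_inner_left D_has_derivative d that)
  qed (simp add: D_sum_Basis[OF d(1)])
  show "(\<lambda>x. D (y x) g x) differentiable (at x)"
    using gen[OF y] unfolding differentiable_def by blast
  \<comment> \<open>The same formula for the constant map with value \<open>y x\<close> identifies
    the second summand.\<close>
  have "D w (D (y x) g) x = (\<Sum>b\<in>Basis. (y x \<bullet> b) *\<^sub>R D w (D b g) x)"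
    using D_eq[OF gen[of "\<lambda>_. y x"], of w] by (simp add: D_def)
  then show "D w (\<lambda>x. D (y x) g x) x = D (D w y x) g x + D w (D (y x) g) x"
    using D_eq[OF gen[OF y]] D_sum_Basis[OF d(1)[OF S(2)], of "D w y x"]
    by (simp add: sum.distrib)
qed

context blaschke_hypersurface
begin

lemma vector_fieldI:
  "openin M W \<Longrightarrow> smooth_fun_on A W Y \<Longrightarrow> (\<And>q. q \<in> W \<Longrightarrow> Y q \<in> tangent_space A F q) \<Longrightarrow> vector_field M A F W Y"
  unfolding vector_field_def by blast

lemma vector_fieldD:
  assumes "vector_field M A F W Y"
  shows "openin M W" "smooth_fun_on A W Y" "q \<in> W \<Longrightarrow> Y q \<in> tangent_space A F q" "W \<subseteq> topspace M"
  using assms openin_subset unfolding vector_field_def by auto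

lemma smooth_fun_on_add:
  "openin M W \<Longrightarrow> smooth_fun_on A W f \<Longrightarrow> smooth_fun_on A W g \<Longrightarrow> smooth_fun_on A W (\<lambda>q. f q + g q)"
  by (rule smooth_fun_onI)
    (use smooth_on_add[OF open_chart_image smooth_in_chart smooth_in_chart] in \<open>simp add: in_chart_def comp_def\<close>)

lemma smooth_fun_on_scaleR:
  "openin M W \<Longrightarrow> smooth_fun_on A W f \<Longrightarrow> smooth_fun_on A W g \<Longrightarrow> smooth_fun_on A W (\<lambda>q. f q *\<^sub>R g q)"
  by (rule smooth_fun_onI)
    (use smooth_on_scaleR[OF open_chart_image smooth_in_chart smooth_in_chart] in \<open>simp add: in_chart_def comp_def\<close>)

lemma smooth_fun_on_component:
  "openin M W \<Longrightarrow> smooth_fun_on A W f \<Longrightarrow> smooth_fun_on A W (\<lambda>q. f q $ i)"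
  by (rule smooth_fun_onI)
    (use smooth_on_component[OF open_chart_image smooth_in_chart] in \<open>simp add: in_chart_def comp_def\<close>)

lemma smooth_fun_on_const: "smooth_fun_on A W (\<lambda>q. a)"
  by (rule smooth_fun_onI) (simp add: in_chart_def comp_def smooth_on_const)

lemma vector_field_add:
  assumes "vector_field M A F W Y" "vector_field M A F W Z"
  shows "vector_field M A F W (\<lambda>q. Y q + Z q)"
  using vector_fieldD[OF assms(1)] vector_fieldD[OF assms(2)]
  by (intro vector_fieldI smooth_fun_on_add subspace_add[OF subspace_tangent_space]) auto

lemma vector_field_scaleR:
  assumes "vector_field M A F W Y" "smooth_fun_on A W f"
  shows "vector_field M A F W (\<lambda>q. f q *\<^sub>R Y q)"
  using vector_fieldD[OF assms(1)] assms(2)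
  by (intro vector_fieldI smooth_fun_on_scaleR subspace_scale[OF subspace_tangent_space]) auto

lemma vector_field_diff:
  assumes "vector_field M A F W Y" "vector_field M A F W Z"
  shows "vector_field M A F W (\<lambda>q. Y q - Z q)"
  using vector_field_add[OF assms(1) vector_field_scaleR[OF assms(2) smooth_fun_on_const[of _ "-1"]]] by simp

lemma vector_field_zero: "openin M W \<Longrightarrow> vector_field M A F W (\<lambda>q. 0)"
  using openin_subset subspace_0[OF subspace_tangent_space]
  by (intro vector_fieldI smooth_fun_on_const) auto

lemma vector_field_sum:
  assumes "openin M W" "\<And>i. i \<in> I \<Longrightarrow> vector_field M A F W (X i)"
  shows "vector_field M A F W (\<lambda>q. \<Sum>i\<in>I. X i q)"
  using assms
  by (induction I rule: infinite_finite_induct) (auto intro: vector_field_add vector_field_zero)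

lemma dir_deriv_linear_map:
  assumes L: "bounded_linear L" and Y: "openin M W" "p \<in> W" "smooth_fun_on A W Y"
    and v: "v \<in> tangent_space A F p"
  shows "dir_deriv A F p v (\<lambda>q. L (Y q)) = L (dir_deriv A F p v Y)"
proof -
  obtain c where c: "c \<in> A" "p \<in> fst c" using ex_chart openin_subset[OF Y(1)] Y(2) by blast
  obtain u where u: "v = D u (in_chart c F) (snd c p)"
    using v tangent_space_eq[OF c] by auto
  note d = differentiable_in_chart[OF Y(3) c Y(2)]
  have "in_chart c (\<lambda>q. L (Y q)) = (\<lambda>x. L (in_chart c Y x))"
    by (simp add: in_chart_def comp_def)
  then have h: "(in_chart c (\<lambda>q. L (Y q)) has_derivative (\<lambda>u. L (D u (in_chart c Y) (snd c p)))) (at (snd c p))"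
    using bounded_linear.has_derivative[OF L D_has_derivative[OF d]] by simp
  show ?thesis
    unfolding u dir_deriv_eq[OF c d] dir_deriv_eq[OF c differentiableI[OF h]] by (rule D_eq[OF h])
qed

lemma dir_deriv_diff:
  assumes Y: "openin M W" "p \<in> W" "smooth_fun_on A W Y" "smooth_fun_on A W Z"
    and v: "v \<in> tangent_space A F p"
  shows "dir_deriv A F p v (\<lambda>q. Y q - Z q) = dir_deriv A F p v Y - dir_deriv A F p v Z"
proof -
  obtain c where c: "c \<in> A" "p \<in> fst c" using ex_chart openin_subset[OF Y(1)] Y(2) by blast
  obtain u where u: "v = D u (in_chart c F) (snd c p)"
    using v tangent_space_eq[OF c] by auto
  note d = differentiable_in_chart[OF Y(3) c Y(2)] differentiable_in_chart[OF Y(4) c Y(2)]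
  have "in_chart c (\<lambda>q. Y q - Z q) = (\<lambda>x. in_chart c Y x - in_chart c Z x)"
    by (simp add: in_chart_def comp_def)
  then have h: "(in_chart c (\<lambda>q. Y q - Z q) has_derivative
      (\<lambda>u. D u (in_chart c Y) (snd c p) - D u (in_chart c Z) (snd c p))) (at (snd c p))"
    using has_derivative_diff[OF d[THEN D_has_derivative]] by simp
  show ?thesis
    unfolding u dir_deriv_eq[OF c d(1)] dir_deriv_eq[OF c d(2)] dir_deriv_eq[OF c differentiableI[OF h]]
    by (rule D_eq[OF h])
qed

lemma linear_tangential_part: "p \<in> topspace M \<Longrightarrow> linear (tangential_part A F \<xi> p)"
  using ex_chart[of p] by (auto intro!: linearI simp: tangential_part_eq inner_add_right algebra_simps)

lemma tangential_part_tangent: "p \<in> topspace M \<Longrightarrow> tangential_part A F \<xi> p z \<in> tangent_space A F p"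
  using constant_field_tangent unfolding constant_field_def .

lemma tangential_part_id: "p \<in> topspace M \<Longrightarrow> z \<in> tangent_space A F p \<Longrightarrow> tangential_part A F \<xi> p z = z"
  using constant_field_apply unfolding constant_field_def .

lemma affine_metric_commute:
  assumes p: "p \<in> topspace M" and vw: "v \<in> tangent_space A F p" "w \<in> tangent_space A F p"
  shows "affine_metric M A F \<xi> p v w = affine_metric M A F \<xi> p w v"
proof -
  obtain c where c: "c \<in> A" "p \<in> fst c" using ex_chart p by blast
  interpret equiaffine_chart "snd c ` fst c" "in_chart c F" "in_chart c \<xi>" "conormal c"
    by (rule equiaffine_chart_in_chart[OF c(1)])
  show ?thesis
    using vw c metric_commute affine_metric_in_chart[OF c] unfolding tangent_space_eq[OF c] by auto
qed

lemma affine_metric_linear: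
  assumes p: "p \<in> topspace M" and T: "u \<in> tangent_space A F p" "v \<in> tangent_space A F p" "w \<in> tangent_space A F p"
  shows "affine_metric M A F \<xi> p u (a *\<^sub>R v + b *\<^sub>R w)
      = a * affine_metric M A F \<xi> p u v + b * affine_metric M A F \<xi> p u w" (is ?right)
    and "affine_metric M A F \<xi> p (a *\<^sub>R v + b *\<^sub>R w) u
      = a * affine_metric M A F \<xi> p v u + b * affine_metric M A F \<xi> p w u"
proof -
  obtain c where c: "c \<in> A" "p \<in> fst c" using ex_chart p by blast
  obtain x where x: "u = D x (in_chart c F) (snd c p)"
    using T tangent_space_eq[OF c] by auto
  have av: "a *\<^sub>R v + b *\<^sub>R w \<in> tangent_space A F p"
    using T subspace_tangent_space[OF p] by (simp add: subspace_add subspace_scale)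
  show ?right
    using affine_metric_eq[OF c] T av unfolding x by (simp add: inner_add_right algebra_simps)
  then show "affine_metric M A F \<xi> p (a *\<^sub>R v + b *\<^sub>R w) u
      = a * affine_metric M A F \<xi> p v u + b * affine_metric M A F \<xi> p w u"
    using affine_metric_commute[OF p] T av by simp
qed

lemma affine_metric_diff:
  assumes p: "p \<in> topspace M" and T: "u \<in> tangent_space A F p" "v \<in> tangent_space A F p" "w \<in> tangent_space A F p"
  shows "affine_metric M A F \<xi> p u (v - w) = affine_metric M A F \<xi> p u v - affine_metric M A F \<xi> p u w"
    and "affine_metric M A F \<xi> p (v - w) u = affine_metric M A F \<xi> p v u - affine_metric M A F \<xi> p w u"
  using affine_metric_linear[OF assms, of 1 "-1"] by simp_all

end

section \<open>The difference tensor\<close>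

locale blaschke_levi_civita = blaschke_hypersurface +
  fixes N :: "'a \<Rightarrow> real^4 \<Rightarrow> ('a \<Rightarrow> real^4) \<Rightarrow> real^4"
  assumes levi_civita: "levi_civita_connection M A F (affine_metric M A F \<xi>) N"
begin

lemma
  assumes Y: "vector_field M A F W Y" and p: "p \<in> W" and v: "v \<in> tangent_space A F p"
  shows connection_tangent: "N p v Y \<in> tangent_space A F p"
    and connection_add: "vector_field M A F W Z \<Longrightarrow> N p v (\<lambda>q. Y q + Z q) = N p v Y + N p v Z"
    and connection_scaleR: "smooth_fun_on A W f \<Longrightarrow>
      N p v (\<lambda>q. f q *\<^sub>R Y q) = dir_deriv A F p v f *\<^sub>R Y p + f p *\<^sub>R N p v Y"
    and connection_metric: "vector_field M A F W Z \<Longrightarrow>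
      dir_deriv A F p v (\<lambda>q. affine_metric M A F \<xi> q (Y q) (Z q))
        = affine_metric M A F \<xi> p (N p v Y) (Z p) + affine_metric M A F \<xi> p (Y p) (N p v Z)"
proof -
  note lc = levi_civita[unfolded levi_civita_connection_def]
  note ac = lc[THEN conjunct1, unfolded affine_connection_def, THEN spec, THEN spec, THEN mp, OF Y,
      THEN conjunct2, THEN bspec, OF p, THEN bspec, OF v]
  show "N p v Y \<in> tangent_space A F p"
    using ac by (rule conjunct1)
  show "N p v (\<lambda>q. Y q + Z q) = N p v Y + N p v Z" if "vector_field M A F W Z"
    using ac that by blast
  show "N p v (\<lambda>q. f q *\<^sub>R Y q) = dir_deriv A F p v f *\<^sub>R Y p + f p *\<^sub>R N p v Y"
    if "smooth_fun_on A W f"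
    by (rule ac[THEN conjunct2, THEN conjunct2, THEN conjunct2, THEN spec, THEN mp, OF that])
  show "dir_deriv A F p v (\<lambda>q. affine_metric M A F \<xi> q (Y q) (Z q))
      = affine_metric M A F \<xi> p (N p v Y) (Z p) + affine_metric M A F \<xi> p (Y p) (N p v Z)"
    if "vector_field M A F W Z"
    using lc[THEN conjunct2, THEN conjunct2, THEN spec, THEN spec, THEN spec, THEN mp, OF conjI, OF Y that]
      p v by blast
qed

lemma connection_torsion:
  assumes "vector_field M A F W X" "vector_field M A F W Y" "p \<in> W"
  shows "N p (X p) Y - N p (Y p) X = lie_bracket A F X Y p"
  using levi_civita assms unfolding levi_civita_connection_def by blast

text \<open>A field vanishing on \<open>V\<close> is its own product with the function that is \<open>0\<close> on \<open>V\<close> and \<open>1\<close>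
  elsewhere, which is smooth on \<open>V\<close>.\<close>

lemma connection_vanishing:
  assumes "vector_field M A F V Z" "p \<in> V" "v \<in> tangent_space A F p" "\<And>q. q \<in> V \<Longrightarrow> Z q = 0"
  shows "N p v Z = 0"
proof -
  let ?f = "\<lambda>q. if q \<in> V then 0 else 1 :: real"
  have "smooth_fun_on A V ?f"
    by (rule smooth_fun_on_cong[OF _ _ smooth_fun_on_const[of V 0]])
      (use vector_fieldD[OF assms(1)] in auto)
  then have "N p v (\<lambda>q. ?f q *\<^sub>R Z q) = 0"
    using connection_scaleR[OF assms(1-3)] assms(2,4) by simp
  moreover have "(\<lambda>q. ?f q *\<^sub>R Z q) = Z"
    using assms(4) by auto
  ultimately show ?thesis by simp
qed

lemma connection_diff:
  assumes "vector_field M A F W Y" "vector_field M A F W Z" "p \<in> W" "v \<in> tangent_space A F p"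
  shows "N p v (\<lambda>q. Y q - Z q) = N p v Y - N p v Z"
  using connection_add[OF assms(2-4) vector_field_diff[OF assms(1,2)]] by simp

text \<open>Vector fields are total functions with arbitrary values off \<open>W\<close>; this is
  the locality that makes those values irrelevant to \<open>N\<close>.\<close>

lemma connection_cong:
  assumes "vector_field M A F W Y" "vector_field M A F W Z" "p \<in> W" "v \<in> tangent_space A F p"
    "\<And>q. q \<in> W \<Longrightarrow> Y q = Z q"
  shows "N p v Y = N p v Z"
  using connection_vanishing[OF vector_field_diff[OF assms(1,2)] assms(3,4)] connection_diff[OF assms(1-4)]
    assms(5) by simp

lemma connection_sum:
  assumes "openin M W" "p \<in> W" "v \<in> tangent_space A F p" "finite I" "\<And>i. i \<in> I \<Longrightarrow> vector_field M A F W (X i)"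
  shows "N p v (\<lambda>q. \<Sum>i\<in>I. X i q) = (\<Sum>i\<in>I. N p v (X i))"
  using assms(4,5)
proof (induction I rule: finite_induct)
  case empty
  then show ?case using connection_vanishing[OF vector_field_zero[OF assms(1)] assms(2,3)] by simp
next
  case (insert i I)
  then show ?case
    using connection_add[OF _ assms(2,3) vector_field_sum[OF assms(1)], of "X i" I X] by simp
qed

text \<open>Write \<open>Z\<close> as a sum of its components times the tangential parts of the
  constant basis fields. The components vanish at \<open>p\<close>, so the Leibniz rule keeps only
  their derivatives, an expression in which \<open>N\<close> no longer occurs.\<close>

lemma connection_at_zero:
  assumes Z: "vector_field M A F W Z" and p: "p \<in> W" and v: "v \<in> tangent_space A F p" and 0: "Z p = 0"
  shows "N p v Z = induced_connection A F \<xi> p v Z"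
proof -
  note W = vector_fieldD[OF Z]
  have top: "p \<in> topspace M" using W p by blast
  let ?E = "\<lambda>k. constant_field (axis k 1)"
  have E: "vector_field M A F W (?E k)" for k
    by (rule vector_field_subset[OF vector_field_constant_field W(1,4)])
  have s: "smooth_fun_on A W (\<lambda>q. Z q $ k)" for k
    by (rule smooth_fun_on_component[OF W(1,2)])
  have rep: "z = (\<Sum>k\<in>UNIV. z $ k *\<^sub>R axis k 1)" for z :: "real^4"
    by (simp add: vec_eq_iff axis_def if_distrib[of "(*) _"] cong: if_cong)
  have lin: "tangential_part A F \<xi> q z = (\<Sum>k\<in>UNIV. z $ k *\<^sub>R ?E k q)" if "q \<in> topspace M" for q z
    using arg_cong[OF rep[of z], of "tangential_part A F \<xi> q"]
    by (simp add: constant_field_def linear_sum[OF linear_tangential_part[OF that]]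
        linear_cmul[OF linear_tangential_part[OF that]])
  have eq: "Z q = (\<Sum>k\<in>UNIV. Z q $ k *\<^sub>R ?E k q)" if "q \<in> W" for q
    using lin[of q "Z q"] tangential_part_id W(3,4) that by auto
  have "N p v Z = N p v (\<lambda>q. \<Sum>k\<in>UNIV. Z q $ k *\<^sub>R ?E k q)"
    by (rule connection_cong[OF Z _ p v eq])
      (intro vector_field_sum vector_field_scaleR E s W)
  also have "\<dots> = (\<Sum>k\<in>UNIV. N p v (\<lambda>q. Z q $ k *\<^sub>R ?E k q))"
    by (rule connection_sum[OF W(1) p v]) (auto intro: vector_field_scaleR E s)
  also have "\<dots> = (\<Sum>k\<in>UNIV. dir_deriv A F p v Z $ k *\<^sub>R ?E k p)"
    using connection_scaleR[OF E p v s] 0 dir_deriv_linear_map[OF bounded_linear_vec_nth W(1) p W(2) v]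
    by simp
  also have "\<dots> = tangential_part A F \<xi> p (dir_deriv A F p v Z)"
    using lin[OF top] by simp
  finally show ?thesis unfolding induced_connection_def .
qed

abbreviation K :: "'a \<Rightarrow> real^4 \<Rightarrow> real^4 \<Rightarrow> real^4" where
  "K \<equiv> difference_tensor M A F \<xi> N"

lemma induced_connection_diff:
  assumes "vector_field M A F W Y" "vector_field M A F W Z" "p \<in> W" "v \<in> tangent_space A F p"
  shows "induced_connection A F \<xi> p v (\<lambda>q. Y q - Z q)
    = induced_connection A F \<xi> p v Y - induced_connection A F \<xi> p v Z"
  unfolding induced_connection_def
  using dir_deriv_diff[of W p Y Z v] linear_diff[OF linear_tangential_part] assms
    vector_fieldD[OF assms(1)] vector_fieldD[OF assms(2)] by auto

text \<open>Two extensions of the same vector differ by a field that vanishes at \<open>p\<close>,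
  on which both connections agree by \<open>connection_at_zero\<close>.\<close>

lemma difference_tensor_eq:
  assumes Y: "vector_field M A F W Y" and p: "p \<in> W" and v: "v \<in> tangent_space A F p"
  shows "K p v (Y p) = induced_connection A F \<xi> p v Y - N p v Y"
  unfolding difference_tensor_def
proof (rule the_equality)
  fix k assume "\<exists>V Z. p \<in> V \<and> vector_field M A F V Z \<and> Z p = Y p
      \<and> k = induced_connection A F \<xi> p v Z - N p v Z"
  then obtain V Z where Z: "p \<in> V" "vector_field M A F V Z" "Z p = Y p"
    and k: "k = induced_connection A F \<xi> p v Z - N p v Z" by blast
  have I: "openin M (V \<inter> W)" "p \<in> V \<inter> W"
    using vector_fieldD[OF Y] vector_fieldD[OF Z(2)] p Z by auto
  have f: "vector_field M A F (V \<inter> W) Z" "vector_field M A F (V \<inter> W) Y"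
    using vector_field_subset I(1) Y Z by (metis inf_le1, metis inf_le2)
  have "N p v (\<lambda>q. Z q - Y q) = induced_connection A F \<xi> p v (\<lambda>q. Z q - Y q)"
    using connection_at_zero[OF vector_field_diff[OF f] I(2) v] Z by simp
  then show "k = induced_connection A F \<xi> p v Y - N p v Y"
    unfolding k connection_diff[OF f I(2) v] induced_connection_diff[OF f I(2) v] by (simp add: algebra_simps)
qed (use assms in blast)

lemma difference_tensor_constant_field:
  assumes "p \<in> topspace M" "v \<in> tangent_space A F p" "w \<in> tangent_space A F p"
  shows "K p v w = induced_connection A F \<xi> p v (constant_field w) - N p v (constant_field w)"
  using difference_tensor_eq[OF vector_field_constant_field assms(1,2), of w]
    constant_field_apply[OF assms(1,3)] by simp

lemma difference_tensor_tangent: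
  assumes "p \<in> topspace M" "v \<in> tangent_space A F p" "w \<in> tangent_space A F p"
  shows "K p v w \<in> tangent_space A F p"
  unfolding difference_tensor_constant_field[OF assms]
  using connection_tangent[OF vector_field_constant_field assms(1,2)] tangential_part_tangent[OF assms(1)]
    subspace_diff[OF subspace_tangent_space[OF assms(1)]]
  by (simp add: induced_connection_def)

text \<open>Both connections are torsion free. The bracket is tangent because \<open>N\<close>
  expresses it as a difference of tangent vectors, so taking tangential parts does not change
  it.\<close>

lemma difference_tensor_commute:
  assumes "p \<in> topspace M" "v \<in> tangent_space A F p" "w \<in> tangent_space A F p"
  shows "K p v w = K p w v"
proof -
  note t = connection_tangent[OF vector_field_constant_field assms(1)]
  have "lie_bracket A F (constant_field v) (constant_field w) p
      = N p v (constant_field w) - N p w (constant_field v)" (is "_ = ?t")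
    using connection_torsion[OF vector_field_constant_field vector_field_constant_field assms(1), of v w]
      constant_field_apply[OF assms(1)] assms by simp
  then have eq: "dir_deriv A F p v (constant_field w) - dir_deriv A F p w (constant_field v) = ?t"
    using constant_field_apply[OF assms(1)] assms by (simp add: lie_bracket_def)
  have "tangential_part A F \<xi> p ?t = ?t"
    by (rule tangential_part_id[OF assms(1)])
      (use t assms subspace_diff[OF subspace_tangent_space[OF assms(1)]] in blast)
  then have "induced_connection A F \<xi> p v (constant_field w) - induced_connection A F \<xi> p w (constant_field v) = ?t"
    unfolding induced_connection_def linear_diff[OF linear_tangential_part[OF assms(1)], symmetric] eq .
  then show ?thesis
    unfolding difference_tensor_constant_field[OF assms] difference_tensor_constant_field[OF assms(1,3,2)]
    by (simp add: algebra_simps)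
qed

lemma smooth_coordinates:
  assumes c: "c \<in> A" and Y: "smooth_on (snd c ` fst c) Y"
  shows "smooth_on (snd c ` fst c) (\<lambda>x. coordinates c x (Y x))"
proof -
  have "smooth_on (snd c ` fst c) (\<lambda>x. (if i = 1 then dual c 1 x else if i = 2 then dual c 2 x else dual c 3 x) \<bullet> Y x)"
    for i :: 3
    by (cases "i = 1"; cases "i = 2")
      (simp_all, (rule smooth_on_inner[OF open_chart[OF c] smooth_dual[OF c] Y])+)
  then show ?thesis
    unfolding coordinates_def by (rule smooth_on_vec[OF open_chart[OF c]])
qed

text \<open>The cubic form is the derivative of \<open>h\<close> with respect to the induced
  connection; since the Levi-Civita connection annihilates \<open>h\<close>, only the action of the
  difference tensor on both arguments remains.\<close>

lemma cubic_eq_difference_tensor: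
  fixes u v w :: "real^3"
  assumes c: "c \<in> A" "p \<in> fst c"
  defines "T \<equiv> \<lambda>u. D u (in_chart c F) (snd c p)"
  shows "equiaffine_chart.cubic (in_chart c F) (conormal c) (snd c p) u v w
    = - affine_metric M A F \<xi> p (K p (T u) (T v)) (T w) - affine_metric M A F \<xi> p (T v) (K p (T u) (T w))"
proof -
  let ?S = "snd c ` fst c" and ?h = "affine_metric M A F \<xi> p"
  define x where "x = snd c p"
  interpret equiaffine_chart ?S "in_chart c F" "in_chart c \<xi>" "conormal c"
    by (rule equiaffine_chart_in_chart[OF c(1)])
  have x: "x \<in> ?S" using c x_def by auto
  have top: "p \<in> topspace M" using chart_subset[OF c(1)] c by blast
  have T: "T u \<in> tangent_space A F p" for u
    using tangent_space_eq[OF c] by (auto simp: T_def)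
  have TD: "T u = D u (in_chart c F) x" for u by (simp add: T_def x_def)
  let ?Y = "constant_field (T v)" and ?Z = "constant_field (T w)"
  define Y Z where "Y = in_chart c ?Y" and "Z = in_chart c ?Z"
  note vf = vector_field_constant_field
  have sm: "smooth_on ?S (in_chart c (constant_field z))" for z
    using smooth_in_chart_topspace[OF vector_fieldD(2)[OF vf] c(1)] .
  \<comment> \<open>The extension is not a coordinate field: its chart components \<open>y\<close>
    vary, with value \<open>v\<close> at \<open>x\<close>.\<close>
  define y where "y = (\<lambda>x. coordinates c x (Y x))"
  have y: "smooth_on ?S y"
    unfolding y_def Y_def by (rule smooth_coordinates[OF c(1) sm])
  have dy: "y differentiable (at x)" and dZ: "Z differentiable (at x)"
    using smooth_on_differentiable[OF _ x] y sm unfolding Z_def by auto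
  have YD: "Y z = D (y z) (in_chart c F) z" if z: "z \<in> ?S" for z
  proof -
    obtain q where q: "q \<in> fst c" "z = snd c q" using z by blast
    have "conormal c z \<bullet> Y z = 0"
      using tangent_space_conormal[OF c(1) q(1)] constant_field_tangent[of q] chart_subset[OF c(1)] q
        in_chart_apply[OF c(1) q(1), of ?Y] unfolding Y_def by auto
    then show ?thesis
      using coordinate_expansion[OF c(1) q(1), of "Y z"] q unfolding y_def by simp
  qed
  have Yp: "Y x = T v" "Z x = T w"
    by (simp_all add: Y_def Z_def x_def in_chart_apply[OF c] constant_field_apply[OF top T])
  have yx: "y x = v"
    using YD[OF x] Yp(1) inj_D[OF x] unfolding TD by (auto dest: injD)
  let ?N = "\<lambda>z. D (y z) (conormal c) z"
  have h: "affine_metric M A F \<xi> q (?Y q) (?Z q) = - (?N (snd c q) \<bullet> Z (snd c q))" if "q \<in> fst c" for q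
    using affine_metric_eq[OF c(1) that, of "?Z q" "y (snd c q)"] YD[of "snd c q"] that
      in_chart_apply[OF c(1) that, of ?Y] in_chart_apply[OF c(1) that, of ?Z]
      constant_field_tangent[of q] chart_subset[OF c(1)]
    unfolding Y_def Z_def by auto
  have dN: "?N differentiable (at x)"
    by (rule differentiable_D_along[OF open_S x smooth(3) dy])
  have "((\<lambda>z. - (?N z \<bullet> Z z)) has_derivative
      (\<lambda>u. - (?N x \<bullet> D u Z x + D u ?N x \<bullet> Z x))) (at x)"
    by (intro has_derivative_minus has_derivative_inner D_has_derivative dN dZ)
  then have hd: "(in_chart c (\<lambda>q. affine_metric M A F \<xi> q (?Y q) (?Z q)) has_derivative
      (\<lambda>u. - (?N x \<bullet> D u Z x + D u ?N x \<bullet> Z x))) (at x)"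
    by (rule has_derivative_transform_within_open[OF _ open_S x])
      (auto simp: in_chart_apply[OF c(1)] h)
  have Tu: "T u = D u (in_chart c F) (snd c p)" by (simp add: T_def)
  have "dir_deriv A F p (T u) (\<lambda>q. affine_metric M A F \<xi> q (?Y q) (?Z q))
      = D u (in_chart c (\<lambda>q. affine_metric M A F \<xi> q (?Y q) (?Z q))) x"
    unfolding Tu x_def by (rule dir_deriv_eq[OF c differentiableI[OF hd[unfolded x_def]]])
  also have "\<dots> = - (?N x \<bullet> D u Z x + D u ?N x \<bullet> Z x)"
    by (rule D_eq[OF hd])
  finally have compat: "?h (N p (T u) ?Y) (T w) + ?h (T v) (N p (T u) ?Z)
      = - (D v (conormal c) x \<bullet> D u Z x) - (D (D u y x) (conormal c) x + D u (D v (conormal c)) x) \<bullet> T w"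
    using connection_metric[OF vf top T vf, of u "T v" "T w"] constant_field_apply[OF top T]
      D_D_along[OF open_S x smooth(3) dy, of u] Yp yx by simp
  have dd: "dir_deriv A F p (T u) ?Y = D u Y x" "dir_deriv A F p (T u) ?Z = D u Z x"
    unfolding Tu Y_def Z_def x_def
    by (intro dir_deriv_eq[OF c] differentiable_in_chart[OF vector_fieldD(2)[OF vf] c top])+
  have "conormal c x \<bullet> (D u (D v (in_chart c F)) x - metric x u v *\<^sub>R \<xi> p) = 0"
    using conormal_\<xi>[OF c] unfolding metric_def x_def by (simp add: inner_diff_right)
  then obtain g where "D u (D v (in_chart c F)) x - metric x u v *\<^sub>R \<xi> p = D g (in_chart c F) x"
    using tangent_if[OF x] by blast
  then have g: "D u (D v (in_chart c F)) x = T g + metric x u v *\<^sub>R \<xi> p"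
    unfolding TD by (simp add: algebra_simps)
  have "D u Y x = D u (\<lambda>z. D (y z) (in_chart c F) z) x"
    by (rule D_cong[OF open_S x YD])
  also have "\<dots> = T (D u y x + g) + metric x u v *\<^sub>R \<xi> p"
    using D_D_along[OF open_S x smooth(1) dy, of u] yx g
      D_add[OF smooth_on_differentiable[OF smooth(1) x], of "D u y x" g] unfolding TD by simp
  finally have iY: "induced_connection A F \<xi> p (T u) ?Y = T (D u y x + g)"
    unfolding induced_connection_def dd tangential_part_eq[OF c]
    using conormal_immersion[OF c] conormal_\<xi>[OF c] by (simp add: T_def inner_add_right)
  \<comment> \<open>The term with \<open>D u y x\<close> also occurs in \<open>compat\<close>, so
    the dependence on the chosen extension cancels at the end.\<close>
  have hY: "?h (induced_connection A F \<xi> p (T u) ?Y) (T w)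
      = - (D (D u y x) (conormal c) x \<bullet> T w) - D g (conormal c) x \<bullet> T w"
    unfolding iY using affine_metric_eq[OF c T]
      D_add[OF smooth_on_differentiable[OF smooth(3) x], of "D u y x" g]
    by (simp add: T_def x_def inner_add_left)
  have "?h (T v) (induced_connection A F \<xi> p (T u) ?Z) = - (D v (conormal c) x \<bullet> induced_connection A F \<xi> p (T u) ?Z)"
    using affine_metric_eq[OF c, of "induced_connection A F \<xi> p (T u) ?Z" v] tangential_part_tangent[OF top]
    by (simp add: T_def x_def induced_connection_def)
  then have hZ: "?h (T v) (induced_connection A F \<xi> p (T u) ?Z) = - (D v (conormal c) x \<bullet> D u Z x)"
    unfolding induced_connection_def dd tangential_part_eq[OF c]
    using D_conormal_normal[OF x, of v] in_chart_apply[OF c, of \<xi>] by (simp add: inner_diff_right x_def)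
  have it: "induced_connection A F \<xi> p (T u) X \<in> tangent_space A F p" for X
    unfolding induced_connection_def by (rule tangential_part_tangent[OF top])
  have nt: "N p (T u) (constant_field z) \<in> tangent_space A F p" for z
    by (rule connection_tangent[OF vf top T])
  have K: "?h (K p (T u) (T v)) (T w) = ?h (induced_connection A F \<xi> p (T u) ?Y) (T w) - ?h (N p (T u) ?Y) (T w)"
    "?h (T v) (K p (T u) (T w)) = ?h (T v) (induced_connection A F \<xi> p (T u) ?Z) - ?h (T v) (N p (T u) ?Z)"
    unfolding difference_tensor_constant_field[OF top T T]
    by (intro affine_metric_diff[OF top T it nt])+
  have "D u (D v (conormal c)) x \<bullet> T w = D w (conormal c) x \<bullet> D u (D v (in_chart c F)) x - cubic x u v w"
    unfolding TD by (rule D2_conormal_tangent[OF x])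
  moreover have "D w (conormal c) x \<bullet> D u (D v (in_chart c F)) x = D g (conormal c) x \<bullet> T w"
    unfolding g using D_conormal_normal[OF x, of w] in_chart_apply[OF c, of \<xi>]
      D_conormal_tangent[OF x] metric_commute[OF x] unfolding TD by (simp add: inner_add_right x_def)
  ultimately show ?thesis
    using K hY hZ compat unfolding x_def[symmetric] by (simp add: inner_add_left algebra_simps)
qed

end

section \<open>Pointwise symmetry\<close>

text \<open>The matrix is P R(r) E with only R(r) depending on r, and det R(r) = r^2 agrees at r =
  -1 and r = 1. It shows that a half turn preserves orientation.\<close>

lemma det_half_turn:
  fixes e1 e2 e3 n :: "real^4" and a b c :: "nat \<Rightarrow> real"
  defines "u \<equiv> \<lambda>r i. (r * a i) *\<^sub>R e1 + (r * b i) *\<^sub>R e2 + c i *\<^sub>R e3"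
  shows "det (vector [u (-1) 1, u (-1) 2, u (-1) 3, n] :: real^4^4) = det (vector [u 1 1, u 1 2, u 1 3, n] :: real^4^4)"
proof -
  define P where "P = (vector [vector [a 1, b 1, c 1, 0], vector [a 2, b 2, c 2, 0],
    vector [a 3, b 3, c 3, 0], vector [0, 0, 0, 1]] :: real^4^4)"
  define R where "R = (\<lambda>r. vector [vector [r, 0, 0, 0], vector [0, r, 0, 0],
    vector [0, 0, 1, 0], vector [0, 0, 0, 1]] :: real^4^4)"
  have "vector [u r 1, u r 2, u r 3, n] = P ** R r ** vector [e1, e2, e3, n]" for r
    unfolding u_def P_def R_def
    by (simp add: vec_eq_iff forall_4 matrix_matrix_mult_def sum_4 vector_4 algebra_simps del: One_nat_def)
  moreover have "det (R r) = r * r" for r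
  proof -
    have "\<forall>i j. i \<noteq> j \<longrightarrow> R r $ i $ j = 0"
      unfolding forall_4 R_def vector_4 by simp
    then have "det (R r) = prod (\<lambda>i. R r $ i $ i) UNIV"
      by (intro det_diagonal) blast
    also have "\<dots> = R r $ 1 $ 1 * R r $ 2 $ 2 * R r $ 3 $ 3 * R r $ 4 $ 4"
      unfolding UNIV_4 by (simp add: ac_simps)
    finally show ?thesis unfolding R_def vector_4 by simp
  qed
  ultimately show ?thesis by (simp add: det_mul)
qed

locale positive_blaschke = blaschke_levi_civita +
  assumes positive: "positive_definite M A F \<xi>"
begin

abbreviation T where "T \<equiv> tangent_space A F"
abbreviation h where "h \<equiv> affine_metric M A F \<xi>"
abbreviation S where "S \<equiv> shape_operator A F \<xi>"

lemma metric_pos: "p \<in> topspace M \<Longrightarrow> v \<in> T p \<Longrightarrow> v \<noteq> 0 \<Longrightarrow> 0 < h p v v"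
  using positive unfolding positive_definite_def by blast

lemma tangent_comb:
  assumes "p \<in> topspace M" "u \<in> T p" "v \<in> T p"
  shows "a *\<^sub>R u + b *\<^sub>R v \<in> T p" "a *\<^sub>R u \<in> T p" "u + v \<in> T p" "u - v \<in> T p" "- u \<in> T p"
  using assms subspace_tangent_space[OF assms(1)]
  by (simp_all add: subspace_add subspace_scale subspace_diff subspace_neg)

lemma metric_scale:
  assumes "p \<in> topspace M" "u \<in> T p" "v \<in> T p"
  shows "h p u (a *\<^sub>R v) = a * h p u v" "h p (a *\<^sub>R v) u = a * h p v u"
    "h p u (- v) = - h p u v" "h p (- v) u = - h p v u"
  using affine_metric_linear[OF assms assms(3), of a 0] affine_metric_linear[OF assms assms(3), of "-1" 0]
  by simp_all

section \<open>Orthonormal bases, the invariant cubic form and the shape operator\<close>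

definition onb :: "'a \<Rightarrow> real^4 \<Rightarrow> real^4 \<Rightarrow> real^4 \<Rightarrow> bool" where
  "onb p e1 e2 e3 \<longleftrightarrow> p \<in> topspace M \<and> e1 \<in> T p \<and> e2 \<in> T p \<and> e3 \<in> T p \<and>
     h p e1 e1 = 1 \<and> h p e2 e2 = 1 \<and> h p e3 e3 = 1 \<and> h p e1 e2 = 0 \<and> h p e2 e1 = 0 \<and>
     h p e1 e3 = 0 \<and> h p e3 e1 = 0 \<and> h p e2 e3 = 0 \<and> h p e3 e2 = 0"

lemma onb_if_orthonormal_frame:
  assumes "p \<in> topspace M" "orthonormal_frame (T p) (h p) e1 e2 e3"
  shows "onb p e1 e2 e3"
proof -
  have "h p e e = 1" if "\<bar>h p e e\<bar> = 1" "e \<in> T p" for e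
  proof -
    have "e \<noteq> 0"
      using that metric_scale(1)[OF assms(1) that(2,2), of 0] by auto
    then show ?thesis using metric_pos[OF assms(1) that(2)] that(1) by simp
  qed
  then show ?thesis
    using assms unfolding orthonormal_frame_def onb_def by simp
qed

lemma metric_comb3:
  assumes p: "p \<in> topspace M" and t: "u \<in> T p" "v \<in> T p" "w \<in> T p" "z \<in> T p"
  shows "h p (a *\<^sub>R u + b *\<^sub>R v + c *\<^sub>R w) z = a * h p u z + b * h p v z + c * h p w z"
    and "a *\<^sub>R u + b *\<^sub>R v + c *\<^sub>R w \<in> T p"
proof -
  have uv: "a *\<^sub>R u + b *\<^sub>R v \<in> T p" using tangent_comb(1)[OF p t(1,2)] .
  show "h p (a *\<^sub>R u + b *\<^sub>R v + c *\<^sub>R w) z = a * h p u z + b * h p v z + c * h p w z"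
    using affine_metric_linear(2)[OF p t(4) uv t(3), of 1 c] affine_metric_linear(2)[OF p t(4,1,2)] by simp
  show "a *\<^sub>R u + b *\<^sub>R v + c *\<^sub>R w \<in> T p"
    using tangent_comb(1)[OF p uv t(3), of 1 c] by simp
qed

lemma metric_of_comb:
  assumes "onb p e1 e2 e3"
  shows "h p (a *\<^sub>R e1 + b *\<^sub>R e2 + c *\<^sub>R e3) e1 = a" "h p (a *\<^sub>R e1 + b *\<^sub>R e2 + c *\<^sub>R e3) e2 = b"
    "h p (a *\<^sub>R e1 + b *\<^sub>R e2 + c *\<^sub>R e3) e3 = c" "a *\<^sub>R e1 + b *\<^sub>R e2 + c *\<^sub>R e3 \<in> T p"
  using assms metric_comb3[of p e1 e2 e3] unfolding onb_def by auto

text \<open>Pairing with the basis recovers coefficients, so the combination map from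
  \<open>real^3\<close> is injective; its image has dimension three and therefore fills
  \<open>T p\<close>.\<close>

lemma onb_expansion:
  assumes o: "onb p e1 e2 e3" and v: "v \<in> T p"
  shows "v = h p v e1 *\<^sub>R e1 + h p v e2 *\<^sub>R e2 + h p v e3 *\<^sub>R e3"
proof -
  note e = o[unfolded onb_def]
  have top: "p \<in> topspace M" using e by blast
  let ?L = "\<lambda>w :: real^3. w $ 1 *\<^sub>R e1 + w $ 2 *\<^sub>R e2 + w $ 3 *\<^sub>R e3"
  have L: "?L w \<in> T p" for w
    by (rule metric_of_comb[OF o])
  have hL: "h p (?L w) e1 = w $ 1" "h p (?L w) e2 = w $ 2" "h p (?L w) e3 = w $ 3" for w
    by (rule metric_of_comb[OF o])+
  have lin: "linear ?L"
    by (auto intro!: linearI simp: algebra_simps)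
  have inj: "inj ?L"
  proof (rule injI)
    fix x y assume eq: "?L x = ?L y"
    have "x $ 1 = y $ 1" "x $ 2 = y $ 2" "x $ 3 = y $ 3"
      using arg_cong[OF eq, of "\<lambda>z. h p z e1"] arg_cong[OF eq, of "\<lambda>z. h p z e2"]
        arg_cong[OF eq, of "\<lambda>z. h p z e3"] unfolding hL by blast+
    then show "x = y" by (simp add: vec_eq_iff forall_3)
  qed
  have "dim (range ?L) = 3"
    using dim_image_eq[OF lin, of UNIV] inj by simp
  then have "range ?L = T p"
    using L dim_tangent_space[OF top] subspace_tangent_space[OF top] linear_subspace_image[OF lin subspace_UNIV]
    by (intro subspace_dim_equal) auto
  then obtain w where "v = ?L w" using v by blast
  then show ?thesis using hL[of w] by simp
qed

text \<open>The cubic form without a chart. Written through \<open>K\<close>, its invariance under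
  \<open>symmetry_group\<close> is immediate, whereas its symmetry is taken from
  \<open>cubic\<close> through \<open>Q_in_chart\<close>.\<close>

definition Q :: "'a \<Rightarrow> real^4 \<Rightarrow> real^4 \<Rightarrow> real^4 \<Rightarrow> real" where
  "Q p u v w = - h p (K p u v) w - h p v (K p u w)"

lemma Q_in_chart:
  assumes "c \<in> A" "p \<in> fst c"
  shows "Q p (D u (in_chart c F) (snd c p)) (D v (in_chart c F) (snd c p)) (D w (in_chart c F) (snd c p))
    = equiaffine_chart.cubic (in_chart c F) (conormal c) (snd c p) u v w"
  unfolding Q_def cubic_eq_difference_tensor[OF assms] ..

lemma
  assumes p: "p \<in> topspace M" and t: "u \<in> T p" "v \<in> T p" "w \<in> T p"
  shows Q_commute12: "Q p u v w = Q p v u w" and Q_commute23: "Q p u v w = Q p u w v"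
    and Q_linear: "z \<in> T p \<Longrightarrow> Q p (a *\<^sub>R u + b *\<^sub>R z) v w = a * Q p u v w + b * Q p z v w"
proof -
  obtain c where c: "c \<in> A" "p \<in> fst c" using ex_chart p by blast
  interpret equiaffine_chart "snd c ` fst c" "in_chart c F" "in_chart c \<xi>" "conormal c"
    by (rule equiaffine_chart_in_chart[OF c(1)])
  have x': "snd c p \<in> snd c ` fst c" using c by blast
  let ?T = "\<lambda>u. D u (in_chart c F) (snd c p)"
  have ex: "\<exists>x. u = ?T x" if "u \<in> T p" for u
    using that tangent_space_eq[OF c] by auto
  obtain x y z where xyz: "u = ?T x" "v = ?T y" "w = ?T z" using ex t by metis
  show "Q p u v w = Q p v u w" "Q p u v w = Q p u w v"
    unfolding xyz Q_in_chart[OF c] using cubic_commute12[OF x'] cubic_commute23[OF x'] by blast+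
  show "Q p (a *\<^sub>R u + b *\<^sub>R z) v w = a * Q p u v w + b * Q p z v w" if z: "z \<in> T p" for z
  proof -
    obtain s where s: "z = ?T s" using ex[OF z] by blast
    have "a *\<^sub>R u + b *\<^sub>R z = ?T (a *\<^sub>R x + b *\<^sub>R s)"
      unfolding xyz s using differentiable_immersion[OF c] by (simp add: D_add D_scale)
    then show ?thesis
      unfolding xyz s
      by (simp add: Q_in_chart[OF c] linear_add[OF linear_cubic[OF x']] linear_cmul[OF linear_cubic[OF x']])
  qed
qed

lemma shape_operator_in_chart:
  assumes "c \<in> A" "p \<in> fst c"
  shows "S p (D u (in_chart c F) (snd c p)) = - D u (in_chart c \<xi>) (snd c p)"
proof -
  have "p \<in> topspace M" using chart_subset assms by blast
  then show ?thesis
    unfolding shape_operator_def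
    using dir_deriv_eq[OF assms differentiable_in_chart[OF smooth_normal assms]] by simp
qed

lemma
  assumes p: "p \<in> topspace M" and t: "u \<in> T p" "v \<in> T p"
  shows shape_operator_tangent: "S p u \<in> T p"
    and shape_operator_linear: "S p (a *\<^sub>R u + b *\<^sub>R v) = a *\<^sub>R S p u + b *\<^sub>R S p v"
proof -
  show "S p u \<in> T p"
    unfolding shape_operator_def
    by (intro subspace_neg[OF subspace_tangent_space[OF p]] D_normal_tangent p t)
  obtain c where c: "c \<in> A" "p \<in> fst c" using ex_chart p by blast
  obtain x y where xy: "u = D x (in_chart c F) (snd c p)" "v = D y (in_chart c F) (snd c p)"
    using t tangent_space_eq[OF c] by auto
  have "a *\<^sub>R u + b *\<^sub>R v = D (a *\<^sub>R x + b *\<^sub>R y) (in_chart c F) (snd c p)"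
    unfolding xy using differentiable_immersion[OF c] by (simp add: D_add D_scale)
  then show "S p (a *\<^sub>R u + b *\<^sub>R v) = a *\<^sub>R S p u + b *\<^sub>R S p v"
    using differentiable_in_chart[OF smooth_normal c p]
    unfolding xy by (simp add: shape_operator_in_chart[OF c] D_add D_scale)
qed

section \<open>Consequences of the two generators of the symmetry group\<close>

abbreviation half_turn where "half_turn p e1 e2 e3 \<equiv> rotation_about (T p) (h p) e1 e2 e3 pi"
abbreviation third_turn where "third_turn p e1 e2 e3 \<equiv> rotation_about (T p) (h p) e3 e1 e2 (2 * pi / 3)"

lemma rotation_values:
  assumes "onb p e1 e2 e3"
  shows "half_turn p e1 e2 e3 e1 = e1" "half_turn p e1 e2 e3 e2 = (-1) *\<^sub>R e2" "half_turn p e1 e2 e3 e3 = (-1) *\<^sub>R e3"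
    "third_turn p e1 e2 e3 e1 = (-1/2) *\<^sub>R e1 + (sqrt 3 / 2) *\<^sub>R e2"
    "third_turn p e1 e2 e3 e2 = (- sqrt 3 / 2) *\<^sub>R e1 + (-1/2) *\<^sub>R e2" "third_turn p e1 e2 e3 e3 = e3"
  using assms unfolding onb_def rotation_about_def cos_120 sin_120 by simp_all

lemma symmetry_invariance:
  assumes p: "p \<in> topspace M" and g: "g \<in> symmetry_group M A F \<xi> N p"
  shows "g \<in> Bij (T p)" "u \<in> T p \<Longrightarrow> g u \<in> T p"
    and "u \<in> T p \<Longrightarrow> v \<in> T p \<Longrightarrow> h p (g u) (g v) = h p u v"
    and "u \<in> T p \<Longrightarrow> v \<in> T p \<Longrightarrow> g (a *\<^sub>R u + b *\<^sub>R v) = a *\<^sub>R g u + b *\<^sub>R g v"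
    and "u \<in> T p \<Longrightarrow> S p (g u) = g (S p u)"
    and "u \<in> T p \<Longrightarrow> v \<in> T p \<Longrightarrow> w \<in> T p \<Longrightarrow> Q p (g u) (g v) (g w) = Q p u v w"
proof -
  note G = g[unfolded symmetry_group_def Let_def, simplified]
  show B: "g \<in> Bij (T p)" using G by blast
  then show m: "u \<in> T p \<Longrightarrow> g u \<in> T p" for u
    using Bij_imp_funcset by blast
  show hh: "u \<in> T p \<Longrightarrow> v \<in> T p \<Longrightarrow> h p (g u) (g v) = h p u v" for u v
    using G by blast
  show "u \<in> T p \<Longrightarrow> v \<in> T p \<Longrightarrow> g (a *\<^sub>R u + b *\<^sub>R v) = a *\<^sub>R g u + b *\<^sub>R g v"
    and "u \<in> T p \<Longrightarrow> S p (g u) = g (S p u)"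
    using G by blast+
  have k: "u \<in> T p \<Longrightarrow> v \<in> T p \<Longrightarrow> K p (g u) (g v) = g (K p u v)" for u v
    using G by blast
  show "u \<in> T p \<Longrightarrow> v \<in> T p \<Longrightarrow> w \<in> T p \<Longrightarrow> Q p (g u) (g v) (g w) = Q p u v w"
    unfolding Q_def by (simp add: k hh difference_tensor_tangent[OF p])
qed

text \<open>The half turn negates e2 and e3, so it kills every component in which these occur an odd
  number of times. Of the others, the third turn kills 331 and 123, and applied to 111 it gives -x/8
  - 9y/8 = x for x = 111, y = 122, hence y = -x.\<close>

lemma S3_invariant_cubic:
  assumes o: "onb p e1 e2 e3"
    and g: "half_turn p e1 e2 e3 \<in> symmetry_group M A F \<xi> N p" "third_turn p e1 e2 e3 \<in> symmetry_group M A F \<xi> N p"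
  shows "Q p e1 e1 e3 = 0" "Q p e2 e2 e3 = 0" "Q p e3 e3 e3 = 0" "Q p e1 e1 e2 = 0" "Q p e2 e2 e2 = 0"
    "Q p e3 e3 e2 = 0" "Q p e3 e3 e1 = 0" "Q p e1 e2 e3 = 0" "Q p e1 e2 e2 = - Q p e1 e1 e1"
proof -
  note e = o[unfolded onb_def]
  have top: "p \<in> topspace M" and t: "e1 \<in> T p" "e2 \<in> T p" "e3 \<in> T p" using e by blast+
  note v = rotation_values[OF o]
  have l1: "Q p (a *\<^sub>R e1 + b *\<^sub>R e2) v w = a * Q p e1 v w + b * Q p e2 v w" if "v \<in> T p" "w \<in> T p" for a b v w
    using Q_linear[OF top t(1) that t(2)] .
  have l2: "Q p u (a *\<^sub>R e1 + b *\<^sub>R e2) w = a * Q p u e1 w + b * Q p u e2 w" if "u \<in> T p" "w \<in> T p" for a b u w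
    using l1[OF that] Q_commute12[OF top that(1) _ that(2)] tangent_comb[OF top t(1,2)] t by simp
  have l3: "Q p u v (a *\<^sub>R e1 + b *\<^sub>R e2) = a * Q p u v e1 + b * Q p u v e2" if "u \<in> T p" "v \<in> T p" for a b u v
    using l2[OF that] Q_commute23[OF top that] tangent_comb[OF top t(1,2)] t by simp
  have s: "Q p u v (-1 *\<^sub>R w) = - Q p u v w" "Q p u (-1 *\<^sub>R v) w = - Q p u v w" "Q p (-1 *\<^sub>R u) v w = - Q p u v w"
    if "u \<in> T p" "v \<in> T p" "w \<in> T p" for u v w
  proof -
    have 1: "Q p (-1 *\<^sub>R u) v w = - Q p u v w" if "u \<in> T p" "v \<in> T p" "w \<in> T p" for u v w
      using Q_linear[OF top that that(1), of "-1" 0] by simp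
    then have 2: "Q p u (-1 *\<^sub>R v) w = - Q p u v w" if "u \<in> T p" "v \<in> T p" "w \<in> T p" for u v w
      using that Q_commute12[OF top that] Q_commute12[OF top that(1) tangent_comb(5)[OF top that(2,2)] that(3)] by simp
    then have 3: "Q p u v (-1 *\<^sub>R w) = - Q p u v w" if "u \<in> T p" "v \<in> T p" "w \<in> T p" for u v w
      using that Q_commute23[OF top that] Q_commute23[OF top that(1,2) tangent_comb(5)[OF top that(3,3)]] by simp
    show "Q p u v (-1 *\<^sub>R w) = - Q p u v w" "Q p u (-1 *\<^sub>R v) w = - Q p u v w" "Q p (-1 *\<^sub>R u) v w = - Q p u v w"
      using 1 2 3 that by blast+
  qed
  note tn = t[THEN subspace_neg[OF subspace_tangent_space[OF top]]]
  note c12 = Q_commute12[OF top] and c23 = Q_commute23[OF top]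
  note h1 = symmetry_invariance(6)[OF top g(1)] and h2 = symmetry_invariance(6)[OF top g(2)]
  show 113: "Q p e1 e1 e3 = 0" using h1[OF t(1,1,3)] unfolding v by (simp add: s[simplified] t tn)
  show 223: "Q p e2 e2 e3 = 0" using h1[OF t(2,2,3)] unfolding v by (simp add: s[simplified] t tn)
  show "Q p e3 e3 e3 = 0" using h1[OF t(3,3,3)] unfolding v by (simp add: s[simplified] t tn)
  show 112: "Q p e1 e1 e2 = 0" using h1[OF t(1,1,2)] unfolding v by (simp add: s[simplified] t tn)
  show 222: "Q p e2 e2 e2 = 0" using h1[OF t(2,2,2)] unfolding v by (simp add: s[simplified] t tn)
  show 332: "Q p e3 e3 e2 = 0" using h1[OF t(3,3,2)] unfolding v by (simp add: s[simplified] t tn)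
  show "Q p e3 e3 e1 = 0"
    using h2[OF t(3,3,1)] 332 unfolding v l3[OF t(3,3)] by simp
  have n: "Q p e2 e1 e3 = Q p e1 e2 e3" "Q p e1 e2 e1 = 0" "Q p e2 e1 e1 = 0" "Q p e2 e1 e2 = Q p e1 e2 e2"
    "Q p e2 e2 e1 = Q p e1 e2 e2"
    using c12 c23 t 112 by metis+
  have r: "sqrt 3 * (sqrt 3 * x) = 3 * x" for x :: real by (simp flip: mult.assoc)
  show "Q p e1 e2 e3 = 0"
    using h2[OF t(1,2,3)] unfolding v
    by (simp only: l1 l2 t tangent_comb(1)[OF top]) (simp add: n r 113 223 algebra_simps)
  show "Q p e1 e2 e2 = - Q p e1 e1 e1"
    using h2[OF t(1,1,1)] unfolding v
    by (simp only: l1 l2 l3 t tangent_comb(1)[OF top]) (simp add: n r 112 222 algebra_simps)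
qed

text \<open>An operator commuting with a rotation preserves its axis: the half turn handles e1 and
  the third turn e3. Commuting with the third turn at e1 then transports the eigenvalue to
  e2.\<close>

lemma S3_invariant_shape:
  assumes o: "onb p e1 e2 e3"
    and g: "half_turn p e1 e2 e3 \<in> symmetry_group M A F \<xi> N p" "third_turn p e1 e2 e3 \<in> symmetry_group M A F \<xi> N p"
  shows "\<exists>s t. S p e1 = s *\<^sub>R e1 \<and> S p e2 = s *\<^sub>R e2 \<and> S p e3 = t *\<^sub>R e3"
proof -
  note e = o[unfolded onb_def]
  have top: "p \<in> topspace M" and t: "e1 \<in> T p" "e2 \<in> T p" "e3 \<in> T p" using e by blast+
  note v = rotation_values[OF o]
  note st = shape_operator_tangent[OF top _ t(1)]
  note i1 = symmetry_invariance(3,5)[OF top g(1)] and i2 = symmetry_invariance(3,5)[OF top g(2)]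
  have f1: "half_turn p e1 e2 e3 (S p e1) = S p e1"
    using i1(2)[OF t(1)] v by simp
  have "h p (S p e1) (-1 *\<^sub>R e2) = h p (S p e1) e2" "h p (S p e1) (-1 *\<^sub>R e3) = h p (S p e1) e3"
    using i1(1)[OF st[OF t(1)] t(2)] i1(1)[OF st[OF t(1)] t(3)] unfolding f1 v by blast+
  then have "h p (S p e1) e2 = 0" "h p (S p e1) e3 = 0"
    using metric_scale(1)[OF top st[OF t(1)], of _ "-1"] t by simp_all
  then have S1: "S p e1 = h p (S p e1) e1 *\<^sub>R e1"
    using onb_expansion[OF o st[OF t(1)]] by simp
  have f3: "third_turn p e1 e2 e3 (S p e3) = S p e3"
    using i2(2)[OF t(3)] v by simp
  have "h p (S p e3) ((-1/2) *\<^sub>R e1 + (sqrt 3 / 2) *\<^sub>R e2) = h p (S p e3) e1"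
    "h p (S p e3) ((- sqrt 3 / 2) *\<^sub>R e1 + (-1/2) *\<^sub>R e2) = h p (S p e3) e2"
    using i2(1)[OF st[OF t(3)] t(1)] i2(1)[OF st[OF t(3)] t(2)] unfolding f3 v by blast+
  then have "(-1/2) * h p (S p e3) e1 + (sqrt 3 / 2) * h p (S p e3) e2 = h p (S p e3) e1"
    "(- sqrt 3 / 2) * h p (S p e3) e1 + (-1/2) * h p (S p e3) e2 = h p (S p e3) e2"
    unfolding affine_metric_linear(1)[OF top st[OF t(3)] t(1,2)] by blast+
  then have x: "sqrt 3 * h p (S p e3) e2 = 3 * h p (S p e3) e1" "- sqrt 3 * h p (S p e3) e1 = 3 * h p (S p e3) e2"
    by (simp_all add: field_simps)
  have "sqrt 3 * (sqrt 3 * h p (S p e3) e2) = 3 * h p (S p e3) e2"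
    by (simp flip: mult.assoc)
  then have z: "h p (S p e3) e2 = 0" using x by simp
  then have "h p (S p e3) e1 = 0" using x by simp
  then have S3: "S p e3 = h p (S p e3) e3 *\<^sub>R e3"
    using onb_expansion[OF o st[OF t(3)]] z by simp
  let ?s = "h p (S p e1) e1"
  have "(-1/2) *\<^sub>R S p e1 + (sqrt 3 / 2) *\<^sub>R S p e2 = third_turn p e1 e2 e3 (?s *\<^sub>R e1 + 0 *\<^sub>R e2)"
    using i2(2)[OF t(1)] S1 unfolding v shape_operator_linear[OF top t(1,2)] by simp
  also have "\<dots> = ?s *\<^sub>R ((-1/2) *\<^sub>R e1 + (sqrt 3 / 2) *\<^sub>R e2)"
    using symmetry_invariance(4)[OF top g(2) t(1,2), of ?s 0] v by simp
  finally have "(-1/2) *\<^sub>R (?s *\<^sub>R e1) + (sqrt 3 / 2) *\<^sub>R S p e2 = ?s *\<^sub>R ((-1/2) *\<^sub>R e1 + (sqrt 3 / 2) *\<^sub>R e2)"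
    using S1 by metis
  then have "(sqrt 3 / 2) *\<^sub>R S p e2 = (sqrt 3 / 2) *\<^sub>R (?s *\<^sub>R e2)"
    by (simp add: algebra_simps)
  then have "S p e2 = ?s *\<^sub>R e2"
    by (rule scaleR_left_imp_eq[rotated]) simp
  then show ?thesis using S1 S3 by blast
qed

text \<open>If \<open>Q\<close> vanishes, h(K(u,v),w) is symmetric in u, v and skew in v, w.
  Alternating the two swaps shows that it equals its own negative.\<close>

lemma difference_tensor_zero_if:
  assumes p: "p \<in> topspace M" and 0: "\<And>u v w. u \<in> T p \<Longrightarrow> v \<in> T p \<Longrightarrow> w \<in> T p \<Longrightarrow> Q p u v w = 0"
    and t: "u \<in> T p" "v \<in> T p"
  shows "K p u v = 0"
proof -
  note kt = difference_tensor_tangent[OF p]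
  define C where "C = (\<lambda>u v w. h p (K p u v) w)"
  have s: "C u v w = C v u w" if "u \<in> T p" "v \<in> T p" for u v w
    unfolding C_def using difference_tensor_commute[OF p that] by simp
  have a: "C u v w = - C u w v" if "u \<in> T p" "v \<in> T p" "w \<in> T p" for u v w
    using 0[OF that] affine_metric_commute[OF p that(2) kt[OF that(1,3)]] unfolding Q_def C_def by simp
  have "C u v w = 0" if "u \<in> T p" "v \<in> T p" "w \<in> T p" for u v w
    using s[of u v w] s[of u w v] s[of v w u] a[of u v w] a[of w u v] a[of v w u] that by simp
  then have "h p (K p u v) (K p u v) = 0"
    using t kt unfolding C_def by simp
  then show ?thesis using metric_pos[OF p kt[OF t]] by force
qed

text \<open>The generators preserve \<open>Re (x + iy)\<^sup>3\<close>, the half turn about \<open>e3\<close> does not.\<close>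

definition harmonic_cubic :: "'a \<Rightarrow> real^4 \<Rightarrow> real^4 \<Rightarrow> real^4 \<Rightarrow> real" where
  "harmonic_cubic p e1 e2 v = (h p v e1)^3 - 3 * h p v e1 * (h p v e2)\<^sup>2"

text \<open>Membership in \<open>Bij X\<close> is part of the induction, since inverses and products
  in \<open>BijGroup\<close> unfold to restricted maps only for bijections.\<close>

lemma generate_preserves:
  assumes H: "\<And>g. g \<in> H \<Longrightarrow> g \<in> Bij X" "\<And>g x. g \<in> H \<Longrightarrow> x \<in> X \<Longrightarrow> f (g x) = f x"
    and g: "g \<in> generate (BijGroup X) H"
  shows "g \<in> Bij X \<and> (\<forall>x\<in>X. f (g x) = f x)"
  using g
proof (induction rule: generate.induct)
  case one
  have "\<one>\<^bsub>BijGroup X\<^esub> = (\<lambda>x\<in>X. x)" by (simp add: BijGroup_def)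
  then show ?case by (metis id_Bij restrict_apply')
next
  case (incl g)
  then show ?case using H by blast
next
  case (inv g)
  have b: "g ` X = X" using H(1)[OF inv] by (simp add: Bij_def bij_betw_def)
  have "f (inv_into X g x) = f x" if "x \<in> X" for x
    using H(2)[OF inv inv_into_into[of x g X]] f_inv_into_f[of x g X] that b by simp
  then show ?case
    unfolding inv_BijGroup[OF H(1)[OF inv]]
    by (intro conjI ballI restrict_inv_into_Bij H(1)[OF inv]) simp
next
  case (eng g1 g2)
  then have "f (compose X g1 g2 x) = f x" if "x \<in> X" for x
    using that Pi_mem[OF Bij_imp_funcset that] by (simp add: compose_def)
  then show ?case using eng compose_Bij[of g1 X g2] by (simp add: BijGroup_def)
qed

text \<open>With \<open>K = 0\<close> only \<open>S\<close> has to be respected, and diag(s, s, t)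
  commutes with every rotation about e3; orientation is settled by
  \<open>det_half_turn\<close>.\<close>

lemma half_turn_e3_in_symmetry_group:
  assumes o: "onb p e1 e2 e3" and sh: "S p e1 = s *\<^sub>R e1" "S p e2 = s *\<^sub>R e2" "S p e3 = t *\<^sub>R e3"
    and k: "\<And>u v. u \<in> T p \<Longrightarrow> v \<in> T p \<Longrightarrow> K p u v = 0"
  shows "half_turn p e3 e1 e2 \<in> symmetry_group M A F \<xi> N p"
proof -
  note e = o[unfolded onb_def]
  have top: "p \<in> topspace M" and te: "e1 \<in> T p" "e2 \<in> T p" "e3 \<in> T p" using e by blast+
  let ?g = "half_turn p e3 e1 e2"
  note mc = metric_of_comb[OF o]
  have g: "?g v = (- h p v e1) *\<^sub>R e1 + (- h p v e2) *\<^sub>R e2 + h p v e3 *\<^sub>R e3" if "v \<in> T p" for v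
    using that by (simp add: rotation_about_def)
  have gt: "?g v \<in> T p" if "v \<in> T p" for v
    unfolding g[OF that] by (rule mc)
  have hg: "h p (?g v) e1 = - h p v e1" "h p (?g v) e2 = - h p v e2" "h p (?g v) e3 = h p v e3" if "v \<in> T p" for v
    unfolding g[OF that] by (rule mc)+
  have gg: "?g (?g v) = v" if "v \<in> T p" for v
    using onb_expansion[OF o that] unfolding g[OF gt[OF that]] hg[OF that] by simp
  have "bij_betw ?g (T p) (T p)"
    by (rule bij_betwI[of _ _ _ ?g]) (use gt gg in auto)
  then have B: "?g \<in> Bij (T p)"
    unfolding Bij_def rotation_about_def by simp
  have lin: "?g (a *\<^sub>R u + b *\<^sub>R v) = a *\<^sub>R ?g u + b *\<^sub>R ?g v" if "u \<in> T p" "v \<in> T p" for u v a b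
    unfolding g[OF tangent_comb(1)[OF top that]] g[OF that(1)] g[OF that(2)]
      affine_metric_linear(2)[OF top te(1) that] affine_metric_linear(2)[OF top te(2) that]
      affine_metric_linear(2)[OF top te(3) that]
    by (simp add: algebra_simps)
  have hexp: "h p u v = h p u e1 * h p v e1 + h p u e2 * h p v e2 + h p u e3 * h p v e3"
    if "u \<in> T p" "v \<in> T p" for u v
  proof -
    have "h p u v = h p (h p u e1 *\<^sub>R e1 + h p u e2 *\<^sub>R e2 + h p u e3 *\<^sub>R e3) v"
      using arg_cong[OF onb_expansion[OF o that(1)], of "\<lambda>u. h p u v"] .
    also have "\<dots> = h p u e1 * h p e1 v + h p u e2 * h p e2 v + h p u e3 * h p e3 v"
      by (rule metric_comb3(1)[OF top te that(2)])
    finally show ?thesis using affine_metric_commute[OF top that(2)] te by simp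
  qed
  have iso: "h p (?g u) (?g v) = h p u v" if "u \<in> T p" "v \<in> T p" for u v
    unfolding hexp[OF gt gt, OF that] hexp[OF that] hg[OF that(1)] hg[OF that(2)] by simp
  have Sv: "S p v = (s * h p v e1) *\<^sub>R e1 + (s * h p v e2) *\<^sub>R e2 + (t * h p v e3) *\<^sub>R e3" if "v \<in> T p" for v
  proof -
    have "S p v = S p (1 *\<^sub>R (h p v e1 *\<^sub>R e1 + h p v e2 *\<^sub>R e2) + h p v e3 *\<^sub>R e3)"
      using onb_expansion[OF o that] by simp
    also have "\<dots> = 1 *\<^sub>R (h p v e1 *\<^sub>R S p e1 + h p v e2 *\<^sub>R S p e2) + h p v e3 *\<^sub>R S p e3"
      unfolding shape_operator_linear[OF top tangent_comb(1)[OF top te(1,2)] te(3)]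
        shape_operator_linear[OF top te(1,2)] ..
    finally show ?thesis by (simp add: sh mult.commute)
  qed
  have Sg: "S p (?g v) = ?g (S p v)" if "v \<in> T p" for v
  proof -
    have "S p v \<in> T p" using shape_operator_tangent[OF top that that] .
    from g[OF this] show ?thesis
      unfolding Sv[OF gt[OF that]] hg[OF that] unfolding Sv[OF that] mc by simp
  qed
  have K0: "K p (?g u) (?g v) = ?g (K p u v)" if "u \<in> T p" "v \<in> T p" for u v
    using k[OF gt gt, OF that] k[OF that] lin[OF te(1,1), of 0 0] by simp
  have vol: "induced_volume \<xi> p (?g u) (?g v) (?g w) = induced_volume \<xi> p u v w"
    if "u \<in> T p" "v \<in> T p" "w \<in> T p" for u v w
  proof -
    let ?x = "\<lambda>i::nat. if i = 1 then u else if i = 2 then v else w"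
    have "induced_volume \<xi> p (?g u) (?g v) (?g w) = induced_volume \<xi> p
        (h p u e1 *\<^sub>R e1 + h p u e2 *\<^sub>R e2 + h p u e3 *\<^sub>R e3) (h p v e1 *\<^sub>R e1 + h p v e2 *\<^sub>R e2 + h p v e3 *\<^sub>R e3)
        (h p w e1 *\<^sub>R e1 + h p w e2 *\<^sub>R e2 + h p w e3 *\<^sub>R e3)"
      using det_half_turn[of "\<lambda>i. h p (?x i) e1" e1 "\<lambda>i. h p (?x i) e2" e2 "\<lambda>i. h p (?x i) e3" e3 "\<xi> p"]
      unfolding induced_volume_def g[OF that(1)] g[OF that(2)] g[OF that(3)] by simp
    then show ?thesis
      using onb_expansion[OF o] that by simp
  qed
  show ?thesis
    unfolding symmetry_group_def Let_def using B lin iso Sg K0 vol by simp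
qed

lemma harmonic_cubic_half_turn:
  assumes o: "onb p e1 e2 e3" and v: "v \<in> T p"
  shows "harmonic_cubic p e1 e2 (half_turn p e1 e2 e3 v) = harmonic_cubic p e1 e2 v"
proof -
  have "half_turn p e1 e2 e3 v = h p v e1 *\<^sub>R e1 + (- h p v e2) *\<^sub>R e2 + (- h p v e3) *\<^sub>R e3"
    using v by (simp add: rotation_about_def)
  then show ?thesis unfolding harmonic_cubic_def by (simp only: metric_of_comb[OF o]) simp
qed

lemma harmonic_cubic_third_turn:
  assumes o: "onb p e1 e2 e3" and v: "v \<in> T p"
  shows "harmonic_cubic p e1 e2 (third_turn p e1 e2 e3 v) = harmonic_cubic p e1 e2 v"
proof -
  define x y where "x = h p v e1" and "y = h p v e2"
  have "third_turn p e1 e2 e3 v = (- x / 2 - sqrt 3 / 2 * y) *\<^sub>R e1 + (sqrt 3 / 2 * x - y / 2) *\<^sub>R e2 + h p v e3 *\<^sub>R e3"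
    using v by (simp add: rotation_about_def cos_120' sin_120' x_def y_def algebra_simps)
  then have "harmonic_cubic p e1 e2 (third_turn p e1 e2 e3 v)
      = (- x / 2 - sqrt 3 / 2 * y)^3 - 3 * (- x / 2 - sqrt 3 / 2 * y) * (sqrt 3 / 2 * x - y / 2)\<^sup>2"
    unfolding harmonic_cubic_def by (simp only: metric_of_comb[OF o])
  also have "\<dots> = ((- x - sqrt 3 * y)^3 - 3 * (- x - sqrt 3 * y) * (sqrt 3 * x - y)\<^sup>2) / 8"
    by (simp add: field_simps power2_eq_square power3_eq_cube)
  also have "(- x - sqrt 3 * y)^3 - 3 * (- x - sqrt 3 * y) * (sqrt 3 * x - y)\<^sup>2 = 8 * (x^3 - 3 * x * y\<^sup>2)"
  proof -
    \<comment> \<open>Only the relation r^2 = 3 matters: abstracting \<open>sqrt 3\<close> turns the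
      claim into a polynomial identity modulo this relation.\<close>
    have "(- x - r * y)^3 - 3 * (- x - r * y) * (r * x - y)\<^sup>2 = 8 * (x^3 - 3 * x * y\<^sup>2)" if "r * r = 3" for r :: real
    proof -
      have r: "r * (r * a) = 3 * a" for a using that by (simp flip: mult.assoc)
      show ?thesis by (simp add: r power2_eq_square power3_eq_cube algebra_simps)
    qed
    then show ?thesis by simp
  qed
  finally show ?thesis unfolding harmonic_cubic_def x_def y_def by simp
qed

lemma symmetry_frame:
  assumes sym: "pointwise_S3_symmetry M A F \<xi> N" and p: "p \<in> topspace M"
  shows "\<exists>e1 e2 e3. onb p e1 e2 e3 \<and>
    symmetry_group M A F \<xi> N p = generate (BijGroup (T p)) {half_turn p e1 e2 e3, third_turn p e1 e2 e3}"
  using sym p onb_if_orthonormal_frame[OF p] unfolding pointwise_S3_symmetry_def Let_def by meson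

lemma S3_frame_in_chart:
  assumes c: "c \<in> A" "p \<in> fst c" and o: "onb p e1 e2 e3"
    and a: "e1 = D a1 (in_chart c F) (snd c p)" "e2 = D a2 (in_chart c F) (snd c p)"
      "e3 = D a3 (in_chart c F) (snd c p)"
    and g: "half_turn p e1 e2 e3 \<in> symmetry_group M A F \<xi> N p" "third_turn p e1 e2 e3 \<in> symmetry_group M A F \<xi> N p"
  shows "equiaffine_chart.S3_frame (in_chart c F) (conormal c) (snd c p) a1 a2 a3 (Q p e1 e1 e1)"
proof -
  let ?T = "\<lambda>u. D u (in_chart c F) (snd c p)"
  let ?e1 = "?T a1" and ?e2 = "?T a2" and ?e3 = "?T a3"
  note o = o[unfolded a] and g = g[unfolded a]
  interpret equiaffine_chart "snd c ` fst c" "in_chart c F" "in_chart c \<xi>" "conormal c"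
    by (rule equiaffine_chart_in_chart[OF c(1)])
  have x: "snd c p \<in> snd c ` fst c" using c by blast
  note e = o[unfolded onb_def]
  have top: "p \<in> topspace M" using e by blast
  note inv = S3_invariant_cubic[OF o g]
  have tu: "?T u \<in> T p" for u using tangent_space_eq[OF c] by blast
  have expansion: "u = metric (snd c p) u a1 *\<^sub>R a1 + metric (snd c p) u a2 *\<^sub>R a2 + metric (snd c p) u a3 *\<^sub>R a3" for u
  proof -
    have "?T u = ?T (metric (snd c p) u a1 *\<^sub>R a1 + metric (snd c p) u a2 *\<^sub>R a2 + metric (snd c p) u a3 *\<^sub>R a3)"
      using onb_expansion[OF o tu, of u, unfolded affine_metric_in_chart[OF c]]
      unfolding D_add[OF differentiable_immersion[OF c]] D_scale[OF differentiable_immersion[OF c]] .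
    then show ?thesis using injD[OF inj_D_immersion[OF c]] by blast
  qed
  have "Q p ?e3 (?T u) (?T v) = 0" for u v
  proof -
    \<comment> \<open>Vanishing is known for basis vectors only. One slot is expanded here and the
      other one below, each moved to the first place by symmetry.\<close>
    have l: "Q p w ?e3 z = 0" if z: "z \<in> T p" and w: "w \<in> {?e1, ?e2, ?e3}"
      and 0: "Q p w ?e3 ?e1 = 0" "Q p w ?e3 ?e2 = 0" "Q p w ?e3 ?e3 = 0" for w z
    proof -
      have wt: "w \<in> T p" using w tu by blast
      have s: "Q p w ?e3 y = Q p y w ?e3" if "y \<in> T p" for y
        using Q_commute12[OF top that wt tu] Q_commute23[OF top wt that tu] by simp
      have "Q p (1 *\<^sub>R (h p z ?e1 *\<^sub>R ?e1 + h p z ?e2 *\<^sub>R ?e2) + h p z ?e3 *\<^sub>R ?e3) w ?e3 = 0"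
        using 0 s[OF tu] unfolding Q_linear[OF top tangent_comb(1)[OF top tu tu] wt tu tu]
          Q_linear[OF top tu wt tu tu] by simp
      then show ?thesis using s[OF z] onb_expansion[OF o z] by simp
    qed
    have c12: "Q p (?T x) (?T y) (?T z) = Q p (?T y) (?T x) (?T z)"
      and c23: "Q p (?T x) (?T y) (?T z) = Q p (?T x) (?T z) (?T y)" for x y z
      using Q_commute12[OF top tu tu tu] Q_commute23[OF top tu tu tu] by blast+
    have z: "Q p ?e1 ?e3 ?e1 = 0" "Q p ?e1 ?e3 ?e2 = 0" "Q p ?e1 ?e3 ?e3 = 0" "Q p ?e2 ?e3 ?e1 = 0"
      "Q p ?e2 ?e3 ?e2 = 0" "Q p ?e2 ?e3 ?e3 = 0" "Q p ?e3 ?e3 ?e1 = 0" "Q p ?e3 ?e3 ?e2 = 0" "Q p ?e3 ?e3 ?e3 = 0"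
      using inv(1-3,6-8) c12 c23 by metis+
    have i: "Q p ?e1 ?e3 (?T v) = 0" "Q p ?e2 ?e3 (?T v) = 0" "Q p ?e3 ?e3 (?T v) = 0"
      using l[OF tu] z by blast+
    have "Q p (1 *\<^sub>R (h p (?T u) ?e1 *\<^sub>R ?e1 + h p (?T u) ?e2 *\<^sub>R ?e2) + h p (?T u) ?e3 *\<^sub>R ?e3) ?e3 (?T v) = 0"
      unfolding Q_linear[OF top tangent_comb(1)[OF top tu tu] tu tu tu] Q_linear[OF top tu tu tu tu] i by simp
    then have "Q p (?T u) ?e3 (?T v) = 0"
      using onb_expansion[OF o tu, of u] by simp
    then show ?thesis using c12 by metis
  qed
  then show ?thesis
    using e inv(4,5,9) expansion
    unfolding S3_frame_def a by (simp add: Q_in_chart[OF c] affine_metric_in_chart[OF c])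
qed

lemma Q_nonzero:
  assumes p: "p \<in> topspace M" and o: "onb p e1 e2 e3"
    and G: "symmetry_group M A F \<xi> N p = generate (BijGroup (T p)) {half_turn p e1 e2 e3, third_turn p e1 e2 e3}"
  shows "Q p e1 e1 e1 \<noteq> 0"
proof
  assume 0: "Q p e1 e1 e1 = 0"
  have g: "half_turn p e1 e2 e3 \<in> symmetry_group M A F \<xi> N p" "third_turn p e1 e2 e3 \<in> symmetry_group M A F \<xi> N p"
    unfolding G by (auto intro: generate.incl)
  have t: "e1 \<in> T p" "e2 \<in> T p" "e3 \<in> T p" using o unfolding onb_def by blast+
  obtain c where c: "c \<in> A" "p \<in> fst c" using ex_chart p by blast
  interpret equiaffine_chart "snd c ` fst c" "in_chart c F" "in_chart c \<xi>" "conormal c"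
    by (rule equiaffine_chart_in_chart[OF c(1)])
  have x: "snd c p \<in> snd c ` fst c" using c by blast
  obtain a1 a2 a3 where a: "e1 = D a1 (in_chart c F) (snd c p)" "e2 = D a2 (in_chart c F) (snd c p)"
    "e3 = D a3 (in_chart c F) (snd c p)"
    using t unfolding tangent_space_eq[OF c] by blast
  have "S3_frame (snd c p) a1 a2 a3 0"
    using S3_frame_in_chart[OF c o a g] unfolding 0 .
  from S3_frame_expand(2)[OF x this] have "Q p u v w = 0" if "u \<in> T p" "v \<in> T p" "w \<in> T p" for u v w
    using that unfolding tangent_space_eq[OF c] by (auto simp: Q_in_chart[OF c])
  then have k: "K p u v = 0" if "u \<in> T p" "v \<in> T p" for u v
    using difference_tensor_zero_if[OF p _ that] by blast
  obtain s t where "S p e1 = s *\<^sub>R e1" "S p e2 = s *\<^sub>R e2" "S p e3 = t *\<^sub>R e3"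
    using S3_invariant_shape[OF o g] by blast
  then have "half_turn p e3 e1 e2 \<in> generate (BijGroup (T p)) {half_turn p e1 e2 e3, third_turn p e1 e2 e3}"
    using half_turn_e3_in_symmetry_group[OF o _ _ _ k] G by metis
  then have "harmonic_cubic p e1 e2 (half_turn p e3 e1 e2 e1) = harmonic_cubic p e1 e2 e1"
    using generate_preserves[where f = "harmonic_cubic p e1 e2"] symmetry_invariance(1)[OF p] g t
      harmonic_cubic_half_turn[OF o] harmonic_cubic_third_turn[OF o]
    by (smt (verit, ccfv_threshold) insert_iff empty_iff)
  \<comment> \<open>The invariant Re (x + iy)^3 is 1 at e1 but -1 at its image -e1.\<close>
  moreover have "half_turn p e3 e1 e2 e1 = (-1) *\<^sub>R e1 + 0 *\<^sub>R e2 + 0 *\<^sub>R e3"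
    using o by (simp add: rotation_about_def onb_def)
  ultimately show False
    using o unfolding harmonic_cubic_def by (simp only: metric_of_comb[OF o]) (simp add: onb_def)
qed

lemma shape_operator_umbilic:
  assumes sym: "pointwise_S3_symmetry M A F \<xi> N" and p: "p \<in> topspace M"
  shows "\<exists>k. \<forall>v\<in>T p. S p v = k *\<^sub>R v"
proof -
  obtain c where c: "c \<in> A" "p \<in> fst c" using ex_chart p by blast
  interpret equiaffine_chart "snd c ` fst c" "in_chart c F" "in_chart c \<xi>" "conormal c"
    by (rule equiaffine_chart_in_chart[OF c(1)])
  \<comment> \<open>Frames are provided on the whole chart, since the determinant identities are
    differentiated there; \<open>p\<close> is specialised afterwards.\<close>
  have fr: "\<exists>a1 a2 a3 l. S3_frame (snd c q) a1 a2 a3 l \<and> l \<noteq> 0 \<and>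
      (\<exists>s t. S q (D a1 (in_chart c F) (snd c q)) = s *\<^sub>R D a1 (in_chart c F) (snd c q) \<and>
        S q (D a2 (in_chart c F) (snd c q)) = s *\<^sub>R D a2 (in_chart c F) (snd c q) \<and>
        S q (D a3 (in_chart c F) (snd c q)) = t *\<^sub>R D a3 (in_chart c F) (snd c q))" if q: "q \<in> fst c" for q
  proof -
    have top: "q \<in> topspace M" using chart_subset[OF c(1)] q by blast
    obtain e1 e2 e3 where o: "onb q e1 e2 e3" and
      G: "symmetry_group M A F \<xi> N q = generate (BijGroup (T q)) {half_turn q e1 e2 e3, third_turn q e1 e2 e3}"
      using symmetry_frame[OF sym top] by blast
    have g: "half_turn q e1 e2 e3 \<in> symmetry_group M A F \<xi> N q" "third_turn q e1 e2 e3 \<in> symmetry_group M A F \<xi> N q"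
      unfolding G by (auto intro: generate.incl)
    have t: "e1 \<in> T q" "e2 \<in> T q" "e3 \<in> T q" using o unfolding onb_def by blast+
    obtain a1 a2 a3 where a: "e1 = D a1 (in_chart c F) (snd c q)" "e2 = D a2 (in_chart c F) (snd c q)"
      "e3 = D a3 (in_chart c F) (snd c q)"
      using t unfolding tangent_space_eq[OF c(1) q] by blast
    show ?thesis
      using S3_frame_in_chart[OF c(1) q o a g] Q_nonzero[OF top o G] S3_invariant_shape[OF o g]
      unfolding a by blast
  qed
  obtain a1 a2 a3 l s t where f: "S3_frame (snd c p) a1 a2 a3 l" "l \<noteq> 0"
    and sh: "S p (D a1 (in_chart c F) (snd c p)) = s *\<^sub>R D a1 (in_chart c F) (snd c p)"
      "S p (D a2 (in_chart c F) (snd c p)) = s *\<^sub>R D a2 (in_chart c F) (snd c p)"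
      "S p (D a3 (in_chart c F) (snd c p)) = t *\<^sub>R D a3 (in_chart c F) (snd c p)"
    using fr[OF c(2)] by blast
  have d: "D a1 (in_chart c \<xi>) (snd c p) = - s *\<^sub>R D a1 (in_chart c F) (snd c p)"
    "D a2 (in_chart c \<xi>) (snd c p) = - s *\<^sub>R D a2 (in_chart c F) (snd c p)"
    "D a3 (in_chart c \<xi>) (snd c p) = - t *\<^sub>R D a3 (in_chart c F) (snd c p)"
    using sh unfolding shape_operator_in_chart[OF c] by (simp_all add: minus_equation_iff[of "D _ _ _"] eq_commute)
  have "s = t"
    by (rule shape_eigenvalues_eq[OF _ f _ d]) (use fr c in blast)+
  have lin: "linear (\<lambda>u. D u (in_chart c \<xi>) (snd c p) + s *\<^sub>R D u (in_chart c F) (snd c p))"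
    using differentiable_in_chart[OF smooth_normal c p] differentiable_immersion[OF c]
    by (auto intro!: linearI simp: D_add D_scale algebra_simps)
  have "D u (in_chart c \<xi>) (snd c p) + s *\<^sub>R D u (in_chart c F) (snd c p) = 0" (is "?W u = 0") for u
  proof -
    have "?W u = ?W (metric (snd c p) u a1 *\<^sub>R a1 + metric (snd c p) u a2 *\<^sub>R a2 + metric (snd c p) u a3 *\<^sub>R a3)"
      using f(1) unfolding S3_frame_def by metis
    also have "\<dots> = metric (snd c p) u a1 *\<^sub>R ?W a1 + metric (snd c p) u a2 *\<^sub>R ?W a2 + metric (snd c p) u a3 *\<^sub>R ?W a3"
      unfolding linear_add[OF lin] linear_cmul[OF lin] ..
    also have "\<dots> = 0" unfolding d \<open>s = t\<close> by simp
    finally show ?thesis .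
  qed
  then have "S p (D u (in_chart c F) (snd c p)) = s *\<^sub>R D u (in_chart c F) (snd c p)" for u
    unfolding shape_operator_in_chart[OF c] by (metis add_eq_0_iff minus_minus)
  then show ?thesis
    unfolding tangent_space_eq[OF c] by blast
qed

end

section \<open>Constancy of the umbilic factor on connected components\<close>

context blaschke_hypersurface
begin

lemma openin_chart_vimage:
  assumes c: "c \<in> A" and B: "open B"
  shows "openin M {q \<in> fst c. snd c q \<in> B}"
proof -
  have "homeomorphic_map (subtopology M (fst c)) (top_of_set (snd c ` fst c)) (snd c)"
    using manifold c unfolding smooth_manifold3_def split_def by blast
  then have cont: "continuous_map (subtopology M (fst c)) (top_of_set (snd c ` fst c)) (snd c)"
    by (rule homeomorphic_imp_continuous_map)
  have "openin (top_of_set (snd c ` fst c)) (snd c ` fst c \<inter> B)"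
    using B by blast
  from openin_continuous_map_preimage[OF cont this]
  have "openin (subtopology M (fst c)) {q \<in> fst c. snd c q \<in> B}"
    using chart_subset[OF c] by (auto simp: Int_absorb1 elim!: back_subst[of "openin _"])
  then show ?thesis
    using openin_trans_full openin_chart[OF c] by blast
qed

lemma umbilic_factor_locally_constant:
  assumes k: "\<And>p v. p \<in> topspace M \<Longrightarrow> v \<in> tangent_space A F p \<Longrightarrow> shape_operator A F \<xi> p v = k p *\<^sub>R v"
    and p: "p \<in> topspace M"
  shows "\<exists>V. openin M V \<and> p \<in> V \<and> (\<forall>q\<in>V. k q = k p)"
proof -
  obtain c where c: "c \<in> A" "p \<in> fst c" using ex_chart p by blast
  let ?S = "snd c ` fst c" and ?k = "in_chart c k"
  interpret equiaffine_chart ?S "in_chart c F" "in_chart c \<xi>" "conormal c"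
    by (rule equiaffine_chart_in_chart[OF c(1)])
  have D: "D u (in_chart c \<xi>) x = - ?k x *\<^sub>R D u (in_chart c F) x" if "x \<in> ?S" for x u
  proof -
    obtain q where q: "q \<in> fst c" "x = snd c q" using \<open>x \<in> ?S\<close> by blast
    have top: "q \<in> topspace M" using q chart_subset[OF c(1)] by blast
    have "- dir_deriv A F q (D u (in_chart c F) x) \<xi> = k q *\<^sub>R D u (in_chart c F) x"
      using k[OF top, of "D u (in_chart c F) x"] tangent_space_eq[OF c(1) q(1)] q
      unfolding shape_operator_def by blast
    then have "- D u (in_chart c \<xi>) x = k q *\<^sub>R D u (in_chart c F) x"
      using dir_deriv_eq[OF c(1) q(1) differentiable_in_chart[OF smooth_normal c(1) q(1) top]] q by simp
    then show ?thesis
      using in_chart_apply[OF c(1) q(1), of k] q by (metis minus_minus scaleR_minus_left)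
  qed
  \<comment> \<open>As a pointwise factor, \<open>k\<close> comes with no regularity. Pairing D
    \<xi> = -k dF with the first dual vector expresses it through smooth maps.\<close>
  have eq: "- (D (axis 1 1) (in_chart c \<xi>) x \<bullet> dual c 1 x) = ?k x" if x: "x \<in> ?S" for x
    using D[OF x, of "axis 1 1"] frame_inner_dual[OF c(1) x, of 1 1] by (simp add: frame_def vector_4)
  have "smooth_on ?S (\<lambda>x. - (D (axis 1 1) (in_chart c \<xi>) x \<bullet> dual c 1 x))"
    by (rule smooth_on_linear[OF bounded_linear_minus[OF bounded_linear_ident] open_S
          smooth_on_inner[OF open_S smooth_D(2) smooth_dual[OF c(1)]]])
  then have "smooth_on ?S ?k"
    by (rule smooth_on_cong[OF open_S, where g = ?k, rotated]) (rule eq)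
  then have d: "?k differentiable (at x)" if "x \<in> ?S" for x
    using smooth_on_differentiable that by blast
  have "snd c p \<in> ?S" using c by blast
  then obtain r where r: "r > 0" "ball (snd c p) r \<subseteq> ?S"
    using open_S openE by blast
  have "(?k has_derivative (\<lambda>v. 0)) (at x within ball (snd c p) r)" if "x \<in> ball (snd c p) r" for x
  proof -
    have x: "x \<in> ?S" using that r by blast
    have "(?k has_derivative (\<lambda>v. D v ?k x)) (at x)"
      by (rule D_has_derivative[OF d[OF x]])
    moreover have "D v ?k x = 0" for v
      by (rule umbilic_factor_derivative[OF x D d[OF x]])
    ultimately show ?thesis by (simp add: has_derivative_at_withinI)
  qed
  then obtain b where b: "\<And>x. x \<in> ball (snd c p) r \<Longrightarrow> ?k x = b"
    using has_derivative_zero_constant[of "ball (snd c p) r" ?k] by auto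
  have kb: "k q = b" if "q \<in> fst c" "snd c q \<in> ball (snd c p) r" for q
    using b[OF that(2)] in_chart_apply[OF c(1) that(1), of k] by simp
  have "k p = b" by (rule kb) (use c r in auto)
  then show ?thesis
    using openin_chart_vimage[OF c(1) open_ball[of "snd c p" r]] c r kb
    by (intro exI[of _ "{q \<in> fst c. snd c q \<in> ball (snd c p) r}"]) auto
qed

lemma umbilic_imp_affine_hypersphere:
  assumes "\<And>p. p \<in> topspace M \<Longrightarrow> \<exists>k. \<forall>v\<in>tangent_space A F p. shape_operator A F \<xi> p v = k *\<^sub>R v"
  shows "affine_hypersphere M A F \<xi>"
proof -
  obtain k where k: "\<And>p v. p \<in> topspace M \<Longrightarrow> v \<in> tangent_space A F p \<Longrightarrow> shape_operator A F \<xi> p v = k p *\<^sub>R v"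
    using assms by metis
  \<comment> \<open>Local constancy makes the preimage of any set of values open, so level sets are
    clopen and contain every connected set they meet.\<close>
  have op: "openin M {q \<in> topspace M. P (k q)}" for P
  proof (subst openin_subopen, intro ballI)
    fix q assume "q \<in> {q \<in> topspace M. P (k q)}"
    then obtain V where "openin M V" "q \<in> V" "\<forall>x\<in>V. k x = k q" "P (k q)"
      using umbilic_factor_locally_constant[OF k, of q] by blast
    then show "\<exists>V. openin M V \<and> q \<in> V \<and> V \<subseteq> {q \<in> topspace M. P (k q)}"
      using openin_subset by (intro exI[of _ V]) fastforce
  qed
  have "k p = k q" if pq: "connected_component_of M p q" for p q
  proof -
    obtain C where C: "connectedin M C" "p \<in> C" "q \<in> C"
      using pq unfolding connected_component_of_def by blast
    let ?E = "{x \<in> topspace M. k x = k p}"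
    have "topspace M - ?E = {x \<in> topspace M. k x \<noteq> k p}" by blast
    then have "closedin M ?E"
      using op[of "\<lambda>y. y \<noteq> k p"] by (simp add: closedin_def)
    then have "C \<subseteq> ?E \<or> disjnt C ?E"
      using connectedin_clopen_cases[OF C(1)] op[of "\<lambda>y. y = k p"] by blast
    moreover have "p \<in> ?E" using C connectedin_subset_topspace by blast
    ultimately show ?thesis using C unfolding disjnt_def by auto
  qed
  then show ?thesis
    unfolding affine_hypersphere_def using k by blast
qed

end

theorem mainTheorem3:
  fixes M :: "'m topology"
    and A :: "'m chart set"
    and F \<xi> :: "'m \<Rightarrow> real^4"
    and nabla_hat :: "'m \<Rightarrow> real^4 \<Rightarrow> ('m \<Rightarrow> real^4) \<Rightarrow> real^4"
  assumes "affine_hypersurface M A F \<xi>"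
    and "positive_definite M A F \<xi>"
    and "levi_civita_connection M A F (affine_metric M A F \<xi>) nabla_hat"
    and "pointwise_S3_symmetry M A F \<xi> nabla_hat"
  shows "affine_hypersphere M A F \<xi>"
proof -
  interpret positive_blaschke M A F \<xi> nabla_hat
    using assms by unfold_locales
  show ?thesis
    by (rule umbilic_imp_affine_hypersphere[OF shape_operator_umbilic[OF assms(4)]])
qed

end
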